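(* Let $\{X_k:k\in\mathbb{N}\}$ be a sequence of nontrivial Banach spaces (all real or all complex) such that each of them is either a uniformly convex space, or $C(K)$ for some compact Hausdorff space $K$, or $L_1(\mu)$ for some measure $\mu$. Let $A=\{k\in\mathbb{N}:X_k\text{ is a uniformly convex space}\}$ and assume that $\inf\{\delta_k(\varepsilon):k\in A\}>0$ for every $\varepsilon>0$, where $\delta_k$ is the modulus of convexity of $X_k$. Then the pair $\big(\ell_1,\big(\oplus\sum_{k=1}^\infty X_k\big)_{\ell_p}\big)$ satisfies the Bishop-Phelps-Bollobás property for operators (BPBp) for every $1\le p<\infty$.
   Context: For a normed space $X$, $S_X$ and $B_X$ denote its unit sphere and closed unit ball. $\mathcal{L}(X,Y)$ is the space of bounded linear operators from $X$ to $Y$ with the operator norm. All spaces (including $\ell_1$) are over the same scalar field, $\mathbb{R}$ or $\mathbb{C}$. A pair $(X,Y)$ of Banach spaces has the BPBp if for every $\varepsilon>0$ there exists $\eta(\varepsilon)>0$ such that for any $T\in S_{\mathcal{L}(X,Y)}$ and any $x\in S_X$ with $\|Tx\|>1-\eta(\varepsilon)$, there exist $u\in S_X$ and $S\in S_{\mathcal{L}(X,Y)}$ with $\|Su\|=1$, $\|u-x\|<\varepsilon$ and $\|S-T\|<\varepsilon$. The modulus of convexity of $X$ is $\delta_X(\varepsilon)=\inf\{1-\|x+y\|/2:x,y\in B_X,\ \|x-y\|\ge\varepsilon\}$ (with $\inf\varnothing=+\infty$); $X$ is uniformly convex if $\delta_X(\varepsilon)>0$ for all $\varepsilon>0$. $\big(\oplus\sum_{k=1}^\infty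 X_k\big)_{\ell_p}$ is the Banach space of sequences $(x_k)$ with $x_k\in X_k$ and $(\|x_k\|)\in\ell_p$, normed by $\|(x_k)\|=\big(\sum_k\|x_k\|^p\big)^{1/p}$. *)

theory Defs
  imports "HOL-Analysis.Analysis" "HOL-Library.Function_Algebras"
begin

(* The scalar field is R or C: a type of this class is isometrically isomorphic,
   as a real normed algebra, to one of the two.  Both are instances. *)
class real_or_complex = real_normed_field + banach + second_countable_topology +
  fixes to_complex :: "'a \<Rightarrow> complex"
  assumes to_complex_add: "to_complex (a + b) = to_complex a + to_complex b"
    and to_complex_mult: "to_complex (a * b) = to_complex a * to_complex b"
    and to_complex_scaleR: "to_complex (r *\<^sub>R a) = r *\<^sub>R to_complex a"
    and norm_to_complex: "norm (to_complex a) = norm a"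
    and range_to_complex: "range to_complex = \<real> \<or> range to_complex = UNIV"

instantiation real :: real_or_complex
begin
definition to_complex_real :: "real \<Rightarrow> complex" where "to_complex_real = complex_of_real"
instance
  by standard (auto simp: to_complex_real_def scaleR_conv_of_real Reals_def)
end

instantiation complex :: real_or_complex
begin
definition to_complex_complex :: "complex \<Rightarrow> complex" where "to_complex_complex = (\<lambda>z. z)"
instance
  by standard (auto simp: to_complex_complex_def)
end

(* The members of a sequence of Banach spaces are unrelated spaces, so a space is a value:
   a set of vectors with its own scalar multiplication and norm.  Only the addition is that
   of the ambient type.  This loses nothing: a sequence of vector spaces embeds in its direct
   sum.  The operations are unconstrained outside the set of vectors. *)
record ('k, 'a) nspace =
  vectors :: "'a set"
  scale :: "'k \<Rightarrow> 'a \<Rightarrow> 'a"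
  nrm :: "'a \<Rightarrow> real"

locale normed_space_on =
  fixes X :: "('k::real_or_complex, 'a::ab_group_add) nspace"
  assumes zero_mem: "0 \<in> vectors X"
    and add_mem: "\<lbrakk>x \<in> vectors X; y \<in> vectors X\<rbrakk> \<Longrightarrow> x + y \<in> vectors X"
    and scale_mem: "x \<in> vectors X \<Longrightarrow> scale X c x \<in> vectors X"
    and scale_add_right: "\<lbrakk>x \<in> vectors X; y \<in> vectors X\<rbrakk>
      \<Longrightarrow> scale X c (x + y) = scale X c x + scale X c y"
    and scale_add_left: "x \<in> vectors X \<Longrightarrow> scale X (c + d) x = scale X c x + scale X d x"
    and scale_scale: "x \<in> vectors X \<Longrightarrow> scale X c (scale X d x) = scale X (c * d) x"
    and scale_one: "x \<in> vectors X \<Longrightarrow> scale X 1 x = x"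
    and nrm_eq_0_iff: "x \<in> vectors X \<Longrightarrow> nrm X x = 0 \<longleftrightarrow> x = 0"
    and nrm_triangle: "\<lbrakk>x \<in> vectors X; y \<in> vectors X\<rbrakk> \<Longrightarrow> nrm X (x + y) \<le> nrm X x + nrm X y"
    and nrm_scale: "x \<in> vectors X \<Longrightarrow> nrm X (scale X c x) = norm c * nrm X x"

locale banach_space_on = normed_space_on +
  assumes complete: "\<lbrakk>\<And>n. s n \<in> vectors X;
      \<And>e. e > 0 \<Longrightarrow> \<exists>N. \<forall>m\<ge>N. \<forall>n\<ge>N. nrm X (s m - s n) < e\<rbrakk>
    \<Longrightarrow> \<exists>l\<in>vectors X. (\<lambda>n. nrm X (s n - l)) \<longlonglongrightarrow> 0"

definition unit_sphere :: "('k, 'a) nspace \<Rightarrow> 'a set" where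
  "unit_sphere X = {x \<in> vectors X. nrm X x = 1}"

definition unit_ball :: "('k, 'a) nspace \<Rightarrow> 'a set" where
  "unit_ball X = {x \<in> vectors X. nrm X x \<le> 1}"

(* Operators are HOL functions of which only the values on the vectors of the domain matter. *)
definition linear_op ::
  "('k, 'a::plus) nspace \<Rightarrow> ('k, 'b::plus) nspace \<Rightarrow> ('a \<Rightarrow> 'b) \<Rightarrow> bool" where
  "linear_op X Y T \<longleftrightarrow>
     (\<forall>x\<in>vectors X. T x \<in> vectors Y) \<and>
     (\<forall>x\<in>vectors X. \<forall>y\<in>vectors X. T (x + y) = T x + T y) \<and>
     (\<forall>c. \<forall>x\<in>vectors X. T (scale X c x) = scale Y c (T x))"

definition bounded_op ::
  "('k, 'a::plus) nspace \<Rightarrow> ('k, 'b::plus) nspace \<Rightarrow> ('a \<Rightarrow> 'b) \<Rightarrow> bool" where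
  "bounded_op X Y T \<longleftrightarrow>
     linear_op X Y T \<and> (\<exists>C. \<forall>x\<in>vectors X. nrm Y (T x) \<le> C * nrm X x)"

definition op_norm :: "('k, 'a) nspace \<Rightarrow> ('k, 'b) nspace \<Rightarrow> ('a \<Rightarrow> 'b) \<Rightarrow> real" where
  "op_norm X Y T = (SUP x\<in>unit_ball X. nrm Y (T x))"

definition BPBp :: "('k, 'a::ab_group_add) nspace \<Rightarrow> ('k, 'b::ab_group_add) nspace \<Rightarrow> bool" where
  "BPBp X Y \<longleftrightarrow>
     (\<forall>\<epsilon>>0. \<exists>\<eta>>0. \<forall>T x.
        bounded_op X Y T \<and> op_norm X Y T = 1 \<and> x \<in> unit_sphere X \<and> nrm Y (T x) > 1 - \<eta> \<longrightarrow>
        (\<exists>u S. u \<in> unit_sphere X \<and> bounded_op X Y S \<and> op_norm X Y S = 1 \<and>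
           nrm Y (S u) = 1 \<and> nrm X (u - x) < \<epsilon> \<and> op_norm X Y (\<lambda>z. S z - T z) < \<epsilon>))"

(* The infimum is taken in the extended reals, where that of the empty set is infinity. *)
definition modulus_of_convexity :: "('k, 'a::ab_group_add) nspace \<Rightarrow> real \<Rightarrow> ereal" where
  "modulus_of_convexity X \<epsilon> =
     Inf {ereal (1 - nrm X (x + y) / 2) | x y.
            x \<in> unit_ball X \<and> y \<in> unit_ball X \<and> nrm X (x - y) \<ge> \<epsilon>}"

definition uniformly_convex :: "('k, 'a::ab_group_add) nspace \<Rightarrow> bool" where
  "uniformly_convex X \<longleftrightarrow> (\<forall>\<epsilon>>0. modulus_of_convexity X \<epsilon> > 0)"

(* Continuous functions on K are represented by their extensions by 0 to the whole type;
   inserting 0 makes the supremum well behaved for empty K. *)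
definition C_space :: "'t topology \<Rightarrow> ('k::real_or_complex, 't \<Rightarrow> 'k) nspace" where
  "C_space K = \<lparr>vectors = {f. continuous_map K euclidean f \<and> (\<forall>t. t \<notin> topspace K \<longrightarrow> f t = 0)},
     scale = (\<lambda>c f t. c * f t),
     nrm = (\<lambda>f. Sup (insert 0 ((\<lambda>t. norm (f t)) ` topspace K)))\<rparr>"

(* The seminormed space of integrable functions, before functions that agree almost
   everywhere are identified. *)
definition L1_functions :: "'s measure \<Rightarrow> ('k::real_or_complex, 's \<Rightarrow> 'k) nspace" where
  "L1_functions M = \<lparr>vectors = {f. integrable M f},
     scale = (\<lambda>c f t. c * f t),
     nrm = (\<lambda>f. \<integral>t. norm (f t) \<partial>M)\<rparr>"

(* A norm-preserving linear map of Z onto X has kernel {z. nrm Z z = 0}.  So X is isometrically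
   isomorphic to Z if Z is normed, and in general to Z modulo the null vectors of its seminorm;
   for L1_functions M this quotient is the usual space of a.e. equivalence classes. *)
definition isometric_to :: "('k, 'a::plus) nspace \<Rightarrow> ('k, 'z::plus) nspace \<Rightarrow> bool" where
  "isometric_to X Z \<longleftrightarrow>
     (\<exists>\<Phi>. linear_op Z X \<Phi> \<and> \<Phi> ` vectors Z = vectors X \<and>
          (\<forall>z\<in>vectors Z. nrm X (\<Phi> z) = nrm Z z))"

definition ell1 :: "('k::real_or_complex, nat \<Rightarrow> 'k) nspace" where
  "ell1 = \<lparr>vectors = {a. summable (\<lambda>n. norm (a n))},
     scale = (\<lambda>c a n. c * a n),
     nrm = (\<lambda>a. \<Sum>n. norm (a n))\<rparr>"

definition lp_sum :: "real \<Rightarrow> (nat \<Rightarrow> ('k, 'a) nspace) \<Rightarrow> ('k, nat \<Rightarrow> 'a) nspace" where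
  "lp_sum p X = \<lparr>vectors = {x. (\<forall>k. x k \<in> vectors (X k)) \<and>
                              summable (\<lambda>k. nrm (X k) (x k) powr p)},
     scale = (\<lambda>c x k. scale (X k) c (x k)),
     nrm = (\<lambda>x. (\<Sum>k. nrm (X k) (x k) powr p) powr (1 / p))\<rparr>"

end

(* Call vectors z_n aligned if |sum b_n z_n| = sum b_n |z_n| for all b_n >= 0.  An operator from
   ell_1 is determined by the images of the unit vectors, so one may change finitely many of these
   images freely; hence BPBp for (ell_1, Y) follows once finitely many vectors y_n of Y with
   |sum y_n| close to sum |y_n| are close, in the mean weighted by norms, to aligned vectors of the
   same norms (a finite form of the approximate hyperplane series property that needs no
   functionals).

   This holds with uniform constants in each of the three classes.  In a uniformly convex space take
   multiples of the direction of the sum; in C(K) move all functions at a point where the sum attains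
   its norm; in L_1 replace f_n by |f_n| times the phase of the sum.  The property passes to ell_p
   sums: align in every coordinate and, for p > 1, use that equality in Young's inequality forces the
   normalised sequences of coordinate norms to be close to a single sequence. *)
theory Submission
imports Defs
begin

subsection \<open>Normed spaces and operators\<close>

text \<open>Alignment asks for vectors that work for all weights b at once. Its use forces this: the
  new operator has to attain its norm at a renormalised part of x, and which part survives is known
  only after errors have been compared index by index.

  The constant \<eta> may depend on \<epsilon> alone, not on the number of vectors or on the
  coordinate. The distance estimates in the three classes are therefore linear in norms and norm
  deficits, as in t a + (2 a - c) / t, so that they can be summed over indices or integrated.

  In an l_p sum with p > 1, alignment in each coordinate is not enough: vectors whose sequences of
  coordinate norms are not proportional have a sum of strictly smaller norm. The aligned vectors
  must share one profile u, and where u is positive but a given vector vanishes they still need a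
  direction. Hence unit vectors are produced in every coordinate, even for zero vectors, and here
  nontriviality of the spaces enters. Proportionality is tested against u^(p-1), the functional that
  norms u.\<close>

lemma sum_fun_eval: "(\<Sum>i\<in>I. f i) x = (\<Sum>i\<in>I. f i x)"
  by (induction I rule: infinite_finite_induct) auto

context normed_space_on
begin

lemma scale_zero_left: "x \<in> vectors X \<Longrightarrow> scale X 0 x = 0"
  using scale_add_left[of x 0 0] by simp

lemma scale_zero_right: "scale X c 0 = 0"
  using scale_add_right[of 0 0 c] zero_mem by simp

lemma scale_minus_one: "x \<in> vectors X \<Longrightarrow> scale X (-1) x = - x"
  using scale_add_left[of x 1 "-1"] scale_one[of x] scale_zero_left[of x]
  by (simp add: add_eq_0_iff)

lemma minus_mem: "x \<in> vectors X \<Longrightarrow> - x \<in> vectors X"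
  using scale_mem[of x "-1"] by (simp add: scale_minus_one)

lemma diff_mem: "x \<in> vectors X \<Longrightarrow> y \<in> vectors X \<Longrightarrow> x - y \<in> vectors X"
  using add_mem[of x "- y"] minus_mem by simp

lemma nrm_minus: "x \<in> vectors X \<Longrightarrow> nrm X (- x) = nrm X x"
  using nrm_scale[of x "-1"] by (simp add: scale_minus_one)

lemma nrm_zero: "nrm X 0 = 0"
  using nrm_eq_0_iff zero_mem by simp

lemma nrm_nonneg: "x \<in> vectors X \<Longrightarrow> 0 \<le> nrm X x"
  using nrm_triangle[of x "- x"] minus_mem[of x] nrm_minus[of x] nrm_zero by simp

lemma nrm_diff_le: "x \<in> vectors X \<Longrightarrow> y \<in> vectors X \<Longrightarrow> nrm X (x - y) \<le> nrm X x + nrm X y"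
  using nrm_triangle[of x "- y"] minus_mem nrm_minus by simp

lemma scale_diff_right:
  "x \<in> vectors X \<Longrightarrow> y \<in> vectors X \<Longrightarrow> scale X c (x - y) = scale X c x - scale X c y"
  using scale_add_right[of "x - y" y c] diff_mem by (simp add: algebra_simps)

lemma scale_diff_left:
  "x \<in> vectors X \<Longrightarrow> scale X (c - d) x = scale X c x - scale X d x"
  using scale_add_left[of x "c - d" d] by (simp add: algebra_simps)

lemma sum_mem: "(\<And>i. i \<in> I \<Longrightarrow> f i \<in> vectors X) \<Longrightarrow> sum f I \<in> vectors X"
  by (induction I rule: infinite_finite_induct) (auto simp: zero_mem add_mem)

lemma scale_sum_right:
  "(\<And>i. i \<in> I \<Longrightarrow> f i \<in> vectors X) \<Longrightarrow> scale X c (sum f I) = (\<Sum>i\<in>I. scale X c (f i))"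
  by (induction I rule: infinite_finite_induct)
    (auto simp: scale_zero_right scale_add_right sum_mem)

lemma scale_sum_left:
  "x \<in> vectors X \<Longrightarrow> scale X (sum c I) x = (\<Sum>i\<in>I. scale X (c i) x)"
  by (induction I rule: infinite_finite_induct)
    (auto simp: scale_zero_left scale_add_left)

lemma nrm_sum_le:
  "(\<And>i. i \<in> I \<Longrightarrow> f i \<in> vectors X) \<Longrightarrow> nrm X (sum f I) \<le> (\<Sum>i\<in>I. nrm X (f i))"
proof (induction I rule: infinite_finite_induct)
  case (insert i I)
  then show ?case
    using nrm_triangle[of "f i" "sum f I"] sum_mem[of I f] by fastforce
qed (auto simp: nrm_zero)

end

lemma bounded_op_nrm_le:
  assumes "normed_space_on X" "normed_space_on Y" "bounded_op X Y T" "x \<in> vectors X"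
  shows "nrm Y (T x) \<le> op_norm X Y T * nrm X x"
proof -
  interpret X: normed_space_on X by fact
  interpret Y: normed_space_on Y by fact
  have lin: "linear_op X Y T" using assms(3) by (simp add: bounded_op_def)
  obtain C where C: "\<And>x. x \<in> vectors X \<Longrightarrow> nrm Y (T x) \<le> C * nrm X x"
    using assms(3) by (auto simp: bounded_op_def)
  have Tm: "T x \<in> vectors Y" if "x \<in> vectors X" for x
    using lin that by (simp add: linear_op_def)
  show ?thesis
  proof (cases "nrm X x = 0")
    case True
    then show ?thesis using C[OF assms(4)] Y.nrm_nonneg[OF Tm[OF assms(4)]] by simp
  next
    case False
    then have pos: "nrm X x > 0" using X.nrm_nonneg[OF assms(4)] by simp
    define c :: 'a where "c = of_real (inverse (nrm X x))"
    define u where "u = scale X c x"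
    have u: "u \<in> vectors X" using X.scale_mem assms(4) by (simp add: u_def)
    have "nrm X u = 1" using pos by (simp add: u_def c_def X.nrm_scale assms(4) norm_inverse)
    then have ub: "u \<in> unit_ball X" using u by (simp add: unit_ball_def)
    \<comment> \<open>\<open>op_norm\<close> is a supremum of reals, so it dominates its members
      only once boundedness is known. The absolute value covers a negative \<open>C\<close>.\<close>
    have "bdd_above ((\<lambda>x. nrm Y (T x)) ` unit_ball X)"
    proof (rule bdd_aboveI2)
      fix x assume "x \<in> unit_ball X"
      then have x: "x \<in> vectors X" "nrm X x \<le> 1" by (auto simp: unit_ball_def)
      have "C * nrm X x \<le> \<bar>C\<bar> * 1"
        by (rule mult_mono) (use x X.nrm_nonneg in auto)
      then show "nrm Y (T x) \<le> \<bar>C\<bar>" using C[OF x(1)] by simp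
    qed
    then have "nrm Y (T u) \<le> op_norm X Y T"
      unfolding op_norm_def by (rule cSUP_upper[OF ub])
    moreover have "nrm Y (T u) = inverse (nrm X x) * nrm Y (T x)"
      using lin assms(4) pos
      by (simp add: u_def linear_op_def Y.nrm_scale Tm c_def norm_inverse)
    ultimately show ?thesis using pos by (simp add: field_simps)
  qed
qed

lemma op_norm_le:
  assumes "normed_space_on X" "0 \<le> c"
    and "\<And>x. x \<in> vectors X \<Longrightarrow> nrm Y (T x) \<le> c * nrm X x"
  shows "op_norm X Y T \<le> c"
  unfolding op_norm_def
proof (rule cSUP_least)
  interpret normed_space_on X by fact
  show "unit_ball X \<noteq> {}" using zero_mem nrm_zero by (auto simp: unit_ball_def)
  fix x assume "x \<in> unit_ball X"
  then have "x \<in> vectors X" "nrm X x \<le> 1" by (auto simp: unit_ball_def)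
  then show "nrm Y (T x) \<le> c"
    using assms(3)[of x] mult_left_mono[of "nrm X x" 1 c] assms(2) by simp
qed

text \<open>Bare closure hypotheses replace \<open>normed_space_on X\<close> because the domain may
  be \<open>L1_functions\<close>, which is only seminormed. Membership of the sum is part of the
  conclusion since the induction needs it.\<close>

lemma linear_op_sum:
  assumes "linear_op X Y T" "0 \<in> vectors X"
    and "\<And>x y. x \<in> vectors X \<Longrightarrow> y \<in> vectors X \<Longrightarrow> x + y \<in> vectors X"
    and "\<And>i. i \<in> I \<Longrightarrow> f i \<in> vectors X"
  shows "sum f I \<in> vectors X \<and> T (sum f I) = (\<Sum>i\<in>I. T (f i) :: 'b::ab_group_add)"
proof -
  have "T (0 + 0) = T 0 + T 0" using assms(1,2) unfolding linear_op_def by blast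
  then have "T 0 = 0" by simp
  then show ?thesis using assms(4)
    by (induction I rule: infinite_finite_induct)
      (use assms(1-3) in \<open>auto simp: linear_op_def\<close>)
qed

text \<open>The vectors \<open>z n\<close> have the norms of the \<open>y n\<close> (take \<open>b\<close> a unit vector). Vectors are not
  normalised, and the weights of a convex series are absorbed into them.\<close>

definition approx_alignable :: "('k::real_or_complex, 'a::ab_group_add) nspace \<Rightarrow> real \<Rightarrow> real \<Rightarrow> bool" where
  "approx_alignable Y \<eta> \<epsilon> \<longleftrightarrow>
     (\<forall>(I :: nat set) y. finite I \<and> (\<forall>n\<in>I. y n \<in> vectors Y) \<and>
        (1 - \<eta>) * (\<Sum>n\<in>I. nrm Y (y n)) \<le> nrm Y (\<Sum>n\<in>I. y n) \<longrightarrow>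
        (\<exists>z. (\<forall>n\<in>I. z n \<in> vectors Y) \<and>
           (\<forall>b. (\<forall>n\<in>I. 0 \<le> b n) \<longrightarrow>
              nrm Y (\<Sum>n\<in>I. scale Y (of_real (b n)) (z n)) = (\<Sum>n\<in>I. b n * nrm Y (y n))) \<and>
           (\<Sum>n\<in>I. nrm Y (y n - z n)) \<le> \<epsilon> * (\<Sum>n\<in>I. nrm Y (y n))))"

lemma approx_alignableE:
  assumes "approx_alignable Y \<eta> \<epsilon>" "finite (I :: nat set)" "\<And>n. n \<in> I \<Longrightarrow> y n \<in> vectors Y"
    and "(1 - \<eta>) * (\<Sum>n\<in>I. nrm Y (y n)) \<le> nrm Y (\<Sum>n\<in>I. y n)"
  obtains z where "\<And>n. n \<in> I \<Longrightarrow> z n \<in> vectors Y"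
    and "\<And>b. (\<And>n. n \<in> I \<Longrightarrow> 0 \<le> b n) \<Longrightarrow>
        nrm Y (\<Sum>n\<in>I. scale Y (of_real (b n)) (z n)) = (\<Sum>n\<in>I. b n * nrm Y (y n))"
    and "(\<Sum>n\<in>I. nrm Y (y n - z n)) \<le> \<epsilon> * (\<Sum>n\<in>I. nrm Y (y n))"
proof -
  have "\<exists>z. (\<forall>n\<in>I. z n \<in> vectors Y) \<and>
      (\<forall>b. (\<forall>n\<in>I. 0 \<le> b n) \<longrightarrow>
         nrm Y (\<Sum>n\<in>I. scale Y (of_real (b n)) (z n)) = (\<Sum>n\<in>I. b n * nrm Y (y n))) \<and>
      (\<Sum>n\<in>I. nrm Y (y n - z n)) \<le> \<epsilon> * (\<Sum>n\<in>I. nrm Y (y n))"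
    by (rule assms(1)[unfolded approx_alignable_def, rule_format]) (use assms(2-) in simp)
  then show ?thesis using that by blast
qed

section \<open>The space \<open>ell1\<close>, its unit vectors and finite restrictions\<close>

lemma vectors_ell1: "a \<in> vectors ell1 \<longleftrightarrow> summable (\<lambda>n. norm (a n))"
  by (simp add: ell1_def)

lemma nrm_ell1: "nrm ell1 a = (\<Sum>n. norm (a n))"
  by (simp add: ell1_def)

lemma scale_ell1: "scale ell1 c a = (\<lambda>n. c * a n)"
  by (simp add: ell1_def)

lemma normed_space_ell1: "normed_space_on (ell1 :: ('k::real_or_complex, _) nspace)"
proof
  fix x y :: "nat \<Rightarrow> 'k" and c d :: 'k
  show "0 \<in> vectors (ell1 :: ('k, _) nspace)" by (simp add: vectors_ell1)
  assume x: "x \<in> vectors ell1"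
  show "scale ell1 c x \<in> vectors ell1"
    using x by (simp add: vectors_ell1 scale_ell1 norm_mult summable_mult)
  show "scale ell1 (c + d) x = scale ell1 c x + scale ell1 d x"
    "scale ell1 c (scale ell1 d x) = scale ell1 (c * d) x" "scale ell1 1 x = x"
    by (auto simp: scale_ell1 algebra_simps)
  show "nrm ell1 x = 0 \<longleftrightarrow> x = 0"
    using x suminf_eq_zero_iff[of "\<lambda>n. norm (x n)"]
    by (auto simp: nrm_ell1 vectors_ell1 fun_eq_iff)
  show "nrm ell1 (scale ell1 c x) = norm c * nrm ell1 x"
    using x by (simp add: nrm_ell1 scale_ell1 norm_mult suminf_mult vectors_ell1)
  assume y: "y \<in> vectors ell1"
  have s: "summable (\<lambda>n. norm (x n) + norm (y n))"
    using x y by (simp add: vectors_ell1 summable_add)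
  show xy: "x + y \<in> vectors ell1"
    unfolding vectors_ell1
    by (rule summable_comparison_test'[OF s, of 0]) (simp add: norm_triangle_ineq)
  show "scale ell1 c (x + y) = scale ell1 c x + scale ell1 c y"
    by (auto simp: scale_ell1 algebra_simps)
  show "nrm ell1 (x + y) \<le> nrm ell1 x + nrm ell1 y"
    using suminf_le[OF _ _ s, of "\<lambda>n. norm ((x + y) n)"] xy x y
    by (simp add: nrm_ell1 vectors_ell1 norm_triangle_ineq suminf_add)
qed

definition unit_seq :: "nat \<Rightarrow> nat \<Rightarrow> 'k::real_or_complex" where
  "unit_seq n = (\<lambda>m. if m = n then 1 else 0)"

definition restrict_seq :: "nat set \<Rightarrow> (nat \<Rightarrow> 'k::real_or_complex) \<Rightarrow> nat \<Rightarrow> 'k" where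
  "restrict_seq J a = (\<lambda>n. if n \<in> J then a n else 0)"

lemma unit_seq_mem: "unit_seq n \<in> vectors ell1"
  unfolding vectors_ell1 unit_seq_def
  by (rule summable_finite[of "{n}"]) auto

lemma nrm_unit_seq: "nrm ell1 (unit_seq n) = 1"
  unfolding nrm_ell1 unit_seq_def
  by (subst suminf_finite[of "{n}"]) auto

lemma restrict_seq_mem: "finite J \<Longrightarrow> restrict_seq J a \<in> vectors ell1"
  unfolding vectors_ell1 restrict_seq_def
  by (rule summable_finite[of J]) auto

lemma nrm_restrict_seq: "finite J \<Longrightarrow> nrm ell1 (restrict_seq J a) = (\<Sum>n\<in>J. norm (a n))"
  unfolding nrm_ell1 restrict_seq_def
  by (subst suminf_finite[of J]) auto

text \<open>The norm of \<open>ell1\<close> is additive over disjoint supports. This is what allows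
  the images of unit vectors to be replaced by other vectors of the unit ball without the operator
  norm exceeding 1.\<close>

lemma nrm_diff_restrict_seq:
  assumes "finite J" "a \<in> vectors ell1"
  shows "nrm ell1 (a - restrict_seq J a) = nrm ell1 a - (\<Sum>n\<in>J. norm (a n))"
proof -
  have "nrm ell1 (a - restrict_seq J a) = (\<Sum>n. norm (a n) - norm (restrict_seq J a n))"
    unfolding nrm_ell1 by (rule suminf_cong) (auto simp: restrict_seq_def)
  also have "\<dots> = nrm ell1 a - nrm ell1 (restrict_seq J a)"
    using assms restrict_seq_mem[of J a] by (simp add: nrm_ell1 vectors_ell1 suminf_diff)
  finally show ?thesis using assms by (simp add: nrm_restrict_seq)
qed

lemma linear_op_restrict_seq:
  assumes "linear_op ell1 Y T" "finite J"
  shows "T (restrict_seq J a) = (\<Sum>n\<in>J. scale Y (a n) (T (unit_seq n)) :: 'b::ab_group_add)"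
proof -
  interpret normed_space_on "ell1 :: ('a, _) nspace" by (rule normed_space_ell1)
  have "restrict_seq J a = (\<Sum>n\<in>J. scale ell1 (a n) (unit_seq n))"
    using assms(2)
    by (auto simp: fun_eq_iff sum_fun_eval scale_ell1 unit_seq_def restrict_seq_def if_distrib
        sum.delta cong: if_cong)
  then show ?thesis
    using linear_op_sum[OF assms(1) zero_mem add_mem, of J "\<lambda>n. scale ell1 (a n) (unit_seq n)",
        OF _ _ scale_mem[OF unit_seq_mem]] assms(1)
    by (simp add: linear_op_def unit_seq_mem)
qed

subsection \<open>From alignment to the Bishop-Phelps-Bollobas property\<close>

lemma ex_truncation_ell1:
  assumes "x \<in> vectors ell1" "0 < e"
  shows "\<exists>I. finite I \<and> nrm ell1 x - (\<Sum>n\<in>I. norm (x n)) \<le> e"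
proof -
  have "(\<lambda>n. norm (x n)) sums nrm ell1 x"
    using assms(1) by (simp add: nrm_ell1 vectors_ell1 summable_sums)
  then have "(\<lambda>N. \<Sum>n<N. norm (x n)) \<longlonglongrightarrow> nrm ell1 x" by (simp add: sums_def)
  then obtain N where "dist (\<Sum>n<N. norm (x n)) (nrm ell1 x) < e"
    using assms(2) by (metis LIMSEQ_iff_nz dist_real_def real_norm_def order_refl)
  then show ?thesis by (intro exI[of _ "{..<N}"]) (auto simp: dist_real_def)
qed

text \<open>A Markov argument. Alignability is applied to the vectors \<open>x n\<close> times the
  image of the n-th unit vector; the errors \<open>q n\<close> have sum at most \<delta> squared, so
  the indices with \<open>q n\<close> above \<delta> times the modulus of \<open>x n\<close> carry
  mass at most \<delta>. At the remaining indices the aligned vector can be normalised and the phase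
  of \<open>x n\<close> divided out at a cost of at most \<delta>.\<close>

lemma ex_good_indices:
  assumes Y: "normed_space_on Y" and "finite I" and "0 < \<delta>" "\<delta> < 1" "0 \<le> \<epsilon>"
    and lin: "linear_op ell1 Y T"
    and T1: "\<And>a. a \<in> vectors ell1 \<Longrightarrow> nrm Y (T a) \<le> nrm ell1 a"
    and approx: "approx_alignable Y \<eta> \<epsilon>"
    and x: "(\<Sum>n\<in>I. norm (x n)) \<le> 1"
    and Tx: "1 - \<theta> \<le> nrm Y (T (restrict_seq I x))" and \<theta>: "\<theta> \<le> \<eta>" "\<theta> \<le> 1" "\<epsilon> + \<theta> \<le> \<delta>\<^sup>2"
  shows "\<exists>J z. J \<subseteq> I \<and> (\<forall>n\<in>J. z n \<in> vectors Y \<and> x n \<noteq> 0 \<and> nrm Y (z n - T (unit_seq n)) \<le> \<delta>) \<and>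
    (\<forall>c. (\<forall>n\<in>J. 0 \<le> c n) \<longrightarrow>
       nrm Y (\<Sum>n\<in>J. scale Y (of_real (c n)) (scale Y (x n) (z n))) = (\<Sum>n\<in>J. c n * norm (x n))) \<and>
    (\<Sum>n\<in>I - J. norm (x n)) \<le> \<delta>"
proof -
  interpret Y: normed_space_on Y by fact
  interpret E: normed_space_on "ell1 :: ('a, _) nspace" by (rule normed_space_ell1)
  define y where "y n = scale Y (x n) (T (unit_seq n))" for n
  define r where "r n = nrm Y (y n)" for n
  have Te: "T (unit_seq n) \<in> vectors Y" for n
    using lin unit_seq_mem by (auto simp: linear_op_def)
  have Te1: "nrm Y (T (unit_seq n)) \<le> 1" for n
    using T1[OF unit_seq_mem, of n] by (simp add: nrm_unit_seq)
  have y: "y n \<in> vectors Y" for n by (simp add: y_def Y.scale_mem Te)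
  have r0: "0 \<le> r n" for n by (simp add: r_def Y.nrm_nonneg y)
  have rx: "r n \<le> norm (x n)" for n
    using mult_left_mono[OF Te1[of n], of "norm (x n)"] by (simp add: r_def y_def Y.nrm_scale Te)
  have Ty: "T (restrict_seq I x) = (\<Sum>n\<in>I. y n)"
    using linear_op_restrict_seq[OF lin \<open>finite I\<close>, of x] by (simp add: y_def)
  have sumr: "(\<Sum>n\<in>I. r n) \<le> 1"
    using sum_mono[of I r "\<lambda>n. norm (x n)"] rx x by fastforce
  have sumr': "1 - \<theta> \<le> (\<Sum>n\<in>I. r n)"
    using Y.nrm_sum_le[of I y] y Tx Ty by (simp add: r_def)
  \<comment> \<open>The bound 1 - \<theta> is absolute, whereas alignability wants one relative to
    the sum of the norms. That sum is at most 1, so the absolute bound suffices.\<close>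
  have "(1 - \<eta>) * (\<Sum>n\<in>I. r n) \<le> (1 - \<theta>) * 1"
  proof -
    have "(1 - \<eta>) * (\<Sum>n\<in>I. r n) \<le> (1 - \<theta>) * (\<Sum>n\<in>I. r n)"
      by (rule mult_right_mono) (use \<theta> sum_nonneg[of I r] r0 in auto)
    also have "\<dots> \<le> (1 - \<theta>) * 1" by (rule mult_left_mono) (use \<theta> sumr in auto)
    finally show ?thesis .
  qed
  then have "(1 - \<eta>) * (\<Sum>n\<in>I. nrm Y (y n)) \<le> nrm Y (\<Sum>n\<in>I. y n)"
    using Tx Ty by (simp add: r_def)
  then obtain w where w: "\<And>n. n \<in> I \<Longrightarrow> w n \<in> vectors Y"
    and al: "\<And>b. (\<And>n. n \<in> I \<Longrightarrow> 0 \<le> b n) \<Longrightarrow>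
        nrm Y (\<Sum>n\<in>I. scale Y (of_real (b n)) (w n)) = (\<Sum>n\<in>I. b n * r n)"
    and close: "(\<Sum>n\<in>I. nrm Y (y n - w n)) \<le> \<epsilon> * (\<Sum>n\<in>I. r n)"
    unfolding r_def by (rule approx_alignableE[OF approx \<open>finite I\<close> y]) blast+
  have nw: "nrm Y (w n) = r n" if "n \<in> I" for n
  proof -
    have "(\<Sum>m\<in>I. scale Y (of_real (if m = n then 1 else 0)) (w m)) = (\<Sum>m\<in>I. if m = n then w n else 0)"
      by (rule sum.cong) (auto simp: Y.scale_one Y.scale_zero_left w)
    then show ?thesis
      using al[of "\<lambda>m. if m = n then 1 else 0"] that \<open>finite I\<close>
      by (simp add: sum.delta' if_distrib[of "\<lambda>c. c * _"] cong: if_cong)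
  qed
  \<comment> \<open>Both errors at index n: the distance to the aligned vector, and the norm lost
    because T may shrink the n-th unit vector.\<close>
  define q where "q n = nrm Y (y n - w n) + (norm (x n) - r n)" for n
  have q0: "0 \<le> q n" if "n \<in> I" for n
    using Y.nrm_nonneg[OF Y.diff_mem[OF y w]] that rx[of n] by (simp add: q_def add_nonneg_nonneg)
  have "\<epsilon> * (\<Sum>n\<in>I. r n) + (1 - (\<Sum>n\<in>I. r n)) \<le> \<epsilon> + \<theta>"
    using mult_left_mono[OF sumr \<open>0 \<le> \<epsilon>\<close>] sumr' by simp
  then have sumq: "(\<Sum>n\<in>I. q n) \<le> \<delta>\<^sup>2"
    using close x \<theta>(3) by (simp add: q_def sum.distrib sum_subtractf)
  define J where "J = {n\<in>I. 0 < r n \<and> q n \<le> \<delta> * norm (x n)}"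
  have J: "J \<subseteq> I" "finite J" using \<open>finite I\<close> by (auto simp: J_def)
  \<comment> \<open>\<open>w n\<close> has norm \<open>r n\<close>, possibly less than the modulus
    of \<open>x n\<close>. The real factor restores the length, and division by \<open>x n\<close>
    makes \<open>z n\<close> a unit vector.\<close>
  define z where "z n = scale Y (of_real (norm (x n) / r n) / x n) (w n)" for n
  have nzJ: "x n \<noteq> 0" "0 < r n" "n \<in> I" if "n \<in> J" for n
    using that rx[of n] by (auto simp: J_def)
  have xz: "scale Y (x n) (z n) = scale Y (of_real (norm (x n) / r n)) (w n)" if "n \<in> J" for n
    using nzJ[OF that] by (simp add: z_def Y.scale_scale w)
  have z: "z n \<in> vectors Y" if "n \<in> J" for n
    using nzJ[OF that] by (simp add: z_def Y.scale_mem w)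
  have near: "nrm Y (z n - T (unit_seq n)) \<le> \<delta>" if "n \<in> J" for n
  proof -
    note n = nzJ[OF that]
    define \<kappa> where "\<kappa> = norm (x n) / r n - 1"
    have \<kappa>: "0 \<le> \<kappa>" using rx[of n] n by (simp add: \<kappa>_def)
    have "scale Y (x n) (z n - T (unit_seq n)) = scale Y (of_real (1 + \<kappa>)) (w n) - y n"
      using n xz[OF that] by (simp add: \<kappa>_def Y.scale_diff_right z that Te y_def)
    \<comment> \<open>The stretch by 1 + \<kappa> costs \<kappa> times \<open>r n\<close>, which is
      exactly the second summand of \<open>q n\<close>.\<close>
    also have "\<dots> = scale Y (of_real \<kappa>) (w n) - (y n - w n)"
      using n by (simp add: Y.scale_add_left w Y.scale_one)
    finally have "norm (x n) * nrm Y (z n - T (unit_seq n)) =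
        nrm Y (scale Y (of_real \<kappa>) (w n) - (y n - w n))"
      by (metis Y.nrm_scale Y.diff_mem z[OF that] Te)
    also have "\<dots> \<le> \<kappa> * r n + nrm Y (y n - w n)"
      using Y.nrm_diff_le[of "scale Y (of_real \<kappa>) (w n)" "y n - w n"] n w y \<kappa>
      by (simp add: Y.scale_mem Y.diff_mem Y.nrm_scale nw)
    also have "\<dots> = q n" using n by (simp add: \<kappa>_def q_def field_simps)
    also have "\<dots> \<le> norm (x n) * \<delta>" using that by (simp add: J_def mult.commute)
    finally show ?thesis using n by simp
  qed
  have align: "nrm Y (\<Sum>n\<in>J. scale Y (of_real (c n)) (scale Y (x n) (z n))) = (\<Sum>n\<in>J. c n * norm (x n))"
    if c: "\<forall>n\<in>J. 0 \<le> c n" for c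
  proof -
    define b where "b n = (if n \<in> J then c n * (norm (x n) / r n) else 0)" for n
    have "(\<Sum>n\<in>J. scale Y (of_real (c n)) (scale Y (x n) (z n))) = (\<Sum>n\<in>I. scale Y (of_real (b n)) (w n))"
    proof (rule sum.mono_neutral_cong_left[OF \<open>finite I\<close> J(1)])
      show "\<forall>n\<in>I - J. scale Y (of_real (b n)) (w n) = 0"
        by (simp add: b_def Y.scale_zero_left w)
      fix n assume n: "n \<in> J"
      show "scale Y (of_real (c n)) (scale Y (x n) (z n)) = scale Y (of_real (b n)) (w n)"
        using n nzJ[OF n] unfolding xz[OF n] by (simp add: b_def Y.scale_scale w)
    qed
    also have "nrm Y \<dots> = (\<Sum>n\<in>I. b n * r n)"
      using c r0 by (intro al) (simp add: b_def)
    also have "\<dots> = (\<Sum>n\<in>J. c n * norm (x n))"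
      by (rule sum.mono_neutral_cong_right[OF \<open>finite I\<close> J(1)]) (auto simp: b_def dest: nzJ)
    finally show ?thesis .
  qed
  have "\<delta> * (\<Sum>n\<in>I - J. norm (x n)) \<le> (\<Sum>n\<in>I - J. q n)"
    unfolding sum_distrib_left
  proof (rule sum_mono)
    fix n assume n: "n \<in> I - J"
    show "\<delta> * norm (x n) \<le> q n"
    \<comment> \<open>An index with \<open>r n = 0\<close> is left out of \<open>J\<close> for want
      of a direction. It is still paid for, since \<open>q n\<close> is then at least the modulus of
      \<open>x n\<close>, and \<delta> < 1.\<close>
    proof (cases "r n = 0")
      case True
      then have "norm (x n) \<le> q n"
        using n Y.nrm_nonneg[OF Y.diff_mem[OF y w], of n] by (simp add: q_def)
      moreover have "\<delta> * norm (x n) \<le> 1 * norm (x n)"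
        by (rule mult_right_mono) (use \<open>\<delta> < 1\<close> in auto)
      ultimately show ?thesis by simp
    next
      case False
      then show ?thesis using n r0[of n] by (auto simp: J_def)
    qed
  qed
  also have "\<dots> \<le> (\<Sum>n\<in>I. q n)"
    by (rule sum_mono2) (use \<open>finite I\<close> q0 in auto)
  finally have "\<delta> * (\<Sum>n\<in>I - J. norm (x n)) \<le> \<delta> * \<delta>" using sumq by (simp add: power2_eq_square)
  then have "(\<Sum>n\<in>I - J. norm (x n)) \<le> \<delta>" using \<open>0 < \<delta>\<close> by simp
  then show ?thesis
    using J(1) z near nzJ(1) align by (intro exI[of _ J] exI[of _ z] conjI ballI) simp_all
qed

text \<open>\<open>S\<close> differs from \<open>T\<close> only at the unit vectors indexed by
  \<open>J\<close>, where it takes the values \<open>z n\<close>. It is a contraction because the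
  norm of \<open>ell1\<close> splits over \<open>J\<close> and its complement; it attains its norm
  at the normalised restriction of x to \<open>J\<close> because the vectors \<open>x n\<close>
  times \<open>z n\<close> are aligned.\<close>

lemma BPBp_ell1:
  fixes Y :: "('k::real_or_complex, 'a::ab_group_add) nspace"
  assumes Y: "normed_space_on Y"
    and approx: "\<And>\<epsilon>. 0 < \<epsilon> \<Longrightarrow> \<exists>\<eta>>0. approx_alignable Y \<eta> \<epsilon>"
  shows "BPBp ell1 Y"
  unfolding BPBp_def
proof (intro allI impI)
  interpret Y: normed_space_on Y by fact
  interpret E: normed_space_on "ell1 :: ('k, _) nspace" by (rule normed_space_ell1)
  fix \<epsilon> :: real assume "0 < \<epsilon>"
  \<comment> \<open>The mass \<sigma> of x on \<open>J\<close> will be at least 1 - 2 \<delta>. The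
    bound 1/4 keeps it away from 0; \<epsilon> / 8 gives 2 (1 - \<sigma>) \<le> 4 \<delta> <
    \<epsilon>.\<close>
  define \<delta> where "\<delta> = min (1/4) (\<epsilon> / 8)"
  have \<delta>: "0 < \<delta>" "\<delta> \<le> 1/4" "\<delta> \<le> \<epsilon> / 8" using \<open>0 < \<epsilon>\<close> by (auto simp: \<delta>_def)
  obtain \<eta>1 where \<eta>1: "0 < \<eta>1" "approx_alignable Y \<eta>1 (\<delta>\<^sup>2 / 2)"
    using approx[of "\<delta>\<^sup>2 / 2"] \<delta>(1) by auto
  \<comment> \<open>One \<eta> is lost because T x has norm only above 1 - \<eta>, another by
    truncating x. So \<theta> = 2 \<eta> is used below, and with the alignment error it must stay
    within \<delta> squared.\<close>
  define \<eta> where "\<eta> = min (\<eta>1 / 2) (\<delta>\<^sup>2 / 4)"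
  have \<eta>: "0 < \<eta>" "2 * \<eta> \<le> \<eta>1" "2 * \<eta> \<le> \<delta>\<^sup>2 / 2" using \<eta>1(1) \<delta>(1) by (auto simp: \<eta>_def)
  have \<delta>2: "\<delta>\<^sup>2 \<le> \<delta>" using \<delta> by (simp add: power2_eq_square mult_left_le)
  show "\<exists>\<eta>>0. \<forall>T x. bounded_op ell1 Y T \<and> op_norm ell1 Y T = 1 \<and> x \<in> unit_sphere ell1 \<and>
      1 - \<eta> < nrm Y (T x) \<longrightarrow>
      (\<exists>u S. u \<in> unit_sphere ell1 \<and> bounded_op ell1 Y S \<and> op_norm ell1 Y S = 1 \<and>
        nrm Y (S u) = 1 \<and> nrm ell1 (u - x) < \<epsilon> \<and> op_norm ell1 Y (\<lambda>z. S z - T z) < \<epsilon>)"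
  proof (intro exI[of _ \<eta>] conjI allI impI \<eta>(1), elim conjE)
    fix T and x :: "nat \<Rightarrow> 'k"
    assume T: "bounded_op ell1 Y T" "op_norm ell1 Y T = 1" and xs: "x \<in> unit_sphere ell1"
      and Tx: "1 - \<eta> < nrm Y (T x)"
    have lin: "linear_op ell1 Y T" using T(1) by (simp add: bounded_op_def)
    have T1: "nrm Y (T a) \<le> nrm ell1 a" if "a \<in> vectors ell1" for a
      using bounded_op_nrm_le[OF normed_space_ell1 Y T(1) that] T(2) by simp
    have Tm: "T a \<in> vectors Y" if "a \<in> vectors ell1" for a
      using lin that by (simp add: linear_op_def)
    have Te: "T (unit_seq n) \<in> vectors Y" for n using Tm unit_seq_mem by blast
    have Tadd: "T (a + b) = T a + T b" if "a \<in> vectors ell1" "b \<in> vectors ell1" for a b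
      using lin that by (simp add: linear_op_def)
    have x: "x \<in> vectors ell1" "nrm ell1 x = 1" using xs by (auto simp: unit_sphere_def)
    obtain I where I: "finite I" "1 - (\<Sum>n\<in>I. norm (x n)) \<le> \<eta>"
      using ex_truncation_ell1[OF x(1) \<eta>(1)] x(2) by auto
    have Tsplit: "nrm Y (T a) \<le> nrm ell1 (a - restrict_seq K a) + nrm Y (T (restrict_seq K a))"
      if "a \<in> vectors ell1" "finite K" for a K
      using Tadd[of "a - restrict_seq K a" "restrict_seq K a"]
        Y.nrm_triangle[OF Tm Tm, of "a - restrict_seq K a" "restrict_seq K a"]
        T1[of "a - restrict_seq K a"] E.diff_mem that restrict_seq_mem[of K a] by simp
    have x1: "(\<Sum>n\<in>I. norm (x n)) \<le> 1"
      using nrm_diff_restrict_seq[OF I(1) x(1)] x(2)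
        E.nrm_nonneg[OF E.diff_mem[OF x(1) restrict_seq_mem[OF I(1), of x]]] by simp
    have "1 - 2 * \<eta> \<le> nrm Y (T (restrict_seq I x))"
      using Tsplit[OF x(1) I(1)] nrm_diff_restrict_seq[OF I(1) x(1)] x(2) I(2) Tx by simp
    from ex_good_indices[OF Y I(1) \<delta>(1) _ _ lin T1 \<eta>1(2) x1 this]
    obtain J z where J: "J \<subseteq> I"
      and z: "\<And>n. n \<in> J \<Longrightarrow> z n \<in> vectors Y"
      and near: "\<And>n. n \<in> J \<Longrightarrow> nrm Y (z n - T (unit_seq n)) \<le> \<delta>"
      and align: "\<And>c. (\<forall>n\<in>J. 0 \<le> c n) \<Longrightarrow>
         nrm Y (\<Sum>n\<in>J. scale Y (of_real (c n)) (scale Y (x n) (z n))) = (\<Sum>n\<in>J. c n * norm (x n))"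
      and xz: "\<And>n. n \<in> J \<Longrightarrow> x n \<noteq> 0" and bad: "(\<Sum>n\<in>I - J. norm (x n)) \<le> \<delta>"
      using \<eta> \<delta> \<delta>2 by (auto simp: field_simps)
    have fJ: "finite J" using J I(1) finite_subset by blast
    have z1: "nrm Y (z n) = 1" if n: "n \<in> J" for n
    proof -
      have "(\<Sum>m\<in>J. scale Y (of_real (if m = n then 1 else 0)) (scale Y (x m) (z m))) =
          (\<Sum>m\<in>J. if m = n then scale Y (x n) (z n) else 0)"
        by (rule sum.cong) (auto simp: Y.scale_one Y.scale_zero_left z Y.scale_mem)
      then have "nrm Y (scale Y (x n) (z n)) = norm (x n)"
        using align[of "\<lambda>m. if m = n then 1 else 0"] n fJ
        by (simp add: sum.delta' if_distrib[of "\<lambda>c. c * _"] cong: if_cong)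
      then show ?thesis using xz[OF n] by (simp add: Y.nrm_scale z n)
    qed
    define \<sigma> where "\<sigma> = (\<Sum>n\<in>J. norm (x n))"
    \<comment> \<open>The missing mass consists of the truncated tail, at most \<eta> \<le>
      \<delta>, and the rejected indices, at most \<delta>.\<close>
    have \<sigma>: "1 - 2 * \<delta> \<le> \<sigma>" "\<sigma> \<le> 1"
    proof -
      have "(\<Sum>n\<in>I. norm (x n)) = (\<Sum>n\<in>I - J. norm (x n)) + \<sigma>"
        unfolding \<sigma>_def by (rule sum.subset_diff[OF J I(1)])
      moreover have "0 \<le> (\<Sum>n\<in>I - J. norm (x n))" by (simp add: sum_nonneg)
      ultimately show "1 - 2 * \<delta> \<le> \<sigma>" "\<sigma> \<le> 1" using x1 I(2) bad \<eta> \<delta>2 \<delta> by auto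
    qed
    then have \<sigma>0: "0 < \<sigma>" using \<delta> by simp
    define u where "u = scale ell1 (of_real (inverse \<sigma>)) (restrict_seq J x)"
    define S where "S a = T a + (\<Sum>n\<in>J. scale Y (a n) (z n - T (unit_seq n)))" for a
    have g: "z n - T (unit_seq n) \<in> vectors Y" if "n \<in> J" for n using Y.diff_mem z Te that by simp
    have gm: "(\<Sum>n\<in>J. scale Y (a n) (z n - T (unit_seq n))) \<in> vectors Y" for a
      by (rule Y.sum_mem) (simp add: Y.scale_mem g)
    \<comment> \<open>\<open>S_def\<close> shows that \<open>S\<close> is near \<open>T\<close>;
      this second form, with disjointly supported parts of \<open>a\<close>, shows that
      \<open>S\<close> is a contraction.\<close>
    have S_alt: "S a = T (a - restrict_seq J a) + (\<Sum>n\<in>J. scale Y (a n) (z n))"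
      if a: "a \<in> vectors ell1" for a
      using Tadd[of "a - restrict_seq J a" "restrict_seq J a"] linear_op_restrict_seq[OF lin fJ, of a]
        E.diff_mem a restrict_seq_mem[OF fJ, of a]
      by (simp add: S_def Y.scale_diff_right z Te sum_subtractf)
    have u: "u \<in> vectors ell1" by (simp add: u_def E.scale_mem restrict_seq_mem fJ)
    have nu: "nrm ell1 u = 1"
      using \<sigma>0 by (simp add: u_def E.nrm_scale restrict_seq_mem fJ nrm_restrict_seq norm_inverse flip: \<sigma>_def)
    have linS: "linear_op ell1 Y S"
      unfolding linear_op_def
    proof (intro conjI ballI allI)
      fix a b :: "nat \<Rightarrow> 'k" and c assume a: "a \<in> vectors ell1"
      show "S a \<in> vectors Y" unfolding S_def by (intro Y.add_mem Tm a gm)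
      have "T (scale ell1 c a) = scale Y c (T a)" using lin a by (simp add: linear_op_def)
      then show "S (scale ell1 c a) = scale Y c (S a)"
        by (simp add: S_def gm Tm a Y.scale_add_right Y.scale_sum_right Y.scale_mem g
            Y.scale_scale scale_ell1)
      assume b: "b \<in> vectors ell1"
      show "S (a + b) = S a + S b"
        by (simp add: S_def Tadd a b Y.scale_add_left g sum.distrib)
    qed
    have S1: "nrm Y (S a) \<le> nrm ell1 a" if a: "a \<in> vectors ell1" for a
    proof -
      have "nrm Y (S a) \<le> nrm Y (T (a - restrict_seq J a)) + nrm Y (\<Sum>n\<in>J. scale Y (a n) (z n))"
        unfolding S_alt[OF a]
        by (intro Y.nrm_triangle Tm E.diff_mem a restrict_seq_mem fJ Y.sum_mem Y.scale_mem z)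
      moreover have "nrm Y (T (a - restrict_seq J a)) \<le> nrm ell1 (a - restrict_seq J a)"
        by (intro T1 E.diff_mem a restrict_seq_mem fJ)
      moreover have "nrm Y (\<Sum>n\<in>J. scale Y (a n) (z n)) \<le> (\<Sum>n\<in>J. norm (a n))"
        using Y.nrm_sum_le[of J "\<lambda>n. scale Y (a n) (z n)"] by (simp add: Y.scale_mem z Y.nrm_scale z1)
      ultimately show ?thesis using nrm_diff_restrict_seq[OF fJ a] by simp
    qed
    have bS: "bounded_op ell1 Y S"
      using linS S1 by (auto simp: bounded_op_def intro!: exI[of _ 1])
    have "S u = (\<Sum>n\<in>J. scale Y (of_real (inverse \<sigma>)) (scale Y (x n) (z n)))"
    proof -
      have "u - restrict_seq J u = 0"
        by (auto simp: u_def scale_ell1 restrict_seq_def)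
      moreover have "T 0 = 0" using Tadd[of 0 0] E.zero_mem by simp
      ultimately have "S u = (\<Sum>n\<in>J. scale Y (u n) (z n))" by (simp add: S_alt[OF u])
      also have "\<dots> = (\<Sum>n\<in>J. scale Y (of_real (inverse \<sigma>)) (scale Y (x n) (z n)))"
        by (rule sum.cong) (auto simp: u_def scale_ell1 restrict_seq_def Y.scale_scale z)
      finally show ?thesis .
    qed
    then have Su: "nrm Y (S u) = 1"
      using align[of "\<lambda>_. inverse \<sigma>"] \<sigma>0 by (simp add: sum_distrib_left[symmetric] flip: \<sigma>_def)
    have "op_norm ell1 Y S = 1"
    proof (rule antisym)
      show "op_norm ell1 Y S \<le> 1"
        by (rule op_norm_le[OF normed_space_ell1]) (auto simp: S1)
      show "1 \<le> op_norm ell1 Y S"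
        using bounded_op_nrm_le[OF normed_space_ell1 Y bS u] nu Su by simp
    qed
    moreover have "nrm ell1 (u - x) < \<epsilon>"
    proof -
      define \<tau> where "\<tau> = inverse \<sigma> - 1"
      have \<tau>: "0 \<le> \<tau>" using \<sigma> \<sigma>0 by (simp add: \<tau>_def one_le_inverse)
      \<comment> \<open>Two parts of equal size: stretching x on \<open>J\<close> costs \<tau>
        \<sigma> = 1 - \<sigma>, and dropping x outside \<open>J\<close> costs 1 - \<sigma>.\<close>
      have "u - x = scale ell1 (of_real \<tau>) (restrict_seq J x) - (x - restrict_seq J x)"
        by (simp add: fun_eq_iff u_def scale_ell1 \<tau>_def algebra_simps)
      then have "nrm ell1 (u - x) = nrm ell1 (scale ell1 (of_real \<tau>) (restrict_seq J x) - (x - restrict_seq J x))"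
        by (rule arg_cong)
      also have "\<dots> \<le> nrm ell1 (scale ell1 (of_real \<tau>) (restrict_seq J x)) +
          nrm ell1 (x - restrict_seq J x)"
        by (intro E.nrm_diff_le E.scale_mem E.diff_mem restrict_seq_mem fJ x(1))
      also have "\<dots> = \<tau> * \<sigma> + (1 - \<sigma>)"
        using \<tau> by (simp add: E.nrm_scale restrict_seq_mem fJ nrm_restrict_seq nrm_diff_restrict_seq x \<sigma>_def)
      also have "\<dots> = 2 * (1 - \<sigma>)" using \<sigma>0 by (simp add: \<tau>_def field_simps)
      also have "\<dots> < \<epsilon>" using \<sigma> \<delta> \<open>0 < \<epsilon>\<close> by simp
      finally show ?thesis .
    qed
    moreover have "op_norm ell1 Y (\<lambda>z. S z - T z) < \<epsilon>"
    proof -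
      have "nrm Y (S a - T a) \<le> \<delta> * nrm ell1 a" if a: "a \<in> vectors ell1" for a
      proof -
        have "nrm Y (S a - T a) \<le> (\<Sum>n\<in>J. norm (a n) * nrm Y (z n - T (unit_seq n)))"
          using Y.nrm_sum_le[of J "\<lambda>n. scale Y (a n) (z n - T (unit_seq n))"]
          by (simp add: S_def Y.nrm_scale Y.scale_mem g)
        also have "\<dots> \<le> (\<Sum>n\<in>J. norm (a n) * \<delta>)"
          by (intro sum_mono mult_left_mono near) auto
        also have "\<dots> = \<delta> * (\<Sum>n\<in>J. norm (a n))" by (simp add: sum_distrib_left mult.commute)
        also have "\<dots> \<le> \<delta> * nrm ell1 a"
          using nrm_diff_restrict_seq[OF fJ a]
            E.nrm_nonneg[OF E.diff_mem[OF a restrict_seq_mem[OF fJ, of a]]] \<delta>(1)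
          by (intro mult_left_mono) auto
        finally show ?thesis .
      qed
      then have "op_norm ell1 Y (\<lambda>z. S z - T z) \<le> \<delta>"
        using \<delta>(1) by (intro op_norm_le[OF normed_space_ell1]) auto
      then show ?thesis using \<delta> \<open>0 < \<epsilon>\<close> by simp
    qed
    ultimately show "\<exists>u S. u \<in> unit_sphere ell1 \<and> bounded_op ell1 Y S \<and> op_norm ell1 Y S = 1 \<and>
        nrm Y (S u) = 1 \<and> nrm ell1 (u - x) < \<epsilon> \<and> op_norm ell1 Y (\<lambda>z. S z - T z) < \<epsilon>"
      using u nu bS Su by (intro exI[of _ u] exI[of _ S]) (simp add: unit_sphere_def)
  qed
qed

subsection \<open>Alignment in spaces of continuous and of integrable functions\<close>

text \<open>The embedding \<open>to_complex\<close> is additive and isometric, so the Euclidean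
  geometry of the complex plane carries over to the scalar field. This is how the restriction to
  real or complex scalars enters.\<close>

lemma parallelogram_scalar:
  fixes x y :: "'k::real_or_complex"
  shows "(norm (x - y))\<^sup>2 = 2 * (norm x)\<^sup>2 + 2 * (norm y)\<^sup>2 - (norm (x + y))\<^sup>2"
proof -
  have diff: "to_complex (x - y) = to_complex x - to_complex y"
    using to_complex_add[of "x - y" y] by (simp add: algebra_simps)
  have "(cmod (to_complex x - to_complex y))\<^sup>2 =
      2 * (cmod (to_complex x))\<^sup>2 + 2 * (cmod (to_complex y))\<^sup>2 - (cmod (to_complex x + to_complex y))\<^sup>2"
    unfolding cmod_power2 by (simp add: power2_eq_square algebra_simps)
  then show ?thesis by (simp only: norm_to_complex flip: diff to_complex_add)
qed

text \<open>Uniform convexity of the scalars in linear form. With c the norm of f + a s, the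
  parallelogram law bounds the squared distance by 4 a (2 a - c). The arithmetic-geometric mean
  inequality with a free parameter t turns its root into a sum that is linear in a and c.\<close>

lemma norm_diff_le_scalar:
  fixes s f :: "'k::real_or_complex"
  assumes "norm s = 1" "norm f \<le> a" "0 < t"
  shows "norm (f - of_real a * s) \<le> t * a + (2 * a - norm (f + of_real a * s)) / t"
proof -
  define c where "c = norm (f + of_real a * s)"
  have a: "0 \<le> a" using norm_ge_zero[of f] assms(2) by linarith
  have c: "0 \<le> c" "c \<le> 2 * a"
    using norm_triangle_ineq[of f "of_real a * s"] assms a by (auto simp: c_def norm_mult)
  have "(norm (f - of_real a * s))\<^sup>2 \<le> 4 * a\<^sup>2 - c\<^sup>2"
    using parallelogram_scalar[of f "of_real a * s"] power_mono[OF assms(2), of 2] assms(1) a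
    by (simp add: norm_mult c_def)
  also have "\<dots> = (2 * a + c) * (2 * a - c)" by (simp add: power2_eq_square algebra_simps)
  also have "\<dots> \<le> (4 * a) * (2 * a - c)" by (rule mult_right_mono) (use c in auto)
  also have "\<dots> \<le> (t * a + (2 * a - c) / t)\<^sup>2"
    using zero_le_power2[of "t * a - (2 * a - c) / t"] \<open>0 < t\<close>
    by (simp add: power2_eq_square field_simps)
  finally have "norm (f - of_real a * s) \<le> t * a + (2 * a - c) / t"
    by (rule power2_le_imp_le) (use assms(3) a c in simp)
  then show ?thesis by (simp add: c_def)
qed

text \<open>Since s is the phase of the sum F of the \<open>f n\<close>, F and the sum of the
  \<open>a n * s\<close> are nonnegative multiples of one scalar and their moduli add. The triangle
  inequality then bounds the total of the deficits by the sum of the \<open>a n\<close> minus the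
  modulus of F. The \<open>a n\<close> may exceed the moduli of the \<open>f n\<close>: in C(K) they
  are supremum norms, not values at the chosen point.\<close>

lemma sum_norm_diff_le_scalar:
  fixes f :: "nat \<Rightarrow> 'k::real_or_complex"
  assumes s: "norm s = 1" and f: "\<And>n. n \<in> I \<Longrightarrow> norm (f n) \<le> a n" and "0 < t"
    and F: "(\<Sum>n\<in>I. f n) = of_real (norm (\<Sum>n\<in>I. f n)) * s"
  shows "(\<Sum>n\<in>I. norm (f n - of_real (a n) * s)) \<le> t * (\<Sum>n\<in>I. a n) + ((\<Sum>n\<in>I. a n) - norm (\<Sum>n\<in>I. f n)) / t"
proof -
  define L where "L = (\<Sum>n\<in>I. a n)"
  have "0 \<le> a n" if "n \<in> I" for n using f[OF that] norm_ge_zero[of "f n"] by linarith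
  then have L0: "0 \<le> L" by (simp add: L_def sum_nonneg)
  have "(\<Sum>n\<in>I. f n + of_real (a n) * s) = of_real (norm (\<Sum>n\<in>I. f n) + L) * s"
    unfolding sum.distrib by (subst F) (simp add: L_def sum_distrib_right distrib_right)
  then have "norm (\<Sum>n\<in>I. f n) + L = norm (\<Sum>n\<in>I. f n + of_real (a n) * s)"
    using s L0 by (simp add: norm_mult del: of_real_add)
  also have "\<dots> \<le> (\<Sum>n\<in>I. norm (f n + of_real (a n) * s))" by (rule norm_sum)
  finally have *: "norm (\<Sum>n\<in>I. f n) + L \<le> (\<Sum>n\<in>I. norm (f n + of_real (a n) * s))" .
  have "(\<Sum>n\<in>I. norm (f n - of_real (a n) * s)) \<le>
      (\<Sum>n\<in>I. t * a n + (2 * a n - norm (f n + of_real (a n) * s)) / t)"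
    by (intro sum_mono norm_diff_le_scalar s f \<open>0 < t\<close>)
  also have "\<dots> = t * L + (2 * L - (\<Sum>n\<in>I. norm (f n + of_real (a n) * s))) / t"
    by (simp add: L_def sum.distrib sum_subtractf sum_distrib_left flip: sum_divide_distrib)
  also have "\<dots> \<le> t * L + (L - norm (\<Sum>n\<in>I. f n)) / t"
    using * \<open>0 < t\<close> by (intro add_left_mono divide_right_mono) auto
  finally show ?thesis by (simp add: L_def)
qed

lemma ex_scalar_phase:
  fixes F :: "'k::real_or_complex"
  shows "\<exists>s. norm s = 1 \<and> F = of_real (norm F) * s"
  by (cases "F = 0") (auto intro: exI[of _ 1] exI[of _ "F / of_real (norm F)"] simp: norm_divide)

section \<open>Continuous functions on a compact space\<close>

lemma vectors_C_space:
  "f \<in> vectors (C_space K) \<longleftrightarrow> continuous_map K euclidean f \<and> (\<forall>t. t \<notin> topspace K \<longrightarrow> f t = 0)"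
  by (simp add: C_space_def)

lemma scale_C_space: "scale (C_space K) c f = (\<lambda>t. c * f t)"
  by (simp add: C_space_def)

lemma nrm_C_space_le:
  assumes "\<And>t. t \<in> topspace K \<Longrightarrow> norm (f t) \<le> c" "0 \<le> c"
  shows "nrm (C_space K) f \<le> c"
  using assms by (auto simp: C_space_def intro!: cSup_least)

lemma bdd_above_C_space:
  assumes "compact_space K" "f \<in> vectors (C_space K)"
  shows "bdd_above (insert 0 ((\<lambda>t. norm (f t)) ` topspace K))"
proof -
  have "compactin euclidean (f ` topspace K)"
    using assms image_compactin[of K "topspace K" euclidean f]
    by (auto simp: vectors_C_space compact_space_def)
  then have "bounded (f ` topspace K)"
    using compact_imp_bounded by (simp add: compactin_euclidean_iff)
  then obtain B where "\<And>t. t \<in> topspace K \<Longrightarrow> norm (f t) \<le> B" by (auto simp: bounded_iff)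
  then show ?thesis by (intro bdd_aboveI[of _ "max 0 B"]) (auto simp: le_max_iff_disj)
qed

lemma norm_le_nrm_C_space:
  assumes "compact_space K" "f \<in> vectors (C_space K)"
  shows "norm (f t) \<le> nrm (C_space K) f" "0 \<le> nrm (C_space K) f"
proof -
  have *: "x \<le> nrm (C_space K) f" if "x \<in> insert 0 ((\<lambda>t. norm (f t)) ` topspace K)" for x
    using cSup_upper[OF that bdd_above_C_space[OF assms]] by (simp add: C_space_def)
  show "0 \<le> nrm (C_space K) f" by (rule *) simp
  show "norm (f t) \<le> nrm (C_space K) f"
    using assms(2) by (intro *) (cases "t \<in> topspace K"; simp add: vectors_C_space)
qed

lemma nrm_C_space_attained:
  fixes f :: "'t \<Rightarrow> 'k::real_or_complex"
  assumes "compact_space K" "f \<in> vectors (C_space K)" "topspace K \<noteq> {}"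
  shows "\<exists>t\<in>topspace K. norm (f t) = nrm (C_space K) f"
proof -
  have "compactin euclidean (f ` topspace K)"
    using assms image_compactin[of K "topspace K" euclidean f]
    by (auto simp: vectors_C_space compact_space_def)
  then have "compact (f ` topspace K)" by (simp add: compactin_euclidean_iff)
  from continuous_attains_sup[OF this _ continuous_on_norm_id] assms(3)
  obtain t where t: "t \<in> topspace K" "\<And>t'. t' \<in> topspace K \<Longrightarrow> norm (f t') \<le> norm (f t)"
    by auto
  then have "nrm (C_space K) f \<le> norm (f t)" by (intro nrm_C_space_le) auto
  then show ?thesis using norm_le_nrm_C_space(1)[OF assms(1,2), of t] t(1) by (intro bexI[of _ t]) auto
qed

text \<open>Every value of f is moved towards \<sigma> by at most the distance r between \<sigma>
  and f at \<open>t0\<close>, and onto \<sigma> if it is that near. The new function is f followed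
  by a continuous map of scalars, so it is continuous. Its values are convex combinations of values
  of f and \<sigma>, so the norm does not grow.\<close>

lemma C_space_move_value:
  fixes f :: "'t \<Rightarrow> 'k::real_or_complex"
  assumes K: "compact_space K" and f: "f \<in> vectors (C_space K)" and t0: "t0 \<in> topspace K"
    and \<sigma>: "norm \<sigma> \<le> nrm (C_space K) f"
  shows "\<exists>z\<in>vectors (C_space K). z t0 = \<sigma> \<and> nrm (C_space K) z \<le> nrm (C_space K) f \<and>
    nrm (C_space K) (f - z) \<le> norm (f t0 - \<sigma>)"
proof (cases "f t0 = \<sigma>")
  case True
  then show ?thesis using f by (intro bexI[of _ f]) (auto intro: nrm_C_space_le)
next
  case False
  define r where "r = norm (f t0 - \<sigma>)"
  have r: "0 < r" using False by (simp add: r_def)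
  \<comment> \<open>The fraction of the way to \<sigma>. The maximum keeps the denominator positive
    and makes \<theta> equal to 1 wherever f is within r of \<sigma>, in particular at
    \<open>t0\<close>.\<close>
  define \<theta> where "\<theta> t = r / max r (norm (f t - \<sigma>))" for t
  have m: "0 < max r (norm (f t - \<sigma>))" for t using r by simp
  have \<theta>: "0 \<le> \<theta> t" "\<theta> t \<le> 1" for t using r by (auto simp: \<theta>_def divide_le_eq)
  have \<theta>r: "\<theta> t * norm (f t - \<sigma>) \<le> r" for t
    using m[of t] r by (simp add: \<theta>_def divide_le_eq mult_left_mono)
  define z where "z t = (if t \<in> topspace K then f t - \<theta> t *\<^sub>R (f t - \<sigma>) else 0)" for t
  show ?thesis
  proof (intro bexI[of _ z] conjI)
    have cf: "continuous_map K euclidean f" using f by (simp add: vectors_C_space)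
    have "continuous_map K euclidean (\<lambda>t. f t - \<theta> t *\<^sub>R (f t - \<sigma>))"
      unfolding continuous_map_atin limitin_canonical_iff \<theta>_def
    proof
      fix t assume "t \<in> topspace K"
      then have "(f \<longlongrightarrow> f t) (atin K t)" using cf by (simp add: continuous_map_atin)
      then show "((\<lambda>t. f t - (r / max r (norm (f t - \<sigma>))) *\<^sub>R (f t - \<sigma>)) \<longlongrightarrow>
          f t - (r / max r (norm (f t - \<sigma>))) *\<^sub>R (f t - \<sigma>)) (atin K t)"
        using m[of t] by (intro tendsto_intros) auto
    qed
    then have "continuous_map K euclidean z"
      by (rule continuous_map_eq) (simp add: z_def)
    then show "z \<in> vectors (C_space K)" by (simp add: vectors_C_space z_def)
    show "z t0 = \<sigma>" using r t0 by (simp add: z_def \<theta>_def flip: r_def)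
    show "nrm (C_space K) z \<le> nrm (C_space K) f"
    proof (rule nrm_C_space_le)
      fix t assume t: "t \<in> topspace K"
      have "z t = (1 - \<theta> t) *\<^sub>R f t + \<theta> t *\<^sub>R \<sigma>" using t by (simp add: z_def algebra_simps)
      then have "norm (z t) \<le> (1 - \<theta> t) * norm (f t) + \<theta> t * norm \<sigma>"
        using norm_triangle_ineq[of "(1 - \<theta> t) *\<^sub>R f t" "\<theta> t *\<^sub>R \<sigma>"] \<theta>[of t] by simp
      also have "\<dots> \<le> (1 - \<theta> t) * nrm (C_space K) f + \<theta> t * nrm (C_space K) f"
        using \<theta>[of t] \<sigma> norm_le_nrm_C_space(1)[OF K f, of t] by (intro add_mono mult_left_mono) auto
      finally show "norm (z t) \<le> nrm (C_space K) f" by (simp add: algebra_simps)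
    qed (rule norm_le_nrm_C_space[OF K f])
    show "nrm (C_space K) (f - z) \<le> norm (f t0 - \<sigma>)"
      using \<theta>r \<theta> by (intro nrm_C_space_le) (auto simp: z_def r_def)
  qed
qed

lemma C_space_closed:
  shows "0 \<in> vectors (C_space K)"
    and "x \<in> vectors (C_space K) \<Longrightarrow> y \<in> vectors (C_space K) \<Longrightarrow> x + y \<in> vectors (C_space K)"
    and "x \<in> vectors (C_space K) \<Longrightarrow> y \<in> vectors (C_space K) \<Longrightarrow> x - y \<in> vectors (C_space K)"
    and "x \<in> vectors (C_space K) \<Longrightarrow> scale (C_space K) c x \<in> vectors (C_space K)"
  by (auto simp: vectors_C_space scale_C_space continuous_map_atin zero_fun_def plus_fun_def
      fun_diff_def intro!: tendsto_intros)

lemma C_space_sum_mem: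
  "(\<And>i. i \<in> I \<Longrightarrow> f i \<in> vectors (C_space K)) \<Longrightarrow> sum f I \<in> vectors (C_space K)"
  by (induction I rule: infinite_finite_induct) (auto simp: C_space_closed)

text \<open>Evaluation at \<open>t0\<close> witnesses alignment for all weights simultaneously:
  there the functions \<open>z n\<close> take the values \<open>a n * s\<close>, of largest possible
  modulus and common phase. The scalar estimate at \<open>t0\<close> controls the whole functions
  because moving a value costs no more in the norm than at the point.\<close>

lemma approx_alignable_C_space:
  fixes K :: "'t topology"
  assumes K: "compact_space K" and t: "0 < t" "0 \<le> \<eta>"
  shows "approx_alignable (C_space K :: ('k::real_or_complex, _) nspace) \<eta> (t + \<eta> / t)"
  unfolding approx_alignable_def
proof (intro allI impI, elim conjE)
  let ?C = "C_space K :: ('k, _) nspace"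
  fix I :: "nat set" and y :: "nat \<Rightarrow> 't \<Rightarrow> 'k"
  assume I: "finite I" and "\<forall>n\<in>I. y n \<in> vectors ?C"
    and le: "(1 - \<eta>) * (\<Sum>n\<in>I. nrm ?C (y n)) \<le> nrm ?C (\<Sum>n\<in>I. y n)"
  then have y: "y n \<in> vectors ?C" if "n \<in> I" for n using that by simp
  show "\<exists>z. (\<forall>n\<in>I. z n \<in> vectors ?C) \<and>
      (\<forall>b. (\<forall>n\<in>I. 0 \<le> b n) \<longrightarrow>
         nrm ?C (\<Sum>n\<in>I. scale ?C (of_real (b n)) (z n)) = (\<Sum>n\<in>I. b n * nrm ?C (y n))) \<and>
      (\<Sum>n\<in>I. nrm ?C (y n - z n)) \<le> (t + \<eta> / t) * (\<Sum>n\<in>I. nrm ?C (y n))"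
  proof (cases "topspace K = {}")
    \<comment> \<open>There is no point at which to evaluate, but all norms are 0 and the given
      functions are already aligned.\<close>
    case True
    then have "nrm ?C f = 0" for f by (simp add: C_space_def)
    then show ?thesis using y by (intro exI[of _ y]) simp
  next
    case False
    define F where "F = (\<Sum>n\<in>I. y n)"
    have "F \<in> vectors ?C" unfolding F_def by (rule C_space_sum_mem) (rule y)
    then obtain t0 where t0: "t0 \<in> topspace K" "norm (F t0) = nrm ?C F"
      using nrm_C_space_attained[OF K _ False] by blast
    obtain s where s: "norm s = 1" "F t0 = of_real (norm (F t0)) * s" using ex_scalar_phase by blast
    have Ft0: "F t0 = (\<Sum>n\<in>I. y n t0)" by (simp add: F_def sum_fun_eval)
    define a where "a n = nrm ?C (y n)" for n
    have a: "0 \<le> a n" "norm (y n t0) \<le> a n" if "n \<in> I" for n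
      using norm_le_nrm_C_space[OF K y[OF that]] by (auto simp: a_def)
    have "\<forall>n\<in>I. \<exists>z\<in>vectors ?C. z t0 = of_real (a n) * s \<and> nrm ?C z \<le> a n \<and>
        nrm ?C (y n - z) \<le> norm (y n t0 - of_real (a n) * s)"
      using C_space_move_value[OF K y t0(1)] a s(1) by (simp add: norm_mult a_def)
    from bchoice[OF this[unfolded Bex_def]] obtain z where
      "\<forall>n\<in>I. z n \<in> vectors ?C \<and> z n t0 = of_real (a n) * s \<and> nrm ?C (z n) \<le> a n \<and>
        nrm ?C (y n - z n) \<le> norm (y n t0 - of_real (a n) * s)"
      by (elim exE)
    then have z: "z n \<in> vectors ?C" "z n t0 = of_real (a n) * s" "nrm ?C (z n) \<le> a n"
        "nrm ?C (y n - z n) \<le> norm (y n t0 - of_real (a n) * s)" if "n \<in> I" for n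
      using that by simp_all
    show ?thesis
    proof (intro exI[of _ z] conjI ballI allI impI)
      show "z n \<in> vectors ?C" if "n \<in> I" for n using z(1) that by simp
      fix b :: "nat \<Rightarrow> real" assume b: "\<forall>n\<in>I. 0 \<le> b n"
      define Z where "Z = (\<Sum>n\<in>I. scale ?C (of_real (b n)) (z n))"
      have Z: "Z \<in> vectors ?C" unfolding Z_def by (rule C_space_sum_mem) (simp add: C_space_closed z)
      have Zt: "Z u = (\<Sum>n\<in>I. of_real (b n) * z n u)" for u
        by (simp add: Z_def sum_fun_eval scale_C_space)
      have s0: "0 \<le> (\<Sum>n\<in>I. b n * a n)" by (intro sum_nonneg mult_nonneg_nonneg) (use a b in auto)
      show "nrm ?C (\<Sum>n\<in>I. scale ?C (of_real (b n)) (z n)) = (\<Sum>n\<in>I. b n * nrm ?C (y n))"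
        unfolding Z_def[symmetric] a_def[symmetric]
      proof (rule antisym)
        show "nrm ?C Z \<le> (\<Sum>n\<in>I. b n * a n)"
        proof (rule nrm_C_space_le[OF _ s0])
          fix u
          have "norm (Z u) \<le> (\<Sum>n\<in>I. norm (of_real (b n) * z n u))" unfolding Zt by (rule norm_sum)
          also have "\<dots> \<le> (\<Sum>n\<in>I. b n * a n)"
          proof (rule sum_mono)
            fix n assume n: "n \<in> I"
            have "norm (z n u) \<le> a n"
              using norm_le_nrm_C_space(1)[OF K z(1)[OF n], of u] z(3)[OF n] by simp
            then show "norm (of_real (b n) * z n u) \<le> b n * a n"
              using b n by (simp add: norm_mult mult_left_mono)
          qed
          finally show "norm (Z u) \<le> (\<Sum>n\<in>I. b n * a n)" .
        qed
        have "Z t0 = of_real (\<Sum>n\<in>I. b n * a n) * s"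
          by (simp add: Zt z(2) sum_distrib_right mult.assoc)
        then have "norm (Z t0) = (\<Sum>n\<in>I. b n * a n)"
          using s0 s(1) by (simp only: norm_mult norm_of_real)
        then show "(\<Sum>n\<in>I. b n * a n) \<le> nrm ?C Z"
          using norm_le_nrm_C_space(1)[OF K Z, of t0] by simp
      qed
    next
      have "(\<Sum>n\<in>I. nrm ?C (y n - z n)) \<le> (\<Sum>n\<in>I. norm (y n t0 - of_real (a n) * s))"
        by (intro sum_mono z(4))
      also have "\<dots> \<le> t * (\<Sum>n\<in>I. a n) + ((\<Sum>n\<in>I. a n) - norm (F t0)) / t"
        unfolding Ft0 by (rule sum_norm_diff_le_scalar[OF s(1) a(2) t(1) s(2)[unfolded Ft0]])
      also have "\<dots> \<le> t * (\<Sum>n\<in>I. a n) + (\<eta> * (\<Sum>n\<in>I. a n)) / t"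
        using le t(1) t0(2)
        by (intro add_left_mono divide_right_mono) (auto simp: a_def F_def algebra_simps)
      finally show "(\<Sum>n\<in>I. nrm ?C (y n - z n)) \<le> (t + \<eta> / t) * (\<Sum>n\<in>I. nrm ?C (y n))"
        by (simp add: a_def algebra_simps)
    qed
  qed
qed

section \<open>Integrable functions\<close>

lemma vectors_L1: "f \<in> vectors (L1_functions M) \<longleftrightarrow> integrable M f"
  by (simp add: L1_functions_def)

lemma scale_L1: "scale (L1_functions M) c f = (\<lambda>t. c * f t)"
  by (simp add: L1_functions_def)

lemma nrm_L1: "nrm (L1_functions M) f = (\<integral>t. norm (f t) \<partial>M)"
  by (simp add: L1_functions_def)

lemma L1_closed:
  shows "0 \<in> vectors (L1_functions M)"
    and "x \<in> vectors (L1_functions M) \<Longrightarrow> y \<in> vectors (L1_functions M) \<Longrightarrow> x + y \<in> vectors (L1_functions M)"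
    and "x \<in> vectors (L1_functions M) \<Longrightarrow> y \<in> vectors (L1_functions M) \<Longrightarrow> x - y \<in> vectors (L1_functions M)"
    and "x \<in> vectors (L1_functions M) \<Longrightarrow> scale (L1_functions M) c x \<in> vectors (L1_functions M)"
  by (simp_all add: vectors_L1 scale_L1 zero_fun_def plus_fun_def fun_diff_def)

text \<open>The phase may vary from point to point: the moduli of the \<open>y n\<close> are kept,
  and at each point all \<open>z n\<close> share one phase, so moduli add before integration. The
  scalar estimate is applied with \<open>a n\<close> the modulus at the point; being linear, it
  integrates to an estimate between norms.\<close>

lemma approx_alignable_L1:
  fixes M :: "'s measure"
  assumes t: "0 < t" "0 \<le> \<eta>"
  shows "approx_alignable (L1_functions M :: ('k::real_or_complex, _) nspace) \<eta> (t + \<eta> / t)"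
  unfolding approx_alignable_def
proof (intro allI impI, elim conjE)
  let ?L = "L1_functions M :: ('k, _) nspace"
  fix I :: "nat set" and y :: "nat \<Rightarrow> 's \<Rightarrow> 'k"
  assume I: "finite I" and y: "\<forall>n\<in>I. y n \<in> vectors ?L"
    and le: "(1 - \<eta>) * (\<Sum>n\<in>I. nrm ?L (y n)) \<le> nrm ?L (\<Sum>n\<in>I. y n)"
  have yi: "integrable M (y n)" if "n \<in> I" for n using y that by (simp add: vectors_L1)
  define F where "F x = (\<Sum>n\<in>I. y n x)" for x
  have F: "integrable M F" unfolding F_def by (intro Bochner_Integration.integrable_sum yi)
  \<comment> \<open>The value 1 at the zeros of F keeps s unimodular everywhere, and s remains
    measurable.\<close>
  define s where "s x = (if F x = 0 then 1 else inverse (norm (F x)) *\<^sub>R F x)" for x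
  have s: "norm (s x) = 1" "F x = of_real (norm (F x)) * s x" for x
    by (auto simp: s_def scaleR_conv_of_real norm_mult norm_inverse)
  have [measurable]: "F \<in> borel_measurable M" using F by simp
  have [measurable]: "s \<in> borel_measurable M" unfolding s_def by measurable
  define z where "z n x = of_real (norm (y n x)) * s x" for n x
  have nz: "norm (z n x) = norm (y n x)" for n x by (simp add: z_def norm_mult s)
  have zi: "integrable M (z n)" if "n \<in> I" for n
  proof (rule Bochner_Integration.integrable_bound[OF yi[OF that]])
    have [measurable]: "y n \<in> borel_measurable M" using yi[OF that] by simp
    show "z n \<in> borel_measurable M" unfolding z_def by measurable
  qed (simp add: nz)
  define S where "S x = (\<Sum>n\<in>I. norm (y n x))" for x
  have S: "integrable M S" unfolding S_def by (intro Bochner_Integration.integrable_sum integrable_norm yi)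
  have intS: "(\<integral>x. S x \<partial>M) = (\<Sum>n\<in>I. nrm ?L (y n))"
    unfolding S_def nrm_L1 by (intro Bochner_Integration.integral_sum integrable_norm yi)
  show "\<exists>z. (\<forall>n\<in>I. z n \<in> vectors ?L) \<and>
      (\<forall>b. (\<forall>n\<in>I. 0 \<le> b n) \<longrightarrow>
         nrm ?L (\<Sum>n\<in>I. scale ?L (of_real (b n)) (z n)) = (\<Sum>n\<in>I. b n * nrm ?L (y n))) \<and>
      (\<Sum>n\<in>I. nrm ?L (y n - z n)) \<le> (t + \<eta> / t) * (\<Sum>n\<in>I. nrm ?L (y n))"
  proof (intro exI[of _ z] conjI ballI allI impI)
    show "z n \<in> vectors ?L" if "n \<in> I" for n using zi that by (simp add: vectors_L1)
    fix b :: "nat \<Rightarrow> real" assume b: "\<forall>n\<in>I. 0 \<le> b n"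
    have "norm ((\<Sum>n\<in>I. scale ?L (of_real (b n)) (z n)) x) = (\<Sum>n\<in>I. b n * norm (y n x))" for x
    proof -
      have "(\<Sum>n\<in>I. scale ?L (of_real (b n)) (z n)) x = of_real (\<Sum>n\<in>I. b n * norm (y n x)) * s x"
        by (simp add: sum_fun_eval scale_L1 z_def sum_distrib_right mult.assoc)
      moreover have "0 \<le> (\<Sum>n\<in>I. b n * norm (y n x))" by (intro sum_nonneg) (use b in auto)
      ultimately show ?thesis by (simp only: norm_mult norm_of_real s)
    qed
    then have "nrm ?L (\<Sum>n\<in>I. scale ?L (of_real (b n)) (z n)) = (\<integral>x. (\<Sum>n\<in>I. b n * norm (y n x)) \<partial>M)"
      by (simp add: nrm_L1)
    also have "\<dots> = (\<Sum>n\<in>I. \<integral>x. b n * norm (y n x) \<partial>M)"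
      by (intro Bochner_Integration.integral_sum integrable_mult_right integrable_norm yi)
    finally show "nrm ?L (\<Sum>n\<in>I. scale ?L (of_real (b n)) (z n)) = (\<Sum>n\<in>I. b n * nrm ?L (y n))"
      by (simp add: nrm_L1)
  next
    have "(\<Sum>n\<in>I. nrm ?L (y n - z n)) = (\<integral>x. (\<Sum>n\<in>I. norm (y n x - z n x)) \<partial>M)"
      unfolding nrm_L1 fun_diff_def
      by (intro Bochner_Integration.integral_sum[symmetric] integrable_norm Bochner_Integration.integrable_diff yi zi)
    also have "\<dots> \<le> (\<integral>x. t * S x + (S x - norm (F x)) / t \<partial>M)"
    proof (intro integral_mono)
      show "integrable M (\<lambda>x. \<Sum>n\<in>I. norm (y n x - z n x))"
        by (intro Bochner_Integration.integrable_sum integrable_norm Bochner_Integration.integrable_diff yi zi)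
      show "integrable M (\<lambda>x. t * S x + (S x - norm (F x)) / t)"
        by (intro Bochner_Integration.integrable_add integrable_mult_right integrable_divide
            Bochner_Integration.integrable_diff integrable_norm S F)
      show "(\<Sum>n\<in>I. norm (y n x - z n x)) \<le> t * S x + (S x - norm (F x)) / t" for x
        unfolding z_def S_def F_def
        by (rule sum_norm_diff_le_scalar[OF s(1)[of x] _ t(1) s(2)[of x, unfolded F_def]]) simp
    qed
    also have "\<dots> = t * (\<integral>x. S x \<partial>M) + ((\<integral>x. S x \<partial>M) - (\<integral>x. norm (F x) \<partial>M)) / t"
      using S F by (simp add: Bochner_Integration.integral_add Bochner_Integration.integral_diff)
    also have "\<dots> \<le> t * (\<integral>x. S x \<partial>M) + (\<eta> * (\<integral>x. S x \<partial>M)) / t"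
    proof -
      have "(\<integral>x. norm (F x) \<partial>M) = nrm ?L (\<Sum>n\<in>I. y n)" by (simp add: nrm_L1 F_def sum_fun_eval)
      then show ?thesis
        using le t(1) intS by (intro add_left_mono divide_right_mono) (auto simp: algebra_simps)
    qed
    finally show "(\<Sum>n\<in>I. nrm ?L (y n - z n)) \<le> (t + \<eta> / t) * (\<Sum>n\<in>I. nrm ?L (y n))"
      unfolding intS by (simp add: algebra_simps)
  qed
qed

subsection \<open>Uniformly convex spaces and isometries\<close>

text \<open>The \<open>z n\<close> are nonnegative multiples of one unit vector, so they are aligned
  for any weights, and only the distances need work. Convexity enters through two numbers e and d
  instead of the modulus, so that the same pair serves a whole family of spaces.\<close>

lemma (in normed_space_on) approx_alignable_uniformly_convex:
  assumes e: "0 < e" and d: "0 < d" and \<eta>: "\<eta> < 1"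
    and convex: "\<And>x y. x \<in> unit_ball X \<Longrightarrow> y \<in> unit_ball X \<Longrightarrow> e \<le> nrm X (x - y) \<Longrightarrow>
      d \<le> 1 - nrm X (x + y) / 2"
  shows "approx_alignable X \<eta> (e + \<eta> / d)"
  unfolding approx_alignable_def
proof (intro allI impI, elim conjE)
  fix I :: "nat set" and y :: "nat \<Rightarrow> 'a"
  assume I: "finite I" and "\<forall>n\<in>I. y n \<in> vectors X"
    and le: "(1 - \<eta>) * (\<Sum>n\<in>I. nrm X (y n)) \<le> nrm X (\<Sum>n\<in>I. y n)"
  then have y: "y n \<in> vectors X" if "n \<in> I" for n using that by simp
  define w where "w = (\<Sum>n\<in>I. y n)"
  have w: "w \<in> vectors X" unfolding w_def by (rule sum_mem) (rule y)
  define L where "L = (\<Sum>n\<in>I. nrm X (y n))"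
  have L0: "0 \<le> L" unfolding L_def by (intro sum_nonneg nrm_nonneg y)
  show "\<exists>z. (\<forall>n\<in>I. z n \<in> vectors X) \<and>
      (\<forall>b. (\<forall>n\<in>I. 0 \<le> b n) \<longrightarrow>
         nrm X (\<Sum>n\<in>I. scale X (of_real (b n)) (z n)) = (\<Sum>n\<in>I. b n * nrm X (y n))) \<and>
      (\<Sum>n\<in>I. nrm X (y n - z n)) \<le> (e + \<eta> / d) * (\<Sum>n\<in>I. nrm X (y n))"
  proof (cases "nrm X w = 0")
    case True
    then have "L \<le> 0" using le \<eta> by (simp add: w_def L_def mult_le_0_iff)
    then have "L = 0" using L0 by simp
    then have "\<forall>n\<in>I. nrm X (y n) = 0"
      unfolding L_def using I y nrm_nonneg by (subst (asm) sum_nonneg_eq_0_iff) auto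
    then have "\<forall>n\<in>I. y n = 0" using nrm_eq_0_iff y by auto
    then show ?thesis
      by (intro exI[of _ "\<lambda>_. 0"]) (auto simp: zero_mem scale_zero_right nrm_zero)
  next
    case False
    define u where "u = scale X (of_real (inverse (nrm X w))) w"
    have u: "u \<in> vectors X" "nrm X u = 1"
      using False nrm_nonneg[OF w] by (simp_all add: u_def scale_mem w nrm_scale norm_inverse)
    have wu: "w = scale X (of_real (nrm X w)) u"
      using False by (simp add: u_def scale_scale w scale_one)
    define z where "z n = scale X (of_real (nrm X (y n))) u" for n
    have z: "z n \<in> vectors X" for n by (simp add: z_def scale_mem u)
    have point: "nrm X (y n - z n) \<le> e * nrm X (y n) + (2 * nrm X (y n) - nrm X (y n + z n)) / d"
      if n: "n \<in> I" for n
    proof (cases "nrm X (y n) = 0")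
      case True
      then show ?thesis
        using nrm_eq_0_iff[OF y[OF n]] by (simp add: z_def scale_zero_left u nrm_zero)
    next
      case False
      define a where "a = nrm X (y n)"
      have a: "0 < a" using False nrm_nonneg[OF y[OF n]] by (simp add: a_def)
      define v where "v = scale X (of_real (inverse a)) (y n)"
      have v: "v \<in> vectors X" "nrm X v = 1"
        using a y[OF n] by (simp_all add: v_def scale_mem nrm_scale norm_inverse a_def)
      have yv: "y n = scale X (of_real a) v"
        using a y[OF n] by (simp add: v_def scale_scale scale_one)
      have "y n - z n = scale X (of_real a) (v - u)" "y n + z n = scale X (of_real a) (v + u)"
        by (subst yv, simp add: z_def scale_diff_right scale_add_right v u a_def)+
      then have eq: "nrm X (y n - z n) = a * nrm X (v - u)" "nrm X (y n + z n) = a * nrm X (v + u)"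
        using a by (simp_all add: nrm_scale diff_mem add_mem v u)
      \<comment> \<open>A linear form of uniform convexity. Either the distance is below e, or 2
        minus the norm of v + u is at least 2 d, and then the last term alone is at least 2, the
        largest possible distance.\<close>
      have "nrm X (v - u) \<le> e + (2 - nrm X (v + u)) / d"
      proof (cases "e \<le> nrm X (v - u)")
        case True
        then have "2 * d \<le> 2 - nrm X (v + u)" using convex[of v u] v u by (simp add: unit_ball_def)
        then have "2 \<le> (2 - nrm X (v + u)) / d" using d by (simp add: field_simps)
        then show ?thesis using nrm_diff_le[OF v(1) u(1)] u v e by simp
      next
        case False
        have "0 \<le> (2 - nrm X (v + u)) / d" using nrm_triangle[OF v(1) u(1)] u v d by simp
        then show ?thesis using False by simp
      qed
      from mult_left_mono[OF this, of a] a
      have "a * nrm X (v - u) \<le> e * a + (2 * a - a * nrm X (v + u)) / d" by (simp add: field_simps)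
      then show ?thesis unfolding eq by (simp add: a_def)
    qed
    show ?thesis
    proof (intro exI[of _ z] conjI ballI allI impI z)
      fix b :: "nat \<Rightarrow> real" assume b: "\<forall>n\<in>I. 0 \<le> b n"
      have "(\<Sum>n\<in>I. scale X (of_real (b n)) (z n)) = scale X (of_real (\<Sum>n\<in>I. b n * nrm X (y n))) u"
        by (simp add: z_def scale_scale u scale_sum_left)
      moreover have "0 \<le> (\<Sum>n\<in>I. b n * nrm X (y n))"
        by (intro sum_nonneg mult_nonneg_nonneg nrm_nonneg y) (use b in auto)
      ultimately show "nrm X (\<Sum>n\<in>I. scale X (of_real (b n)) (z n)) = (\<Sum>n\<in>I. b n * nrm X (y n))"
        by (simp only: nrm_scale u norm_of_real abs_of_nonneg mult_1_right)
    next
      \<comment> \<open>Since w and the sum of the \<open>z n\<close> are nonnegative multiples of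
        u, their norms add. Hence the deficits summed over n are at most \<open>L - nrm X w\<close>,
        which is at most \<eta> L.\<close>
      have "(\<Sum>n\<in>I. y n + z n) = scale X (of_real (nrm X w)) u + scale X (of_real L) u"
        using wu by (simp add: sum.distrib z_def L_def scale_sum_left u flip: w_def)
      also have "\<dots> = scale X (of_real (nrm X w + L)) u" by (simp add: scale_add_left u)
      finally have "nrm X (\<Sum>n\<in>I. y n + z n) = nrm X w + L"
        using L0 nrm_nonneg[OF w] u by (simp only: nrm_scale norm_of_real abs_of_nonneg mult_1_right add_nonneg_nonneg zero_le_one less_imp_le)
      then have *: "nrm X w + L \<le> (\<Sum>n\<in>I. nrm X (y n + z n))"
        using nrm_sum_le[of I "\<lambda>n. y n + z n"] y z add_mem by simp
      have "(\<Sum>n\<in>I. nrm X (y n - z n)) \<le>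
          (\<Sum>n\<in>I. e * nrm X (y n) + (2 * nrm X (y n) - nrm X (y n + z n)) / d)"
        by (rule sum_mono) (rule point)
      also have "\<dots> = e * L + (2 * L - (\<Sum>n\<in>I. nrm X (y n + z n))) / d"
        by (simp add: L_def sum.distrib sum_subtractf sum_distrib_left flip: sum_divide_distrib)
      also have "\<dots> \<le> e * L + (\<eta> * L) / d"
        using * le d by (intro add_left_mono divide_right_mono) (auto simp: L_def w_def algebra_simps)
      finally show "(\<Sum>n\<in>I. nrm X (y n - z n)) \<le> (e + \<eta> / d) * (\<Sum>n\<in>I. nrm X (y n))"
        by (simp add: L_def algebra_simps)
    qed
  qed
qed

text \<open>Preimages of the \<open>y n\<close> are aligned in Z and mapped back; linearity and
  preservation of norms carry over all three conditions. Z need only be seminormed, as for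
  integrable functions before identification, so its closure properties are separate
  hypotheses.\<close>

lemma approx_alignable_isometric:
  fixes X :: "('k::real_or_complex, 'a::ab_group_add) nspace"
    and Z :: "('k, 'z::ab_group_add) nspace"
  assumes iso: "isometric_to X Z" and approx: "approx_alignable Z \<eta> \<epsilon>"
    and zero: "0 \<in> vectors Z"
    and add: "\<And>x y. x \<in> vectors Z \<Longrightarrow> y \<in> vectors Z \<Longrightarrow> x + y \<in> vectors Z"
    and diff: "\<And>x y. x \<in> vectors Z \<Longrightarrow> y \<in> vectors Z \<Longrightarrow> x - y \<in> vectors Z"
    and scale: "\<And>c x. x \<in> vectors Z \<Longrightarrow> scale Z c x \<in> vectors Z"
  shows "approx_alignable X \<eta> \<epsilon>"
  unfolding approx_alignable_def
proof (intro allI impI, elim conjE)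
  obtain \<Phi> where lin: "linear_op Z X \<Phi>" and surj: "\<Phi> ` vectors Z = vectors X"
    and nrm: "\<And>z. z \<in> vectors Z \<Longrightarrow> nrm X (\<Phi> z) = nrm Z z"
    using iso by (auto simp: isometric_to_def)
  have \<Phi>d: "\<Phi> (x - y) = \<Phi> x - \<Phi> y" if "x \<in> vectors Z" "y \<in> vectors Z" for x y
  proof -
    have "\<Phi> ((x - y) + y) = \<Phi> (x - y) + \<Phi> y"
      using lin diff[OF that] that(2) unfolding linear_op_def by blast
    then show ?thesis by simp
  qed
  have \<Phi>s: "\<Phi> (scale Z c x) = scale X c (\<Phi> x)" if "x \<in> vectors Z" for c x
    using lin that by (simp add: linear_op_def)
  have \<Phi>sum: "sum f I \<in> vectors Z" "\<Phi> (sum f I) = (\<Sum>n\<in>I. \<Phi> (f n))"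
    if "\<And>n. n \<in> I \<Longrightarrow> f n \<in> vectors Z" for f and I :: "nat set"
    using linear_op_sum[OF lin zero add, of I f] that by auto
  fix I :: "nat set" and y :: "nat \<Rightarrow> 'a"
  assume I: "finite I" and "\<forall>n\<in>I. y n \<in> vectors X"
    and le: "(1 - \<eta>) * (\<Sum>n\<in>I. nrm X (y n)) \<le> nrm X (\<Sum>n\<in>I. y n)"
  then have "\<forall>n\<in>I. \<exists>f. f \<in> vectors Z \<and> \<Phi> f = y n" using surj by force
  from bchoice[OF this] obtain f where "\<forall>n\<in>I. f n \<in> vectors Z \<and> \<Phi> (f n) = y n" ..
  then have f: "f n \<in> vectors Z" "y n = \<Phi> (f n)" if "n \<in> I" for n using that by auto
  have ny: "nrm X (y n) = nrm Z (f n)" if "n \<in> I" for n using f that nrm by simp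
  have sy: "nrm X (\<Sum>n\<in>I. y n) = nrm Z (\<Sum>n\<in>I. f n)"
    using nrm[OF \<Phi>sum(1)] \<Phi>sum(2) f by simp
  have le': "(1 - \<eta>) * (\<Sum>n\<in>I. nrm Z (f n)) \<le> nrm Z (\<Sum>n\<in>I. f n)"
    using le ny sy by simp
  obtain z where z: "\<And>n. n \<in> I \<Longrightarrow> z n \<in> vectors Z"
    and align: "\<And>b. (\<And>n. n \<in> I \<Longrightarrow> 0 \<le> b n) \<Longrightarrow>
        nrm Z (\<Sum>n\<in>I. scale Z (of_real (b n)) (z n)) = (\<Sum>n\<in>I. b n * nrm Z (f n))"
    and close: "(\<Sum>n\<in>I. nrm Z (f n - z n)) \<le> \<epsilon> * (\<Sum>n\<in>I. nrm Z (f n))"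
    by (rule approx_alignableE[OF approx I f(1) le']) blast+
  show "\<exists>z. (\<forall>n\<in>I. z n \<in> vectors X) \<and>
      (\<forall>b. (\<forall>n\<in>I. 0 \<le> b n) \<longrightarrow>
         nrm X (\<Sum>n\<in>I. scale X (of_real (b n)) (z n)) = (\<Sum>n\<in>I. b n * nrm X (y n))) \<and>
      (\<Sum>n\<in>I. nrm X (y n - z n)) \<le> \<epsilon> * (\<Sum>n\<in>I. nrm X (y n))"
  proof (intro exI[of _ "\<lambda>n. \<Phi> (z n)"] conjI ballI allI impI)
    show "\<Phi> (z n) \<in> vectors X" if "n \<in> I" for n using surj z that by blast
    fix b :: "nat \<Rightarrow> real" assume b: "\<forall>n\<in>I. 0 \<le> b n"
    have "(\<Sum>n\<in>I. scale X (of_real (b n)) (\<Phi> (z n))) = \<Phi> (\<Sum>n\<in>I. scale Z (of_real (b n)) (z n))"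
      using \<Phi>sum(2)[of I "\<lambda>n. scale Z (of_real (b n)) (z n)"] by (simp add: \<Phi>s z scale)
    also have "nrm X \<dots> = nrm Z (\<Sum>n\<in>I. scale Z (of_real (b n)) (z n))"
      by (intro nrm \<Phi>sum scale z)
    also have "\<dots> = (\<Sum>n\<in>I. b n * nrm Z (f n))" by (rule align) (use b in auto)
    finally show "nrm X (\<Sum>n\<in>I. scale X (of_real (b n)) (\<Phi> (z n))) = (\<Sum>n\<in>I. b n * nrm X (y n))"
      by (simp add: ny)
  next
    have "nrm X (y n - \<Phi> (z n)) = nrm Z (f n - z n)" if n: "n \<in> I" for n
      using \<Phi>d[OF f(1)[OF n] z[OF n]] nrm[OF diff[OF f(1)[OF n] z[OF n]]] f(2)[OF n] by simp
    then show "(\<Sum>n\<in>I. nrm X (y n - \<Phi> (z n))) \<le> \<epsilon> * (\<Sum>n\<in>I. nrm X (y n))"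
      using close ny by simp
  qed
qed

text \<open>The aligned vectors have no direction where \<open>y n = 0\<close>. To obtain unit vectors there as well,
  the zero vectors are first replaced by small multiples of the sum.\<close>

lemma (in normed_space_on) approx_alignable_unit_vectors:
  assumes approx: "approx_alignable X \<eta> \<epsilon>" and \<eta>: "0 \<le> \<eta>" "\<eta> < 1" and "0 \<le> \<epsilon>"
    and nontrivial: "vectors X \<noteq> {0}" and I: "finite (I :: nat set)"
    and mem: "\<forall>n\<in>I. y n \<in> vectors X"
    and le: "(1 - \<eta>) * (\<Sum>n\<in>I. nrm X (y n)) \<le> nrm X (\<Sum>n\<in>I. y n)"
  shows "\<exists>\<zeta>. (\<forall>n\<in>I. \<zeta> n \<in> vectors X) \<and>
    (\<forall>b. (\<forall>n\<in>I. 0 \<le> b n) \<longrightarrow> nrm X (\<Sum>n\<in>I. scale X (of_real (b n)) (\<zeta> n)) = (\<Sum>n\<in>I. b n)) \<and>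
    (\<Sum>n\<in>I. nrm X (y n - scale X (of_real (nrm X (y n))) (\<zeta> n))) \<le> 2 * \<epsilon> * (\<Sum>n\<in>I. nrm X (y n))"
proof -
  have y: "y n \<in> vectors X" if "n \<in> I" for n using mem that by simp
  define w where "w = (\<Sum>n\<in>I. y n)"
  have w: "w \<in> vectors X" unfolding w_def by (rule sum_mem) (rule y)
  define L where "L = (\<Sum>n\<in>I. nrm X (y n))"
  have L0: "0 \<le> L" unfolding L_def by (intro sum_nonneg nrm_nonneg y)
  have wL: "nrm X w \<le> L" unfolding w_def L_def by (rule nrm_sum_le) (rule y)
  show ?thesis
  proof (cases "nrm X w = 0")
    case True
    then have "L \<le> 0" using le \<eta> by (simp add: w_def L_def mult_le_0_iff)
    then have "L = 0" using L0 by simp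
    then have "\<forall>n\<in>I. nrm X (y n) = 0"
      unfolding L_def using I y nrm_nonneg by (subst (asm) sum_nonneg_eq_0_iff) auto
    then have y0: "\<forall>n\<in>I. y n = 0" using nrm_eq_0_iff y by auto
    \<comment> \<open>All \<open>y n\<close> vanish, so no direction is prescribed and the distances
      are 0 for any choice. Nontriviality supplies one unit vector to be used for every
      index.\<close>
    obtain v where v: "v \<in> vectors X" "v \<noteq> 0" using nontrivial zero_mem by blast
    define u where "u = scale X (of_real (inverse (nrm X v))) v"
    have u: "u \<in> vectors X" "nrm X u = 1"
      using nrm_nonneg[OF v(1)] nrm_eq_0_iff[OF v(1)] v
      by (simp_all add: u_def scale_mem nrm_scale norm_inverse)
    have "nrm X (\<Sum>n\<in>I. scale X (of_real (b n)) u) = (\<Sum>n\<in>I. b n)" if "\<forall>n\<in>I. 0 \<le> b n" for b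
    proof -
      have "(\<Sum>n\<in>I. scale X (of_real (b n)) u) = scale X (of_real (\<Sum>n\<in>I. b n)) u"
        by (simp add: scale_sum_left u)
      moreover have "0 \<le> (\<Sum>n\<in>I. b n)" using that by (simp add: sum_nonneg)
      ultimately show ?thesis using u by (simp only: nrm_scale norm_of_real abs_of_nonneg mult_1_right add_nonneg_nonneg zero_le_one less_imp_le)
    qed
    then show ?thesis
      using u y0 by (intro exI[of _ "\<lambda>_. u"]) (simp add: nrm_zero scale_zero_left)
  next
    case False
    then have w0: "0 < nrm X w" using nrm_nonneg[OF w] by simp
    \<comment> \<open>With this weight the vectors put in place of the zeros have total norm at most
      that of w, hence at most L. The sum of the norms at most doubles, which is the origin of the
      factor 2 in the conclusion.\<close>
    define \<delta> where "\<delta> = 1 / real (card I)"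
    have cI: "card I \<noteq> 0"
    proof
      assume "card I = 0"
      then have "I = {}" using I by simp
      then show False using False by (simp add: w_def nrm_zero)
    qed
    then have \<delta>: "0 < \<delta>" by (simp add: \<delta>_def)
    define N where "N = {n\<in>I. y n = 0}"
    have N: "finite N" "N \<subseteq> I" using I by (auto simp: N_def)
    define m where "m = real (card N) * \<delta>"
    have m: "0 \<le> m" "m \<le> 1"
      using \<delta> cI card_mono[OF I N(2)] by (simp_all add: m_def \<delta>_def)
    define y' where "y' n = y n + (if n \<in> N then scale X (of_real \<delta>) w else 0)" for n
    have y': "y' n \<in> vectors X" if "n \<in> I" for n
      using y[OF that] w by (simp add: y'_def add_mem scale_mem zero_mem)
    have y'1: "y' n = y n" if "n \<in> I" "y n \<noteq> 0" for n using that by (simp add: y'_def N_def)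
    have y'0: "nrm X (y' n) = (if y n = 0 then \<delta> * nrm X w else nrm X (y n))" if "n \<in> I" for n
      using that \<delta> w by (simp add: y'_def N_def nrm_scale)
    have pos: "0 < nrm X (y' n)" if "n \<in> I" for n
      using y'0[OF that] \<delta> w0 nrm_eq_0_iff[OF y[OF that]] nrm_nonneg[OF y[OF that]] by auto
    have "(\<Sum>n\<in>I. nrm X (y' n)) = (\<Sum>n\<in>I. nrm X (y n) + (if n \<in> N then \<delta> * nrm X w else 0))"
      by (rule sum.cong) (auto simp: y'0 N_def nrm_zero)
    also have "\<dots> = L + (\<Sum>n\<in>N. \<delta> * nrm X w)"
      using I N by (simp add: sum.distrib L_def sum.If_cases Int_absorb1)
    also have "\<dots> = L + m * nrm X w" by (simp add: m_def)
    finally have L': "(\<Sum>n\<in>I. nrm X (y' n)) = L + m * nrm X w" .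
    have "(\<Sum>n\<in>I. y' n) = w + (\<Sum>n\<in>N. scale X (of_real \<delta>) w)"
      using I N by (simp add: y'_def sum.distrib sum.If_cases Int_absorb1 flip: w_def)
    also have "\<dots> = scale X (1 + (\<Sum>n\<in>N. of_real \<delta>)) w"
      by (simp only: scale_add_left scale_one scale_sum_left w)
    also have "\<dots> = scale X (of_real (1 + m)) w" by (simp add: m_def)
    also have "nrm X \<dots> = (1 + m) * nrm X w"
      using m w by (simp only: nrm_scale norm_of_real abs_of_nonneg mult_1_right add_nonneg_nonneg zero_le_one less_imp_le)
    finally have w': "nrm X (\<Sum>n\<in>I. y' n) = (1 + m) * nrm X w" .
    \<comment> \<open>Adding multiples of w itself raises the norm of the sum by as much as the sum
      of the norms, so near alignment is preserved with the same \<eta>.\<close>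
    have "(1 - \<eta>) * (m * nrm X w) \<le> 1 * (m * nrm X w)"
      using \<eta> m w0 by (intro mult_right_mono) auto
    then have le': "(1 - \<eta>) * (\<Sum>n\<in>I. nrm X (y' n)) \<le> nrm X (\<Sum>n\<in>I. y' n)"
      unfolding L' w' using le by (simp add: L_def w_def algebra_simps)
    obtain z where z: "\<And>n. n \<in> I \<Longrightarrow> z n \<in> vectors X"
      and align: "\<And>b. (\<And>n. n \<in> I \<Longrightarrow> 0 \<le> b n) \<Longrightarrow>
          nrm X (\<Sum>n\<in>I. scale X (of_real (b n)) (z n)) = (\<Sum>n\<in>I. b n * nrm X (y' n))"
      and close: "(\<Sum>n\<in>I. nrm X (y' n - z n)) \<le> \<epsilon> * (\<Sum>n\<in>I. nrm X (y' n))"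
      by (rule approx_alignableE[OF approx I y' le']) blast+
    define \<zeta> where "\<zeta> n = scale X (of_real (inverse (nrm X (y' n)))) (z n)" for n
    show ?thesis
    proof (intro exI[of _ \<zeta>] conjI ballI allI impI)
      show "\<zeta> n \<in> vectors X" if "n \<in> I" for n using that z by (simp add: \<zeta>_def scale_mem)
      fix b :: "nat \<Rightarrow> real" assume b: "\<forall>n\<in>I. 0 \<le> b n"
      have "(\<Sum>n\<in>I. scale X (of_real (b n)) (\<zeta> n)) =
          (\<Sum>n\<in>I. scale X (of_real (b n * inverse (nrm X (y' n)))) (z n))"
        by (rule sum.cong) (simp_all add: \<zeta>_def scale_scale z)
      also have "nrm X \<dots> = (\<Sum>n\<in>I. b n * inverse (nrm X (y' n)) * nrm X (y' n))"
        by (rule align) (use b pos in \<open>simp add: less_imp_le\<close>)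
      also have "\<dots> = (\<Sum>n\<in>I. b n)"
        by (rule sum.cong) (use pos in \<open>auto simp: less_imp_neq[symmetric]\<close>)
      finally show "nrm X (\<Sum>n\<in>I. scale X (of_real (b n)) (\<zeta> n)) = (\<Sum>n\<in>I. b n)" .
    next
      have "(\<Sum>n\<in>I. nrm X (y n - scale X (of_real (nrm X (y n))) (\<zeta> n))) \<le> (\<Sum>n\<in>I. nrm X (y' n - z n))"
      proof (rule sum_mono)
        fix n assume n: "n \<in> I"
        show "nrm X (y n - scale X (of_real (nrm X (y n))) (\<zeta> n)) \<le> nrm X (y' n - z n)"
        proof (cases "y n = 0")
          case True
          then show ?thesis
            using n z by (simp add: nrm_zero scale_zero_left \<zeta>_def scale_mem nrm_nonneg diff_mem y')
        next
          case False
          then have "nrm X (y n) \<noteq> 0" using nrm_eq_0_iff[OF y[OF n]] by simp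
          then show ?thesis
            using False n by (simp add: \<zeta>_def scale_scale z y'1 scale_one)
        qed
      qed
      also have "\<dots> \<le> \<epsilon> * (L + m * nrm X w)" using close L' by simp
      also have "\<dots> \<le> \<epsilon> * (L + 1 * L)"
        using m w0 wL \<open>0 \<le> \<epsilon>\<close> by (intro mult_left_mono add_left_mono mult_mono) auto
      finally show "(\<Sum>n\<in>I. nrm X (y n - scale X (of_real (nrm X (y n))) (\<zeta> n))) \<le>
          2 * \<epsilon> * (\<Sum>n\<in>I. nrm X (y n))" by (simp add: L_def)
    qed
  qed
qed

subsection \<open>The norm of an \<open>\<ell>\<^sub>p\<close> sum\<close>

text \<open>Convexity on the positive reals covers the interior. If an argument is 0, the claim
  comes down to s powr p \<le> s for s between 0 and 1.\<close>

lemma powr_convex_nonneg: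
  fixes x y :: real
  assumes p: "1 \<le> p" and "0 \<le> x" "0 \<le> y" and \<theta>: "0 \<le> \<theta>" "\<theta> \<le> 1"
  shows "((1 - \<theta>) * x + \<theta> * y) powr p \<le> (1 - \<theta>) * x powr p + \<theta> * y powr p"
proof -
  have scale: "(s * r) powr p \<le> s * r powr p" if "0 \<le> s" "s \<le> 1" "0 \<le> r" for s r :: real
  proof -
    have "s powr p \<le> s powr 1" using that p by (intro powr_mono') auto
    then show ?thesis using that by (simp add: powr_mult mult_right_mono)
  qed
  consider "x = 0" | "y = 0" | "0 < x" "0 < y" using assms by linarith
  then show ?thesis
  proof cases
    case 1
    then show ?thesis using scale[of \<theta> y] assms by simp
  next
    case 2
    then show ?thesis using scale[of "1 - \<theta>" x] assms by simp
  next
    case 3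
    then show ?thesis
      using convex_onD[OF powr_convex[OF p], of \<theta> x y] \<theta> by simp
  qed
qed

lemma powr_add_le:
  fixes x y :: real
  assumes "0 \<le> p" "0 \<le> x" "0 \<le> y"
  shows "(x + y) powr p \<le> 2 powr p * (x powr p + y powr p)"
proof -
  have "(x + y) powr p \<le> (2 * max x y) powr p" by (rule powr_mono2) (use assms in auto)
  also have "\<dots> = 2 powr p * max x y powr p" using assms by (simp add: powr_mult)
  also have "\<dots> \<le> 2 powr p * (x powr p + y powr p)" by (intro mult_left_mono) (auto simp: max_def)
  finally show ?thesis .
qed

lemma summable_powr_add:
  fixes f g :: "nat \<Rightarrow> real"
  assumes "0 \<le> p" "\<And>k. 0 \<le> f k" "\<And>k. 0 \<le> g k"
    and "summable (\<lambda>k. f k powr p)" "summable (\<lambda>k. g k powr p)"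
  shows "summable (\<lambda>k. (f k + g k) powr p)"
proof (rule summable_comparison_test'[of "\<lambda>k. 2 powr p * (f k powr p + g k powr p)" 0])
  show "summable (\<lambda>k. 2 powr p * (f k powr p + g k powr p))"
    using assms by (intro summable_mult summable_add)
qed (use powr_add_le assms in auto)

lemma summable_powr_le:
  fixes f g :: "nat \<Rightarrow> real"
  assumes "summable (\<lambda>k. g k powr p)" "0 \<le> p" "\<And>k. 0 \<le> f k" "\<And>k. f k \<le> g k"
  shows "summable (\<lambda>k. f k powr p)"
  by (rule summable_comparison_test'[OF assms(1), of 0]) (use assms powr_mono2 in auto)

lemma summable_powr_sum:
  fixes f :: "'i \<Rightarrow> nat \<Rightarrow> real"
  assumes "0 \<le> p" "\<And>i k. i \<in> I \<Longrightarrow> 0 \<le> f i k" "\<And>i. i \<in> I \<Longrightarrow> summable (\<lambda>k. f i k powr p)"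
  shows "summable (\<lambda>k. (\<Sum>i\<in>I. f i k) powr p)"
  using assms
proof (induction I rule: infinite_finite_induct)
  case (insert i I)
  then show ?case
    using summable_powr_add[of p "f i" "\<lambda>k. \<Sum>i\<in>I. f i k"] by (simp add: sum_nonneg)
qed auto

text \<open>Convexity of the p-th power is applied to f / A and g / B, where A and B are the norms,
  with weights A / (A + B) and B / (A + B); then one sums over k. If A or B is 0 the corresponding
  sequence vanishes.\<close>

lemma Minkowski_suminf:
  fixes f g :: "nat \<Rightarrow> real"
  assumes p: "1 \<le> p" and f0: "\<And>k. 0 \<le> f k" and g0: "\<And>k. 0 \<le> g k"
    and f: "summable (\<lambda>k. f k powr p)" and g: "summable (\<lambda>k. g k powr p)"
  shows "(\<Sum>k. (f k + g k) powr p) powr (1/p) \<le>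
    (\<Sum>k. f k powr p) powr (1/p) + (\<Sum>k. g k powr p) powr (1/p)"
proof -
  define A where "A = (\<Sum>k. f k powr p) powr (1/p)"
  define B where "B = (\<Sum>k. g k powr p) powr (1/p)"
  have Ap: "A powr p = (\<Sum>k. f k powr p)" and Bp: "B powr p = (\<Sum>k. g k powr p)"
    using p f g by (simp_all add: A_def B_def powr_powr suminf_nonneg)
  have zero: "f k = 0" if "A = 0" for k
    using that Ap p suminf_eq_zero_iff[OF f] by simp
  have zero': "g k = 0" if "B = 0" for k
    using that Bp p suminf_eq_zero_iff[OF g] by simp
  have AB: "0 \<le> A" "0 \<le> B" by (simp_all add: A_def B_def)
  consider "A = 0" | "B = 0" | "0 < A" "0 < B" using AB by linarith
  then have "(\<Sum>k. (f k + g k) powr p) powr (1/p) \<le> A + B"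
  proof cases
    case 1
    then show ?thesis using zero by (simp add: B_def)
  next
    case 2
    then show ?thesis using zero' by (simp add: A_def)
  next
    case 3
    define \<theta> where "\<theta> = B / (A + B)"
    have \<theta>: "0 \<le> \<theta>" "\<theta> \<le> 1" "(A + B) * (1 - \<theta>) = A" "(A + B) * \<theta> = B"
      using 3 by (auto simp: \<theta>_def field_simps)
    have point: "(f k + g k) powr p \<le>
        (A + B) powr p * ((1 - \<theta>) * (f k powr p / A powr p) + \<theta> * (g k powr p / B powr p))" for k
    proof -
      have "f k + g k = ((A + B) * (1 - \<theta>)) * (f k / A) + ((A + B) * \<theta>) * (g k / B)"
        unfolding \<theta>(3,4) using 3 by simp
      also have "\<dots> = (A + B) * ((1 - \<theta>) * (f k / A) + \<theta> * (g k / B))" by (simp only: distrib_left mult.assoc)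
      also have "\<dots> powr p = (A + B) powr p * ((1 - \<theta>) * (f k / A) + \<theta> * (g k / B)) powr p"
        by (rule powr_mult)
      also have "\<dots> \<le> (A + B) powr p * ((1 - \<theta>) * (f k / A) powr p + \<theta> * (g k / B) powr p)"
        using 3 \<theta> f0 g0 p by (intro mult_left_mono powr_convex_nonneg) auto
      finally show ?thesis using 3 f0 g0 by (simp add: powr_divide)
    qed
    have sums: "(\<lambda>k. (A + B) powr p * ((1 - \<theta>) * (f k powr p / A powr p) + \<theta> * (g k powr p / B powr p)))
        sums ((A + B) powr p * ((1 - \<theta>) * (A powr p / A powr p) + \<theta> * (B powr p / B powr p)))"
      unfolding Ap Bp using f g
      by (intro sums_mult sums_add sums_divide) (auto intro: summable_sums)
    have "(\<Sum>k. (f k + g k) powr p) \<le>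
        (A + B) powr p * ((1 - \<theta>) * (A powr p / A powr p) + \<theta> * (B powr p / B powr p))"
      unfolding sums_unique[OF sums]
      by (rule suminf_le[OF point summable_powr_add sums_summable[OF sums]]) (use p f0 g0 f g in auto)
    also have "\<dots> = (A + B) powr p" using 3 by simp
    finally have "(\<Sum>k. (f k + g k) powr p) powr (1/p) \<le> ((A + B) powr p) powr (1/p)"
      using p f0 g0 f g by (intro powr_mono2 suminf_nonneg summable_powr_add) auto
    then show ?thesis using p 3 by (simp add: powr_powr)
  qed
  then show ?thesis by (simp add: A_def B_def)
qed

lemma vectors_lp_sum:
  "x \<in> vectors (lp_sum p X) \<longleftrightarrow>
    (\<forall>k. x k \<in> vectors (X k)) \<and> summable (\<lambda>k. nrm (X k) (x k) powr p)"
  by (simp add: lp_sum_def)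

lemma scale_lp_sum: "scale (lp_sum p X) c x = (\<lambda>k. scale (X k) c (x k))"
  by (simp add: lp_sum_def)

lemma nrm_lp_sum: "nrm (lp_sum p X) x = (\<Sum>k. nrm (X k) (x k) powr p) powr (1/p)"
  by (simp add: lp_sum_def)

lemma normed_space_lp_sum:
  fixes X :: "nat \<Rightarrow> ('k::real_or_complex, 'a::ab_group_add) nspace"
  assumes X: "\<And>k. normed_space_on (X k)" and p: "1 \<le> p"
  shows "normed_space_on (lp_sum p X)"
proof
  interpret X: normed_space_on "X k" for k by (rule X)
  fix x y :: "nat \<Rightarrow> 'a" and c d :: 'k
  show "0 \<in> vectors (lp_sum p X)" by (simp add: vectors_lp_sum X.zero_mem X.nrm_zero)
  assume x: "x \<in> vectors (lp_sum p X)"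
  have xk: "x k \<in> vectors (X k)" for k using x by (simp add: vectors_lp_sum)
  have xs: "summable (\<lambda>k. nrm (X k) (x k) powr p)" using x by (simp add: vectors_lp_sum)
  have nc: "nrm (X k) (scale (X k) c (x k)) powr p = norm c powr p * nrm (X k) (x k) powr p" for k
    by (simp add: X.nrm_scale xk powr_mult X.nrm_nonneg)
  show "scale (lp_sum p X) c x \<in> vectors (lp_sum p X)"
    using xs by (simp add: vectors_lp_sum scale_lp_sum X.scale_mem xk nc summable_mult)
  show "scale (lp_sum p X) (c + d) x = scale (lp_sum p X) c x + scale (lp_sum p X) d x"
    "scale (lp_sum p X) c (scale (lp_sum p X) d x) = scale (lp_sum p X) (c * d) x"
    "scale (lp_sum p X) 1 x = x"
    by (auto simp: scale_lp_sum X.scale_add_left X.scale_scale X.scale_one xk)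
  have "nrm (lp_sum p X) x = 0 \<longleftrightarrow> (\<forall>k. nrm (X k) (x k) = 0)"
    using suminf_eq_zero_iff[OF xs] by (simp add: nrm_lp_sum)
  then show "nrm (lp_sum p X) x = 0 \<longleftrightarrow> x = 0"
    by (simp add: X.nrm_eq_0_iff xk fun_eq_iff)
  have "(norm c powr p * (\<Sum>k. nrm (X k) (x k) powr p)) powr (1/p) = norm c * nrm (lp_sum p X) x"
    using p xs by (simp add: powr_mult powr_powr nrm_lp_sum suminf_nonneg)
  then show "nrm (lp_sum p X) (scale (lp_sum p X) c x) = norm c * nrm (lp_sum p X) x"
    using xs by (simp add: nrm_lp_sum scale_lp_sum nc suminf_mult)
  assume y: "y \<in> vectors (lp_sum p X)"
  have yk: "y k \<in> vectors (X k)" for k using y by (simp add: vectors_lp_sum)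
  have ys: "summable (\<lambda>k. nrm (X k) (y k) powr p)" using y by (simp add: vectors_lp_sum)
  have le: "nrm (X k) (x k + y k) \<le> nrm (X k) (x k) + nrm (X k) (y k)" for k
    by (rule X.nrm_triangle[OF xk yk])
  have sum: "summable (\<lambda>k. (nrm (X k) (x k) + nrm (X k) (y k)) powr p)"
    using p xs ys by (intro summable_powr_add) (auto simp: X.nrm_nonneg xk yk)
  have xys: "summable (\<lambda>k. nrm (X k) (x k + y k) powr p)"
    by (rule summable_powr_le[OF sum]) (use p le in \<open>auto simp: X.nrm_nonneg X.add_mem xk yk\<close>)
  then show "x + y \<in> vectors (lp_sum p X)" by (simp add: vectors_lp_sum X.add_mem xk yk)
  show "scale (lp_sum p X) c (x + y) = scale (lp_sum p X) c x + scale (lp_sum p X) c y"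
    by (auto simp: scale_lp_sum X.scale_add_right xk yk)
  have "nrm (lp_sum p X) (x + y) \<le> (\<Sum>k. (nrm (X k) (x k) + nrm (X k) (y k)) powr p) powr (1/p)"
    unfolding nrm_lp_sum plus_fun_apply using p le xys sum
    by (intro powr_mono2 suminf_le suminf_nonneg) (auto simp: X.nrm_nonneg X.add_mem xk yk)
  also have "\<dots> \<le> nrm (lp_sum p X) x + nrm (lp_sum p X) y"
    unfolding nrm_lp_sum by (rule Minkowski_suminf[OF p _ _ xs ys]) (auto simp: X.nrm_nonneg xk yk)
  finally show "nrm (lp_sum p X) (x + y) \<le> nrm (lp_sum p X) x + nrm (lp_sum p X) y" .
qed

text \<open>Prepares a choice over all coordinates: aligned unit vectors exist whether or not the
  \<open>y n\<close> are nearly aligned, and only their closeness to the \<open>y n\<close> is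
  conditional. Otherwise the construction is applied to zero vectors, which satisfy its hypothesis
  trivially.\<close>

lemma (in normed_space_on) ex_aligned_unit_vectors:
  assumes approx: "approx_alignable X \<eta> \<epsilon>" and \<eta>: "0 \<le> \<eta>" "\<eta> < 1" and "0 \<le> \<epsilon>"
    and nontrivial: "vectors X \<noteq> {0}" and I: "finite (I :: nat set)"
    and y: "\<And>n. n \<in> I \<Longrightarrow> y n \<in> vectors X"
  shows "\<exists>\<zeta>. (\<forall>n\<in>I. \<zeta> n \<in> vectors X \<and> nrm X (\<zeta> n) = 1) \<and>
    (\<forall>b. (\<forall>n\<in>I. 0 \<le> b n) \<longrightarrow> nrm X (\<Sum>n\<in>I. scale X (of_real (b n)) (\<zeta> n)) = (\<Sum>n\<in>I. b n)) \<and>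
    ((1 - \<eta>) * (\<Sum>n\<in>I. nrm X (y n)) \<le> nrm X (\<Sum>n\<in>I. y n) \<longrightarrow>
      (\<Sum>n\<in>I. nrm X (y n - scale X (of_real (nrm X (y n))) (\<zeta> n))) \<le> 2 * \<epsilon> * (\<Sum>n\<in>I. nrm X (y n)))"
proof -
  define good where "good \<longleftrightarrow> (1 - \<eta>) * (\<Sum>n\<in>I. nrm X (y n)) \<le> nrm X (\<Sum>n\<in>I. y n)"
  define y' where "y' n = (if good then y n else 0)" for n
  have y': "\<forall>n\<in>I. y' n \<in> vectors X" using y zero_mem by (simp add: y'_def)
  have "(1 - \<eta>) * (\<Sum>n\<in>I. nrm X (y' n)) \<le> nrm X (\<Sum>n\<in>I. y' n)"
    using nrm_zero by (cases good) (simp_all add: y'_def, simp add: good_def)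
  from approx_alignable_unit_vectors[OF approx \<eta> \<open>0 \<le> \<epsilon>\<close> nontrivial I y' this]
  obtain \<zeta> where \<zeta>: "\<forall>n\<in>I. \<zeta> n \<in> vectors X"
    and align: "\<forall>b. (\<forall>n\<in>I. 0 \<le> b n) \<longrightarrow> nrm X (\<Sum>n\<in>I. scale X (of_real (b n)) (\<zeta> n)) = (\<Sum>n\<in>I. b n)"
    and close: "(\<Sum>n\<in>I. nrm X (y' n - scale X (of_real (nrm X (y' n))) (\<zeta> n))) \<le> 2 * \<epsilon> * (\<Sum>n\<in>I. nrm X (y' n))"
    by (elim exE conjE)
  have "nrm X (\<zeta> n) = 1" if "n \<in> I" for n
  proof -
    have "(\<Sum>m\<in>I. scale X (of_real (if m = n then 1 else 0)) (\<zeta> m)) = (\<Sum>m\<in>I. if m = n then \<zeta> n else 0)"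
      by (rule sum.cong) (auto simp: scale_one scale_zero_left \<zeta>)
    then show ?thesis
      using align[rule_format, of "\<lambda>m. if m = n then 1 else 0"] that I by (simp add: sum.delta')
  qed
  then show ?thesis
    using \<zeta> align close by (intro exI[of _ \<zeta>] conjI) (auto simp: y'_def good_def)
qed

subsection \<open>Stability of Young's inequality\<close>

text \<open>The difference of the two sides of Young's inequality for a and b^(p-1), with conjugate
  exponents p and p / (p - 1).\<close>

definition young_gap :: "real \<Rightarrow> real \<Rightarrow> real \<Rightarrow> real" where
  "young_gap p a b = a powr p / p + (1 - 1/p) * b powr p - a * b powr (p - 1)"

lemma young_gap_nonneg:
  assumes "1 < p" "0 \<le> a" "0 \<le> b"
  shows "0 \<le> young_gap p a b"
proof -
  have "a * b powr (p - 1) \<le> a powr p / p + (b powr (p - 1)) powr (p / (p - 1)) / (p / (p - 1))"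
    by (rule Youngs_inequality) (use assms in \<open>auto simp: field_simps\<close>)
  moreover have "(b powr (p - 1)) powr (p / (p - 1)) = b powr p"
    using assms by (simp add: powr_powr)
  ultimately show ?thesis using assms by (simp add: young_gap_def field_simps)
qed

text \<open>Strict convexity at the point 1: by the mean value theorem the slope of the chord is p
  z^(p-1) with z strictly between t and 1, which lies strictly on the required side of p.\<close>

lemma powr_gt_tangent:
  fixes t :: real
  assumes p: "1 < p" and "0 \<le> t" "t \<noteq> 1"
  shows "1 + p * (t - 1) < t powr p"
proof (cases "t = 0")
  case True
  then show ?thesis using p by simp
next
  case False
  then have t: "0 < t" using assms by simp
  have deriv: "((\<lambda>x. x powr p) has_real_derivative p * x powr (p - 1)) (at x)" if "0 < x" for x
    using has_real_derivative_powr[OF that, of p] by simp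
  show ?thesis
  proof (cases "1 < t")
    case True
    obtain z where z: "1 < z" "z < t" "t powr p - 1 powr p = (t - 1) * (p * z powr (p - 1))"
      using MVT2[OF True, of "\<lambda>x. x powr p" "\<lambda>x. p * x powr (p - 1)"] deriv by auto
    have "1 < z powr (p - 1)" using z(1) p by simp
    then have "(t - 1) * (p * 1) < (t - 1) * (p * z powr (p - 1))"
      using True p by (intro mult_strict_left_mono) auto
    then show ?thesis using z(3) by (simp add: mult.commute)
  next
    case False
    then have t1: "t < 1" using assms by simp
    obtain z where z: "t < z" "z < 1" "1 powr p - t powr p = (1 - t) * (p * z powr (p - 1))"
      using MVT2[OF t1, of "\<lambda>x. x powr p" "\<lambda>x. p * x powr (p - 1)"] deriv t by auto
    have "z powr (p - 1) < 1 powr (p - 1)"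
      using z t p by (intro powr_less_mono2) auto
    then have "(1 - t) * (p * z powr (p - 1)) < (1 - t) * (p * 1)"
      using t1 p by (intro mult_strict_left_mono) auto
    then show ?thesis using z(3) by (simp add: algebra_simps)
  qed
qed

text \<open>For positive b, the gap divided by b^p / p is the distance from the p-th power to its
  tangent at 1, taken at the quotient a / b.\<close>

lemma young_gap_pos:
  assumes p: "1 < p" and a: "0 \<le> a" and b: "0 \<le> b" and "a \<noteq> b"
  shows "0 < young_gap p a b"
proof (cases "b = 0")
  case True
  then show ?thesis using assms by (simp add: young_gap_def)
next
  case False
  then have b: "0 < b" using b by simp
  have "b powr (p - 1) = b powr p / b" using b by (simp add: powr_diff)
  then have "young_gap p a b = b powr p / p * ((a / b) powr p - (1 + p * (a / b - 1)))"
    using a b p by (simp add: young_gap_def powr_divide field_simps)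
  moreover have "1 + p * (a / b - 1) < (a / b) powr p"
    using assms b by (intro powr_gt_tangent) auto
  ultimately show ?thesis using b p by simp
qed

text \<open>Equality in Young's inequality forces \<open>a = b\<close>; compactness and homogeneity make this
  quantitative.\<close>

lemma powr_dist_le_young_gap:
  assumes p: "1 < p" and \<tau>: "0 < \<tau>"
  shows "\<exists>C\<ge>0. \<forall>a\<ge>0. \<forall>b\<ge>0. \<bar>a - b\<bar> powr p \<le> \<tau> * (a powr p + b powr p) + C * young_gap p a b"
proof -
  \<comment> \<open>By homogeneity it suffices to treat pairs with maximum 1. Keeping away from the
    diagonal by \<tau> gives a compact set on which the gap has a positive minimum.\<close>
  define S :: "(real \<times> real) set" where "S = ({0..1} \<times> {0..1}) \<inter> {x. max (fst x) (snd x) = 1} \<inter>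
    {x. \<tau> \<le> \<bar>fst x - snd x\<bar> powr p}"
  have closed: "closed {x :: real \<times> real. max (fst x) (snd x) = 1}"
    by (intro closed_Collect_eq continuous_intros)
  have "closed {x :: real \<times> real. \<tau> \<le> \<bar>fst x - snd x\<bar> powr p}"
    using p by (intro closed_Collect_le continuous_on_powr' continuous_intros) auto
  then have "compact S" unfolding S_def
    by (intro compact_Int_closed closed compact_Times compact_Icc)
  have cont: "continuous_on S (\<lambda>x. young_gap p (fst x) (snd x))"
    unfolding young_gap_def using p
    by (intro continuous_intros continuous_on_powr') (auto simp: S_def)
  have "\<exists>m>0. \<forall>x\<in>S. m \<le> young_gap p (fst x) (snd x)"
  proof (cases "S = {}")
    \<comment> \<open>This occurs for \<tau> > 1; any positive number then serves as the
      minimum.\<close>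
    case True
    then show ?thesis by (intro exI[of _ 1]) simp
  next
    case False
    obtain x where x: "x \<in> S" "\<And>y. y \<in> S \<Longrightarrow> young_gap p (fst x) (snd x) \<le> young_gap p (fst y) (snd y)"
      using continuous_attains_inf[OF \<open>compact S\<close> False cont] by blast
    have "0 < young_gap p (fst x) (snd x)"
      using x(1) p \<tau> by (intro young_gap_pos) (auto simp: S_def)
    then show ?thesis using x(2) by blast
  qed
  then obtain m where m: "0 < m" "\<And>x. x \<in> S \<Longrightarrow> m \<le> young_gap p (fst x) (snd x)" by blast
  \<comment> \<open>After scaling, the left side is at most 1. On \<open>S\<close> the gap term
    alone is at least 1; off \<open>S\<close> the left side is below \<tau>, and the sum of the
    powers is at least 1.\<close>
  have "\<bar>a - b\<bar> powr p \<le> \<tau> * (a powr p + b powr p) + 1 / m * young_gap p a b"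
    if ab: "0 \<le> a" "0 \<le> b" for a b
  proof (cases "max a b = 0")
    case True
    then have "a = 0" "b = 0" using ab by (auto simp: max_def split: if_splits)
    then show ?thesis by (simp add: young_gap_def)
  next
    case False
    define M where "M = max a b"
    have M: "0 < M" "a \<le> M" "b \<le> M" using False ab by (auto simp: M_def)
    define \<alpha> where "\<alpha> = a / M"
    define \<beta> where "\<beta> = b / M"
    have \<alpha>\<beta>: "0 \<le> \<alpha>" "\<alpha> \<le> 1" "0 \<le> \<beta>" "\<beta> \<le> 1" using ab M by (auto simp: \<alpha>_def \<beta>_def)
    have eq: "a = M * \<alpha>" "b = M * \<beta>" using M by (auto simp: \<alpha>_def \<beta>_def)
    have mx: "max \<alpha> \<beta> = 1" using M ab by (auto simp: \<alpha>_def \<beta>_def M_def max_def)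
    have one: "1 \<le> \<alpha> powr p + \<beta> powr p" using mx by (auto simp: max_def split: if_splits)
    have *: "\<bar>\<alpha> - \<beta>\<bar> powr p \<le> \<tau> * (\<alpha> powr p + \<beta> powr p) + 1 / m * young_gap p \<alpha> \<beta>"
    proof (cases "\<tau> \<le> \<bar>\<alpha> - \<beta>\<bar> powr p")
      case True
      then have "m \<le> young_gap p \<alpha> \<beta>" using m(2)[of "(\<alpha>, \<beta>)"] \<alpha>\<beta> mx by (simp add: S_def)
      then have "1 \<le> 1 / m * young_gap p \<alpha> \<beta>" using m(1) by (simp add: field_simps)
      moreover have "\<bar>\<alpha> - \<beta>\<bar> powr p \<le> 1" using \<alpha>\<beta> p by (intro powr_le1) auto
      moreover have "0 \<le> \<tau> * (\<alpha> powr p + \<beta> powr p)" using \<tau> by simp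
      ultimately show ?thesis by linarith
    next
      case False
      moreover have "\<tau> * 1 \<le> \<tau> * (\<alpha> powr p + \<beta> powr p)" using \<tau> one by (intro mult_left_mono) auto
      moreover have "0 \<le> 1 / m * young_gap p \<alpha> \<beta>"
        using m(1) young_gap_nonneg[OF p \<alpha>\<beta>(1,3)] by simp
      ultimately show ?thesis by linarith
    qed
    have "\<bar>a - b\<bar> = M * \<bar>\<alpha> - \<beta>\<bar>" using M by (simp add: eq abs_mult flip: right_diff_distrib)
    then have 1: "\<bar>a - b\<bar> powr p = M powr p * \<bar>\<alpha> - \<beta>\<bar> powr p" by (simp add: powr_mult)
    have "M * M powr (p - 1) = M powr p" using M by (simp add: powr_diff)
    then have 2: "young_gap p a b = M powr p * young_gap p \<alpha> \<beta>"
      by (simp add: young_gap_def eq powr_mult algebra_simps)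
    show ?thesis
      using mult_left_mono[OF *, of "M powr p"] unfolding 1 2 by (simp add: eq powr_mult algebra_simps)
  qed
  then show ?thesis using m(1) by (intro exI[of _ "1 / m"]) auto
qed

text \<open>Turns a bound on a weighted mean of p-th powers into one on the mean of the numbers
  themselves. Numbers up to s cost s; for larger ones x^(1-p) \<le> s^(1-p).\<close>

lemma le_add_powr:
  fixes x s :: real
  assumes "1 \<le> p" "0 \<le> x" "0 < s"
  shows "x \<le> s + s powr (1 - p) * x powr p"
proof (cases "x \<le> s")
  case True
  then show ?thesis using assms by (simp add: add_increasing2)
next
  case False
  then have "x powr (1 - p) \<le> s powr (1 - p)" using assms by (intro powr_mono2') auto
  then have "x powr (1 - p) * x powr p \<le> s powr (1 - p) * x powr p" by (rule mult_right_mono) simp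
  moreover have "x powr (1 - p) * x powr p = x" using False assms by (simp flip: powr_add)
  ultimately show ?thesis using assms by simp
qed

text \<open>The part of d above 2 u is at most twice the distance from c to u, since d \<le> 2 c; so
  d can be cut down to its minimum m with 2 u. Writing m^p as m times m^(p-1) leaves a term linear
  in d, which can be summed over the vectors with their weights before any smallness is used. The 6
  is 2 times 3.\<close>

lemma powr_deviation_le:
  fixes c d u :: real
  assumes p: "1 < p" and c: "0 \<le> c" and u: "0 \<le> u" and d: "0 \<le> d" "d \<le> 2 * c"
  shows "(d + \<bar>c - u\<bar>) powr p \<le> 2 powr p * (d * (2 * u) powr (p - 1)) + 6 powr p * \<bar>c - u\<bar> powr p"
proof -
  define m where "m = min d (2 * u)"
  have m: "0 \<le> m" "m \<le> d" "m \<le> 2 * u" using d u by (auto simp: m_def)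
  have "d + \<bar>c - u\<bar> \<le> m + 3 * \<bar>c - u\<bar>" using d by (auto simp: m_def min_def abs_if)
  then have "(d + \<bar>c - u\<bar>) powr p \<le> (m + 3 * \<bar>c - u\<bar>) powr p"
    using d p by (intro powr_mono2) auto
  also have "\<dots> \<le> 2 powr p * (m powr p + (3 * \<bar>c - u\<bar>) powr p)"
    using m p by (intro powr_add_le) auto
  also have "m powr p \<le> d * (2 * u) powr (p - 1)"
  proof (cases "m = 0")
    case True
    then show ?thesis using d by simp
  next
    case False
    then have "m powr p = m * m powr (p - 1)" using m by (simp add: powr_diff)
    also have "\<dots> \<le> d * (2 * u) powr (p - 1)"
      using m p d by (intro mult_mono powr_mono2) auto
    finally show ?thesis .
  qed
  also have "2 powr p * (d * (2 * u) powr (p - 1) + (3 * \<bar>c - u\<bar>) powr p) =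
      2 powr p * (d * (2 * u) powr (p - 1)) + (2 * 3) powr p * \<bar>c - u\<bar> powr p"
    by (simp only: powr_mult distrib_left mult.assoc)
  finally show ?thesis by simp
qed

text \<open>Concerns a single coordinate with total deviation D. If the coordinate is nearly
  aligned, D is small by hypothesis. If not, w / V is at most (1 - \<eta>) u, so the loss of p-th
  power is at least \<eta> u^p and pays for the trivial bound on D. The right side covers both cases
  and can be summed over coordinates.\<close>

lemma powr_mult_deviation_sum_le:
  fixes V u w D :: real
  assumes p: "1 \<le> p" and V: "0 < V" and u: "0 \<le> u" and w: "0 \<le> w" "w \<le> V * u"
    and \<eta>: "0 < \<eta>" "\<eta> \<le> 1" and "0 \<le> \<epsilon>"
    and D: "0 \<le> D" "D \<le> 2 * (V * u)" "(1 - \<eta>) * (V * u) \<le> w \<Longrightarrow> D \<le> \<epsilon> * (V * u)"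
  shows "u powr (p - 1) * D \<le> V * (\<epsilon> * u powr p + 2 / \<eta> * (u powr p - w powr p / V powr p))"
proof -
  have uu: "u powr (p - 1) * u = u powr p" using u by (cases "u = 0") (simp_all add: powr_diff)
  define g where "g = w / V"
  have g: "0 \<le> g" "g \<le> u" using w V by (simp_all add: g_def field_simps)
  have gp: "w powr p / V powr p = g powr p" using w V by (simp add: g_def powr_divide)
  have gu: "g powr p \<le> u powr p" using g p by (intro powr_mono2) auto
  show ?thesis
  proof (cases "(1 - \<eta>) * (V * u) \<le> w")
    case True
    have "u powr (p - 1) * D \<le> u powr (p - 1) * (\<epsilon> * (V * u))"
      by (rule mult_left_mono[OF D(3)[OF True]]) simp
    also have "\<dots> = V * (\<epsilon> * u powr p)" by (simp add: mult.left_commute flip: uu)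
    also have "\<dots> \<le> V * (\<epsilon> * u powr p + 2 / \<eta> * (u powr p - w powr p / V powr p))"
      using V gu \<eta> unfolding gp by (intro mult_left_mono) auto
    finally show ?thesis .
  next
    case False
    then have "g \<le> (1 - \<eta>) * u" using V by (simp add: g_def field_simps)
    then have "g powr p \<le> ((1 - \<eta>) * u) powr p" using g p by (intro powr_mono2) auto
    also have "\<dots> = (1 - \<eta>) powr p * u powr p" by (rule powr_mult)
    also have "\<dots> \<le> (1 - \<eta>) * u powr p"
      using powr_mono'[of 1 p "1 - \<eta>"] p \<eta> by (intro mult_right_mono) auto
    finally have *: "u powr p \<le> 1 / \<eta> * (u powr p - g powr p)" using \<eta> by (simp add: field_simps)
    have "u powr (p - 1) * D \<le> u powr (p - 1) * (2 * (V * u))" by (rule mult_left_mono[OF D(2)]) simp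
    also have "\<dots> = V * (2 * u powr p)" by (simp add: mult.left_commute flip: uu)
    also have "\<dots> \<le> V * (2 * (1 / \<eta> * (u powr p - g powr p)))" using V * by (intro mult_left_mono) auto
    also have "\<dots> \<le> V * (\<epsilon> * u powr p + 2 / \<eta> * (u powr p - w powr p / V powr p))"
      using V \<open>0 \<le> \<epsilon>\<close> unfolding gp by (intro mult_left_mono) auto
    finally show ?thesis .
  qed
qed

text \<open>In the application \<open>a n\<close> is the norm of the n-th vector, \<open>c n\<close>
  its normalised sequence of coordinate norms, \<open>d n\<close> the normalised coordinate
  distances to the aligned directions, V times u the sum of the norm sequences, and w the coordinate
  norms of the sum of the vectors. Near maximality is used twice: \<open>VL\<close> makes the total
  Young gap between \<open>c n\<close> and u small, and \<open>W\<close> limits the coordinates that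
  are not nearly aligned.\<close>

lemma sum_lp_deviation_le:
  fixes c d :: "nat \<Rightarrow> nat \<Rightarrow> real" and a :: "nat \<Rightarrow> real" and u w :: "nat \<Rightarrow> real"
  assumes p: "1 < p" and I: "finite I" and a: "\<And>n. n \<in> I \<Longrightarrow> 0 \<le> a n"
    and c: "\<And>n k. n \<in> I \<Longrightarrow> 0 \<le> c n k" and cs: "\<And>n. n \<in> I \<Longrightarrow> summable (\<lambda>k. c n k powr p)"
    and c1: "\<And>n. n \<in> I \<Longrightarrow> (\<Sum>k. c n k powr p) \<le> 1"
    and d: "\<And>n k. n \<in> I \<Longrightarrow> 0 \<le> d n k" "\<And>n k. n \<in> I \<Longrightarrow> d n k \<le> 2 * c n k"
    and V: "0 < V" and u: "\<And>k. 0 \<le> u k" and us: "(\<lambda>k. u k powr p) sums 1"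
    and Vu: "\<And>k. V * u k = (\<Sum>n\<in>I. a n * c n k)"
    and w: "\<And>k. 0 \<le> w k" "\<And>k. w k \<le> V * u k" and ws: "summable (\<lambda>k. w k powr p)"
    and \<eta>': "0 < \<eta>'" "\<eta>' \<le> 1" and \<epsilon>': "0 \<le> \<epsilon>'"
    and D: "\<And>k. (1 - \<eta>') * (V * u k) \<le> w k \<Longrightarrow> (\<Sum>n\<in>I. a n * d n k) \<le> \<epsilon>' * (V * u k)"
    and L: "L = (\<Sum>n\<in>I. a n)" and W: "(1 - \<theta>) * L powr p \<le> (\<Sum>k. w k powr p)" and \<theta>: "0 \<le> \<theta>" "\<theta> \<le> 1"
    and VL: "(1 - \<eta>) * L \<le> V"
    and \<tau>: "0 \<le> \<tau>" and C: "0 \<le> C"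
    and gap: "\<And>x y. 0 \<le> x \<Longrightarrow> 0 \<le> y \<Longrightarrow>
      \<bar>x - y\<bar> powr p \<le> \<tau> * (x powr p + y powr p) + C * young_gap p x y"
  shows "\<And>n. n \<in> I \<Longrightarrow> summable (\<lambda>k. (d n k + \<bar>c n k - u k\<bar>) powr p)"
    and "(\<Sum>n\<in>I. a n * (\<Sum>k. (d n k + \<bar>c n k - u k\<bar>) powr p)) \<le>
      L * (2 powr p * 2 powr (p - 1) * (\<epsilon>' + 2 / \<eta>' * \<theta>) + 6 powr p * (2 * \<tau> + C * \<eta>))"
proof -
  have us': "summable (\<lambda>k. u k powr p)" using us by (rule sums_summable)
  show E: "summable (\<lambda>k. (d n k + \<bar>c n k - u k\<bar>) powr p)" if n: "n \<in> I" for n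
  proof -
    have "summable (\<lambda>k. (3 * c n k) powr p)" using cs[OF n] by (simp add: powr_mult summable_mult)
    then have "summable (\<lambda>k. (3 * c n k + u k) powr p)"
      by (rule summable_powr_add[rotated 3]) (use p c n u us' in auto)
    then show ?thesis
    proof (rule summable_powr_le)
      show "d n k + \<bar>c n k - u k\<bar> \<le> 3 * c n k + u k" for k
        using d(2)[OF n, of k] c[OF n, of k] u[of k] by linarith
      show "0 \<le> d n k + \<bar>c n k - u k\<bar>" for k using d(1)[OF n, of k] by simp
    qed (use p in simp)
  qed
  have L0: "0 \<le> L" unfolding L by (rule sum_nonneg) (rule a)
  define D' where "D' k = (\<Sum>n\<in>I. a n * d n k)" for k
  define P where "P k = (\<Sum>n\<in>I. a n * c n k powr p)" for k
  define Q where "Q = (\<Sum>n\<in>I. a n * (\<Sum>k. c n k powr p))"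
  have Ps: "P sums Q"
    unfolding P_def Q_def using cs by (intro sums_sum sums_mult summable_sums)
  have QL: "Q \<le> L"
    unfolding Q_def L using mult_left_mono[OF c1 a] by (intro sum_mono) auto
  have uu: "u k * u k powr (p - 1) = u k powr p" for k
    using u[of k] by (cases "u k = 0") (simp_all add: powr_diff)
  \<comment> \<open>The weighted Young gap of coordinate k. Its mixed terms add up to V u^p because
    V u is the weighted sum of the \<open>c n\<close>, so its sum over k can be computed.\<close>
  define G where "G k = P k / p + (1 - 1/p) * (L * u k powr p) - V * u k powr p" for k
  have G: "G k = (\<Sum>n\<in>I. a n * young_gap p (c n k) (u k))" for k
  proof -
    have "V * u k powr p = (\<Sum>n\<in>I. a n * c n k) * u k powr (p - 1)"
      by (simp flip: Vu uu)
    then show ?thesis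
      by (simp add: G_def P_def young_gap_def L right_diff_distrib distrib_left sum.distrib
          sum_subtractf sum_distrib_right sum_distrib_left sum_divide_distrib mult_ac)
  qed
  have Gs: "G sums (Q / p + (1 - 1/p) * (L * 1) - V * 1)"
    unfolding G_def by (intro sums_add sums_diff sums_mult sums_divide Ps us)
  have G0: "0 \<le> G k" for k
    unfolding G using p by (intro sum_nonneg mult_nonneg_nonneg a young_gap_nonneg c u) auto
  have "0 \<le> Q / p + (1 - 1/p) * (L * 1) - V * 1"
    using sums_le[OF G0 sums_zero Gs] .
  moreover have "Q / p + (1 - 1/p) * (L * 1) \<le> L"
    using QL p by (simp add: field_simps)
  \<comment> \<open>Nonnegativity of the gaps yields V \<le> L. Since also Q \<le> L, their total is
    at most L - V, hence at most \<eta> L.\<close>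
  ultimately have V_le: "V \<le> L" and sumG: "Q / p + (1 - 1/p) * (L * 1) - V * 1 \<le> \<eta> * L"
    using VL by (auto simp: algebra_simps)
  \<comment> \<open>A majorant of the deviation in coordinate k, built only from sequences whose
    sums over k are known.\<close>
  define H where "H k = 2 powr p * 2 powr (p - 1) *
      (V * (\<epsilon>' * u k powr p + 2 / \<eta>' * (u k powr p - w k powr p / V powr p))) +
      6 powr p * (\<tau> * (P k + L * u k powr p) + C * G k)" for k
  define W' where "W' = (\<Sum>k. w k powr p)"
  have Hs: "H sums (2 powr p * 2 powr (p - 1) * (V * (\<epsilon>' * 1 + 2 / \<eta>' * (1 - W' / V powr p))) +
      6 powr p * (\<tau> * (Q + L * 1) + C * (Q / p + (1 - 1/p) * (L * 1) - V * 1)))"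
    unfolding H_def W'_def
    by (intro sums_add sums_diff sums_mult sums_divide Ps us Gs summable_sums[OF ws])
  have point: "(\<Sum>n\<in>I. a n * (d n k + \<bar>c n k - u k\<bar>) powr p) \<le> H k" for k
  proof -
    have "(\<Sum>n\<in>I. a n * (d n k + \<bar>c n k - u k\<bar>) powr p) \<le>
      (\<Sum>n\<in>I. a n * (2 powr p * (d n k * (2 * u k) powr (p - 1)) +
        6 powr p * (\<tau> * (c n k powr p + u k powr p) + C * young_gap p (c n k) (u k))))"
    proof (intro sum_mono mult_left_mono a)
      fix n assume n: "n \<in> I"
      have "6 powr p * \<bar>c n k - u k\<bar> powr p \<le>
          6 powr p * (\<tau> * (c n k powr p + u k powr p) + C * young_gap p (c n k) (u k))"
        by (intro mult_left_mono gap c[OF n] u) simp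
      then show "(d n k + \<bar>c n k - u k\<bar>) powr p \<le> 2 powr p * (d n k * (2 * u k) powr (p - 1)) +
          6 powr p * (\<tau> * (c n k powr p + u k powr p) + C * young_gap p (c n k) (u k))"
        using powr_deviation_le[OF p c[OF n] u d(1)[OF n] d(2)[OF n], of k k] by linarith
    qed
    also have "\<dots> = 2 powr p * (2 * u k) powr (p - 1) * D' k +
        6 powr p * (\<tau> * (P k + L * u k powr p) + C * G k)"
      unfolding G D'_def P_def L
      by (simp add: distrib_left sum.distrib sum_distrib_left sum_distrib_right mult_ac)
    also have "\<dots> = 2 powr p * 2 powr (p - 1) * (u k powr (p - 1) * D' k) +
        6 powr p * (\<tau> * (P k + L * u k powr p) + C * G k)"
      by (simp add: powr_mult)
    also have "\<dots> \<le> H k"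
    proof -
      have "D' k \<le> (\<Sum>n\<in>I. a n * (2 * c n k))"
        unfolding D'_def by (intro sum_mono mult_left_mono d a)
      also have "\<dots> = 2 * (V * u k)" by (simp add: Vu sum_distrib_left mult.left_commute)
      finally have D2: "D' k \<le> 2 * (V * u k)" .
      have D0: "0 \<le> D' k" unfolding D'_def by (intro sum_nonneg mult_nonneg_nonneg d a)
      show ?thesis
        unfolding H_def using p
        by (intro add_right_mono mult_left_mono
            powr_mult_deviation_sum_le[OF _ V u w \<eta>' \<epsilon>' D0 D2 D[folded D'_def]]) auto
    qed
    finally show ?thesis .
  qed
  have "(\<lambda>k. \<Sum>n\<in>I. a n * (d n k + \<bar>c n k - u k\<bar>) powr p) sums
      (\<Sum>n\<in>I. a n * (\<Sum>k. (d n k + \<bar>c n k - u k\<bar>) powr p))"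
    by (intro sums_sum sums_mult summable_sums E)
  then have "(\<Sum>n\<in>I. a n * (\<Sum>k. (d n k + \<bar>c n k - u k\<bar>) powr p)) \<le>
      2 powr p * 2 powr (p - 1) * (V * (\<epsilon>' * 1 + 2 / \<eta>' * (1 - W' / V powr p))) +
      6 powr p * (\<tau> * (Q + L * 1) + C * (Q / p + (1 - 1/p) * (L * 1) - V * 1))"
    by (rule sums_le[OF point _ Hs])
  also have "\<dots> \<le> 2 powr p * 2 powr (p - 1) * (L * (\<epsilon>' + 2 / \<eta>' * \<theta>)) +
      6 powr p * (\<tau> * (L + L) + C * (\<eta> * L))"
  proof -
    \<comment> \<open>\<open>W\<close> is relative to L, whereas the loss in H is relative to V; V
      \<le> L makes the comparison go the right way.\<close>
    have "(1 - \<theta>) * V powr p \<le> (1 - \<theta>) * L powr p"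
      using V_le V p \<theta> by (intro mult_left_mono powr_mono2) auto
    then have "1 - W' / V powr p \<le> \<theta>" using W V by (simp add: W'_def field_simps)
    then have 1: "\<epsilon>' * 1 + 2 / \<eta>' * (1 - W' / V powr p) \<le> \<epsilon>' + 2 / \<eta>' * \<theta>"
      using \<eta>' by (intro add_mono mult_left_mono) auto
    have "V * (\<epsilon>' * 1 + 2 / \<eta>' * (1 - W' / V powr p)) \<le> V * (\<epsilon>' + 2 / \<eta>' * \<theta>)"
      using 1 V by (intro mult_left_mono) auto
    also have "\<dots> \<le> L * (\<epsilon>' + 2 / \<eta>' * \<theta>)"
      using V_le \<epsilon>' \<eta>' \<theta> by (intro mult_right_mono) auto
    finally have 2: "V * (\<epsilon>' * 1 + 2 / \<eta>' * (1 - W' / V powr p)) \<le> L * (\<epsilon>' + 2 / \<eta>' * \<theta>)" .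
    show ?thesis
      using 2 QL sumG \<tau> C by (intro add_mono mult_left_mono) auto
  qed
  also have "\<dots> = L * (2 powr p * 2 powr (p - 1) * (\<epsilon>' + 2 / \<eta>' * \<theta>) + 6 powr p * (2 * \<tau> + C * \<eta>))"
    by (simp add: algebra_simps)
  finally show "(\<Sum>n\<in>I. a n * (\<Sum>k. (d n k + \<bar>c n k - u k\<bar>) powr p)) \<le>
      L * (2 powr p * 2 powr (p - 1) * (\<epsilon>' + 2 / \<eta>' * \<theta>) + 6 powr p * (2 * \<tau> + C * \<eta>))" .
qed

subsection \<open>Alignment in \<open>\<ell>\<^sub>p\<close> sums\<close>

lemma (in normed_space_on) approx_alignable_mono:
  assumes "approx_alignable X \<eta>' \<epsilon>'" "\<eta> \<le> \<eta>'" "\<epsilon>' \<le> \<epsilon>"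
  shows "approx_alignable X \<eta> \<epsilon>"
  unfolding approx_alignable_def
proof (intro allI impI, elim conjE)
  fix I :: "nat set" and y :: "nat \<Rightarrow> 'a"
  assume I: "finite I" and y: "\<forall>n\<in>I. y n \<in> vectors X"
    and le: "(1 - \<eta>) * (\<Sum>n\<in>I. nrm X (y n)) \<le> nrm X (\<Sum>n\<in>I. y n)"
  have S0: "0 \<le> (\<Sum>n\<in>I. nrm X (y n))" using y by (intro sum_nonneg nrm_nonneg) auto
  have le': "(1 - \<eta>') * (\<Sum>n\<in>I. nrm X (y n)) \<le> nrm X (\<Sum>n\<in>I. y n)"
    using mult_right_mono[OF _ S0, of "1 - \<eta>'" "1 - \<eta>"] assms(2) le by simp
  obtain z where z: "\<And>n. n \<in> I \<Longrightarrow> z n \<in> vectors X"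
    and al: "\<And>b. (\<And>n. n \<in> I \<Longrightarrow> 0 \<le> b n) \<Longrightarrow>
        nrm X (\<Sum>n\<in>I. scale X (of_real (b n)) (z n)) = (\<Sum>n\<in>I. b n * nrm X (y n))"
    and close: "(\<Sum>n\<in>I. nrm X (y n - z n)) \<le> \<epsilon>' * (\<Sum>n\<in>I. nrm X (y n))"
    by (rule approx_alignableE[OF assms(1) I bspec[OF y] le']) blast+
  have "(\<Sum>n\<in>I. nrm X (y n - z n)) \<le> \<epsilon> * (\<Sum>n\<in>I. nrm X (y n))"
    using close mult_right_mono[OF assms(3) S0] by simp
  then show "\<exists>z. (\<forall>n\<in>I. z n \<in> vectors X) \<and>
      (\<forall>b. (\<forall>n\<in>I. 0 \<le> b n) \<longrightarrow>
         nrm X (\<Sum>n\<in>I. scale X (of_real (b n)) (z n)) = (\<Sum>n\<in>I. b n * nrm X (y n))) \<and>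
      (\<Sum>n\<in>I. nrm X (y n - z n)) \<le> \<epsilon> * (\<Sum>n\<in>I. nrm X (y n))"
    using z al by (intro exI[of _ z] conjI) auto
qed

text \<open>For \<open>p = 1\<close> it suffices to align in each coordinate. The coordinates in which the
  given vectors are far from aligned carry little mass, so there any unit vector will do.\<close>

lemma approx_alignable_l1_sum:
  fixes X :: "nat \<Rightarrow> ('k::real_or_complex, 'a::ab_group_add) nspace"
  assumes X: "\<And>k. normed_space_on (X k)" and nontrivial: "\<And>k. vectors (X k) \<noteq> {0}"
    and unif: "\<And>\<epsilon>. 0 < \<epsilon> \<Longrightarrow> \<exists>\<eta>>0. \<forall>k. approx_alignable (X k) \<eta> \<epsilon>"
    and \<epsilon>: "0 < \<epsilon>"
  shows "\<exists>\<eta>>0. approx_alignable (lp_sum 1 X) \<eta> \<epsilon>"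
proof -
  interpret X: normed_space_on "X k" for k by (rule X)
  obtain \<eta>1 where \<eta>1: "0 < \<eta>1" "\<And>k. approx_alignable (X k) \<eta>1 (\<epsilon> / 4)"
    using unif[of "\<epsilon> / 4"] \<epsilon> by auto
  define \<eta>' where "\<eta>' = min \<eta>1 (1/2)"
  have \<eta>': "0 < \<eta>'" "0 \<le> \<eta>'" "\<eta>' < 1" using \<eta>1(1) by (auto simp: \<eta>'_def)
  have approx: "approx_alignable (X k) \<eta>' (\<epsilon> / 4)" for k
    by (rule X.approx_alignable_mono[OF \<eta>1(2)]) (auto simp: \<eta>'_def)
  \<comment> \<open>In coordinates that are not nearly aligned, v is at most (v - w) / \<eta>', so
    these have mass at most \<epsilon> L / 4. Each is charged twice its mass, giving \<epsilon> / 2;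
    the other half is the doubled alignment error \<epsilon> / 4.\<close>
  have "approx_alignable (lp_sum 1 X) (\<eta>' * \<epsilon> / 4) \<epsilon>"
    unfolding approx_alignable_def
  proof (intro allI impI, elim conjE)
    let ?Y = "lp_sum 1 X"
    fix I :: "nat set" and y :: "nat \<Rightarrow> nat \<Rightarrow> 'a"
    assume I: "finite I" and y: "\<forall>n\<in>I. y n \<in> vectors ?Y"
      and le: "(1 - \<eta>' * \<epsilon> / 4) * (\<Sum>n\<in>I. nrm ?Y (y n)) \<le> nrm ?Y (\<Sum>n\<in>I. y n)"
    have yk: "y n k \<in> vectors (X k)" if "n \<in> I" for n k using y that by (simp add: vectors_lp_sum)
    define b where "b n k = nrm (X k) (y n k)" for n k
    have b0: "0 \<le> b n k" if "n \<in> I" for n k by (simp add: b_def X.nrm_nonneg yk that)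
    have bs: "summable (b n)" if "n \<in> I" for n
      using y that by (simp add: vectors_lp_sum b_def[abs_def] X.nrm_nonneg yk)
    define v where "v k = (\<Sum>n\<in>I. b n k)" for k
    define w where "w k = nrm (X k) (\<Sum>n\<in>I. y n k)" for k
    have w0: "0 \<le> w k" for k unfolding w_def by (intro X.nrm_nonneg X.sum_mem yk)
    have wv: "w k \<le> v k" for k unfolding w_def v_def b_def by (intro X.nrm_sum_le yk)
    have nrmY: "nrm ?Y f = (\<Sum>k. nrm (X k) (f k))" if "\<And>k. f k \<in> vectors (X k)" "summable (\<lambda>k. nrm (X k) (f k))" for f
      using that by (simp add: nrm_lp_sum X.nrm_nonneg suminf_nonneg)
    have nb: "nrm ?Y (y n) = (\<Sum>k. b n k)" if "n \<in> I" for n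
      using nrmY[of "y n"] yk[OF that] bs[OF that] by (simp add: b_def[abs_def])
    define L where "L = (\<Sum>n\<in>I. nrm ?Y (y n))"
    have vs: "v sums L"
      unfolding v_def L_def by (simp add: nb, intro sums_sum summable_sums bs)
    have ws: "summable w"
      by (rule summable_comparison_test'[OF sums_summable[OF vs], of 0]) (simp add: w0 wv)
    have nw: "nrm ?Y (\<Sum>n\<in>I. y n) = (\<Sum>k. w k)"
      using nrmY[of "\<Sum>n\<in>I. y n"] ws by (simp add: sum_fun_eval X.sum_mem yk w_def[abs_def])
    have "\<forall>k. \<exists>\<zeta>. (\<forall>n\<in>I. \<zeta> n \<in> vectors (X k) \<and> nrm (X k) (\<zeta> n) = 1) \<and>
      (\<forall>\<beta>. (\<forall>n\<in>I. 0 \<le> \<beta> n) \<longrightarrow> nrm (X k) (\<Sum>n\<in>I. scale (X k) (of_real (\<beta> n)) (\<zeta> n)) = (\<Sum>n\<in>I. \<beta> n)) \<and>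
      ((1 - \<eta>') * (\<Sum>n\<in>I. nrm (X k) (y n k)) \<le> nrm (X k) (\<Sum>n\<in>I. y n k) \<longrightarrow>
        (\<Sum>n\<in>I. nrm (X k) (y n k - scale (X k) (of_real (nrm (X k) (y n k))) (\<zeta> n))) \<le>
          2 * (\<epsilon> / 4) * (\<Sum>n\<in>I. nrm (X k) (y n k)))"
      using \<epsilon> by (intro allI X.ex_aligned_unit_vectors[OF approx \<eta>'(2,3) _ nontrivial I yk]) auto
    from choice[OF this] obtain \<zeta> where \<zeta>_all: "\<forall>k. (\<forall>n\<in>I. \<zeta> k n \<in> vectors (X k) \<and> nrm (X k) (\<zeta> k n) = 1) \<and>
      (\<forall>\<beta>. (\<forall>n\<in>I. 0 \<le> \<beta> n) \<longrightarrow> nrm (X k) (\<Sum>n\<in>I. scale (X k) (of_real (\<beta> n)) (\<zeta> k n)) = (\<Sum>n\<in>I. \<beta> n)) \<and>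
      ((1 - \<eta>') * v k \<le> w k \<longrightarrow>
        (\<Sum>n\<in>I. nrm (X k) (y n k - scale (X k) (of_real (b n k)) (\<zeta> k n))) \<le> 2 * (\<epsilon> / 4) * v k)"
      unfolding v_def w_def b_def by (elim exE)
    then have \<zeta>: "\<zeta> k n \<in> vectors (X k)" "nrm (X k) (\<zeta> k n) = 1" if "n \<in> I" for n k
      using that by auto
    have align: "nrm (X k) (\<Sum>n\<in>I. scale (X k) (of_real (\<beta> n)) (\<zeta> k n)) = (\<Sum>n\<in>I. \<beta> n)"
      if "\<And>n. n \<in> I \<Longrightarrow> 0 \<le> \<beta> n" for \<beta> k using \<zeta>_all that by auto
    have good: "(\<Sum>n\<in>I. nrm (X k) (y n k - scale (X k) (of_real (b n k)) (\<zeta> k n))) \<le> \<epsilon> / 2 * v k"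
      if "(1 - \<eta>') * v k \<le> w k" for k using \<zeta>_all that by auto
    \<comment> \<open>Every coordinate norm is kept. For p = 1 norms add over coordinates, so
      alignment within each coordinate gives alignment in the sum.\<close>
    define z where "z n k = scale (X k) (of_real (b n k)) (\<zeta> k n)" for n k
    have zk: "z n k \<in> vectors (X k)" if "n \<in> I" for n k by (simp add: z_def X.scale_mem \<zeta> that)
    have nz: "nrm (X k) (z n k) = b n k" if "n \<in> I" for n k
      using that b0[OF that] by (simp add: z_def X.nrm_scale \<zeta>)
    define d where "d n k = nrm (X k) (y n k - z n k)" for n k
    have d0: "0 \<le> d n k" if "n \<in> I" for n k by (simp add: d_def X.nrm_nonneg X.diff_mem yk zk that)
    have d2: "d n k \<le> 2 * b n k" if "n \<in> I" for n k
      using X.nrm_diff_le[OF yk zk, OF that that, of k] nz[OF that] by (simp add: d_def b_def)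
    have ds: "summable (d n)" if "n \<in> I" for n
      by (rule summable_comparison_test'[OF summable_mult[OF bs[OF that], of 2], of 0])
        (simp add: d0 d2 that)
    have nd: "nrm ?Y (y n - z n) = (\<Sum>k. d n k)" if "n \<in> I" for n
      using nrmY[of "y n - z n"] ds[OF that] by (simp add: X.diff_mem yk zk that d_def[abs_def])
    show "\<exists>z. (\<forall>n\<in>I. z n \<in> vectors ?Y) \<and>
        (\<forall>b. (\<forall>n\<in>I. 0 \<le> b n) \<longrightarrow>
           nrm ?Y (\<Sum>n\<in>I. scale ?Y (of_real (b n)) (z n)) = (\<Sum>n\<in>I. b n * nrm ?Y (y n))) \<and>
        (\<Sum>n\<in>I. nrm ?Y (y n - z n)) \<le> \<epsilon> * (\<Sum>n\<in>I. nrm ?Y (y n))"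
    proof (intro exI[of _ z] conjI ballI allI impI)
      show "z n \<in> vectors ?Y" if "n \<in> I" for n
        using bs[OF that] b0[OF that] by (simp add: vectors_lp_sum zk nz that)
      fix \<beta> :: "nat \<Rightarrow> real" assume \<beta>: "\<forall>n\<in>I. 0 \<le> \<beta> n"
      define Z where "Z = (\<Sum>n\<in>I. scale ?Y (of_real (\<beta> n)) (z n))"
      have Zk: "Z k = (\<Sum>n\<in>I. scale (X k) (of_real (\<beta> n)) (z n k))" for k
        by (simp add: Z_def sum_fun_eval scale_lp_sum)
      have "Z k = (\<Sum>n\<in>I. scale (X k) (of_real (\<beta> n * b n k)) (\<zeta> k n))" for k
        unfolding Zk by (rule sum.cong) (simp_all add: z_def X.scale_scale \<zeta>)
      then have nZ: "nrm (X k) (Z k) = (\<Sum>n\<in>I. \<beta> n * b n k)" for k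
        using align[of "\<lambda>n. \<beta> n * b n k" k] \<beta> b0 by simp
      have sums: "(\<lambda>k. nrm (X k) (Z k)) sums (\<Sum>n\<in>I. \<beta> n * nrm ?Y (y n))"
        unfolding nZ by (simp add: nb, intro sums_sum sums_mult summable_sums bs)
      have "nrm ?Y Z = (\<Sum>k. nrm (X k) (Z k))"
        by (rule nrmY[OF _ sums_summable[OF sums]]) (simp add: Zk X.sum_mem X.scale_mem zk)
      then show "nrm ?Y (\<Sum>n\<in>I. scale ?Y (of_real (\<beta> n)) (z n)) = (\<Sum>n\<in>I. \<beta> n * nrm ?Y (y n))"
        using sums_unique[OF sums] by (simp add: Z_def)
    next
      have point: "(\<Sum>n\<in>I. d n k) \<le> \<epsilon> / 2 * v k + 2 / \<eta>' * (v k - w k)" for k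
      proof (cases "(1 - \<eta>') * v k \<le> w k")
        case True
        have "0 \<le> 2 / \<eta>' * (v k - w k)" using wv[of k] \<eta>' by simp
        then show ?thesis using good[OF True] by (simp add: d_def z_def)
      next
        case False
        have "(\<Sum>n\<in>I. d n k) \<le> 2 * v k"
          unfolding v_def sum_distrib_left by (intro sum_mono d2)
        also have "\<dots> \<le> 2 / \<eta>' * (v k - w k)" using False \<eta>' by (simp add: field_simps)
        also have "\<dots> \<le> \<epsilon> / 2 * v k + 2 / \<eta>' * (v k - w k)"
          using \<epsilon> w0[of k] wv[of k] by simp
        finally show ?thesis .
      qed
      have "(\<lambda>k. \<Sum>n\<in>I. d n k) sums (\<Sum>n\<in>I. nrm ?Y (y n - z n))"
        by (simp add: nd, intro sums_sum summable_sums ds)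
      moreover have "(\<lambda>k. \<epsilon> / 2 * v k + 2 / \<eta>' * (v k - w k)) sums
          (\<epsilon> / 2 * L + 2 / \<eta>' * (L - (\<Sum>k. w k)))"
        by (intro sums_add sums_mult sums_diff vs summable_sums ws)
      ultimately have "(\<Sum>n\<in>I. nrm ?Y (y n - z n)) \<le> \<epsilon> / 2 * L + 2 / \<eta>' * (L - (\<Sum>k. w k))"
        by (rule sums_le[OF point])
      also have "\<dots> \<le> \<epsilon> / 2 * L + 2 / \<eta>' * (\<eta>' * \<epsilon> / 4 * L)"
        using le \<eta>' by (intro add_left_mono mult_left_mono) (auto simp: nw L_def algebra_simps)
      also have "\<dots> = \<epsilon> * L" using \<eta>' by (simp add: field_simps)
      finally show "(\<Sum>n\<in>I. nrm ?Y (y n - z n)) \<le> \<epsilon> * (\<Sum>n\<in>I. nrm ?Y (y n))"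
        by (simp add: L_def)
    qed
  qed
  then show ?thesis using \<eta>' \<epsilon> by (intro exI[of _ "\<eta>' * \<epsilon> / 4"]) simp
qed

text \<open>Each of the four terms gets a quarter of \<kappa>. Two quarters are fixed in advance;
  \<theta> is chosen for the third given \<eta>', and \<eta> for the fourth given C and
  \<theta>.\<close>

lemma ex_lp_parameters:
  fixes \<kappa> B C \<eta>' :: real
  assumes p: "1 < p" and "0 < \<kappa>" "0 < B" "0 < M" "0 \<le> C" "0 < \<eta>'"
  shows "\<exists>\<eta> \<theta>. 0 < \<eta> \<and> \<eta> < 1 \<and> 0 \<le> \<theta> \<and> \<theta> \<le> 1 \<and> 1 - \<theta> \<le> (1 - \<eta>) powr p \<and>
    B * (\<kappa> / (4 * B) + 2 / \<eta>' * \<theta>) + M * (2 * (\<kappa> / (8 * M)) + C * \<eta>) \<le> \<kappa>"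
proof -
  define \<theta> where "\<theta> = min 1 (\<kappa> * \<eta>' / (8 * B))"
  have \<theta>: "0 < \<theta>" "\<theta> \<le> 1" using assms by (auto simp: \<theta>_def)
  have "\<theta> \<le> \<kappa> * \<eta>' / (8 * B)" by (simp add: \<theta>_def)
  then have 1: "B * (2 / \<eta>' * \<theta>) \<le> \<kappa> / 4" using assms by (simp add: field_simps)
  \<comment> \<open>C + 1 in the denominator because C may be 0. The middle entry comes from solving
    1 - \<theta> \<le> (1 - \<eta>)^p for \<eta>.\<close>
  define \<eta> where "\<eta> = min (1/2) (min (1 - (1 - \<theta>) powr (1/p)) (\<kappa> / (4 * M * (C + 1))))"
  have "(1 - \<theta>) powr (1/p) < 1 powr (1/p)"
    using p \<theta> by (intro powr_less_mono2) auto
  then have \<eta>: "0 < \<eta>" "\<eta> < 1" using assms by (auto simp: \<eta>_def)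
  have "(1 - \<theta>) powr (1/p) \<le> 1 - \<eta>" by (simp add: \<eta>_def)
  then have "((1 - \<theta>) powr (1/p)) powr p \<le> (1 - \<eta>) powr p"
    using p by (intro powr_mono2) auto
  then have 2: "1 - \<theta> \<le> (1 - \<eta>) powr p" using p \<theta> by (simp add: powr_powr)
  have "\<eta> \<le> \<kappa> / (4 * M * (C + 1))" by (simp add: \<eta>_def)
  moreover have "0 < 4 * M * (C + 1)" using assms by simp
  ultimately have "\<eta> * (4 * M * (C + 1)) \<le> \<kappa>" by (simp only: pos_le_divide_eq)
  then have "M * ((C + 1) * \<eta>) \<le> \<kappa> / 4" by (simp add: algebra_simps)
  moreover have "M * (C * \<eta>) \<le> M * ((C + 1) * \<eta>)"
    using assms \<eta> by (intro mult_left_mono mult_right_mono) auto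
  ultimately have 3: "M * (C * \<eta>) \<le> \<kappa> / 4" by linarith
  have "B * (\<kappa> / (4 * B)) = \<kappa> / 4" "M * (2 * (\<kappa> / (8 * M))) = \<kappa> / 4" using assms by simp_all
  then have "B * (\<kappa> / (4 * B) + 2 / \<eta>' * \<theta>) + M * (2 * (\<kappa> / (8 * M)) + C * \<eta>) \<le> \<kappa>"
    unfolding distrib_left using 1 3 by linarith
  then show ?thesis using \<eta> \<theta> 2 by (intro exI[of _ \<eta>] exI[of _ \<theta>]) auto
qed

text \<open>For \<open>p > 1\<close> almost maximality of the norm of the sum forces the normalised norm
  sequences of the vectors to be close to one common unit vector \<open>u\<close> of the scalar space, and
  the aligned vectors are taken with norm sequences proportional to \<open>u\<close>.\<close>

lemma approx_alignable_lp_sum: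
  fixes X :: "nat \<Rightarrow> ('k::real_or_complex, 'a::ab_group_add) nspace"
  assumes X: "\<And>k. normed_space_on (X k)" and nontrivial: "\<And>k. vectors (X k) \<noteq> {0}"
    and unif: "\<And>\<epsilon>. 0 < \<epsilon> \<Longrightarrow> \<exists>\<eta>>0. \<forall>k. approx_alignable (X k) \<eta> \<epsilon>"
    and p: "1 < p" and \<epsilon>: "0 < \<epsilon>"
  shows "\<exists>\<eta>>0. approx_alignable (lp_sum p X) \<eta> \<epsilon>"
proof -
  interpret X: normed_space_on "X k" for k by (rule X)
  interpret Y: normed_space_on "lp_sum p X" by (rule normed_space_lp_sum) (use X p in auto)
  \<comment> \<open>\<open>le_add_powr\<close> will cost s directly and s^(1-p) \<kappa> through the
    p-th powers. With \<kappa> = s^p the latter is again s, and together they make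
    \<epsilon>.\<close>
  define s where "s = \<epsilon> / 2"
  define \<kappa> where "\<kappa> = s powr p"
  have s: "0 < s" and \<kappa>: "0 < \<kappa>" using \<epsilon> by (simp_all add: s_def \<kappa>_def)
  define B :: real where "B = 2 powr p * 2 powr (p - 1)"
  define M :: real where "M = 6 powr p"
  have BM: "0 < B" "0 < M" by (simp_all add: B_def M_def)
  define \<epsilon>' where "\<epsilon>' = \<kappa> / (4 * B)"
  define \<tau> where "\<tau> = \<kappa> / (8 * M)"
  have \<epsilon>': "0 < \<epsilon>'" and \<tau>: "0 < \<tau>" using \<kappa> BM by (simp_all add: \<epsilon>'_def \<tau>_def)
  obtain \<eta>1 where \<eta>1: "0 < \<eta>1" "\<And>k. approx_alignable (X k) \<eta>1 (\<epsilon>' / 2)"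
    using unif[of "\<epsilon>' / 2"] \<epsilon>' by auto
  define \<eta>' where "\<eta>' = min \<eta>1 (1/2)"
  have \<eta>': "0 < \<eta>'" "0 \<le> \<eta>'" "\<eta>' < 1" using \<eta>1(1) by (auto simp: \<eta>'_def)
  have approx: "approx_alignable (X k) \<eta>' (\<epsilon>' / 2)" for k
    by (rule X.approx_alignable_mono[OF \<eta>1(2)]) (auto simp: \<eta>'_def)
  obtain C where C: "0 \<le> C" and "\<forall>a\<ge>0. \<forall>b\<ge>0. \<bar>a - b\<bar> powr p \<le> \<tau> * (a powr p + b powr p) + C * young_gap p a b"
    using powr_dist_le_young_gap[OF p \<tau>] by blast
  then have gap: "\<bar>a - b\<bar> powr p \<le> \<tau> * (a powr p + b powr p) + C * young_gap p a b"
    if "0 \<le> a" "0 \<le> b" for a b using that by simp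
  obtain \<eta> \<theta> where \<eta>: "0 < \<eta>" "\<eta> < 1" and \<theta>: "0 \<le> \<theta>" "\<theta> \<le> 1" "1 - \<theta> \<le> (1 - \<eta>) powr p"
    and total: "B * (\<epsilon>' + 2 / \<eta>' * \<theta>) + M * (2 * \<tau> + C * \<eta>) \<le> \<kappa>"
    using ex_lp_parameters[OF p \<kappa> BM C \<eta>'(1)] unfolding \<epsilon>'_def \<tau>_def by blast
  have "approx_alignable (lp_sum p X) \<eta> \<epsilon>"
    unfolding approx_alignable_def
  proof (intro allI impI, elim conjE)
    let ?Y = "lp_sum p X"
    fix I :: "nat set" and y :: "nat \<Rightarrow> nat \<Rightarrow> 'a"
    assume I: "finite I" and yY: "\<forall>n\<in>I. y n \<in> vectors ?Y"
      and le: "(1 - \<eta>) * (\<Sum>n\<in>I. nrm ?Y (y n)) \<le> nrm ?Y (\<Sum>n\<in>I. y n)"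
    have yk: "y n k \<in> vectors (X k)" if "n \<in> I" for n k using yY that by (simp add: vectors_lp_sum)
    define a where "a n = nrm ?Y (y n)" for n
    define L where "L = (\<Sum>n\<in>I. a n)"
    have a0: "0 \<le> a n" for n by (simp add: a_def nrm_lp_sum)
    have y0: "y n = 0" if "n \<in> I" "a n = 0" for n
      using that Y.nrm_eq_0_iff[of "y n"] yY by (simp add: a_def)
    show "\<exists>z. (\<forall>n\<in>I. z n \<in> vectors ?Y) \<and>
        (\<forall>b. (\<forall>n\<in>I. 0 \<le> b n) \<longrightarrow>
           nrm ?Y (\<Sum>n\<in>I. scale ?Y (of_real (b n)) (z n)) = (\<Sum>n\<in>I. b n * nrm ?Y (y n))) \<and>
        (\<Sum>n\<in>I. nrm ?Y (y n - z n)) \<le> \<epsilon> * (\<Sum>n\<in>I. nrm ?Y (y n))"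
    proof (cases "L = 0")
      case True
      then have "\<forall>n\<in>I. a n = 0"
        unfolding L_def using I a0 by (subst (asm) sum_nonneg_eq_0_iff) auto
      then have "\<forall>n\<in>I. y n = 0" using y0 by auto
      then show ?thesis
        by (intro exI[of _ "\<lambda>_. 0"]) (auto simp: Y.zero_mem Y.scale_zero_right Y.nrm_zero)
    next
      case False
      then have L: "0 < L" using sum_nonneg[of I a] a0 by (simp add: L_def)
      define b where "b n k = nrm (X k) (y n k)" for n k
      have b0: "0 \<le> b n k" if "n \<in> I" for n k by (simp add: b_def X.nrm_nonneg yk that)
      have bs: "summable (\<lambda>k. b n k powr p)" if "n \<in> I" for n
        using yY that by (simp add: vectors_lp_sum b_def)
      have ab: "a n powr p = (\<Sum>k. b n k powr p)" if "n \<in> I" for n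
        using p bs[OF that] by (simp add: a_def nrm_lp_sum powr_powr suminf_nonneg flip: b_def)
      have b_zero: "b n k = 0" if "n \<in> I" "a n = 0" for n k
        using y0[OF that] by (simp add: b_def X.nrm_zero)
      define v where "v k = (\<Sum>n\<in>I. b n k)" for k
      have v0: "0 \<le> v k" for k unfolding v_def by (intro sum_nonneg b0)
      have vs: "summable (\<lambda>k. v k powr p)"
        unfolding v_def using p b0 bs by (intro summable_powr_sum) auto
      define w where "w k = nrm (X k) (\<Sum>n\<in>I. y n k)" for k
      have w0: "0 \<le> w k" for k unfolding w_def by (intro X.nrm_nonneg X.sum_mem yk)
      have wv: "w k \<le> v k" for k unfolding w_def v_def b_def by (intro X.nrm_sum_le yk)
      have ws: "summable (\<lambda>k. w k powr p)"
        by (rule summable_powr_le[OF vs]) (use p w0 wv in auto)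
      have nw: "nrm ?Y (\<Sum>n\<in>I. y n) = (\<Sum>k. w k powr p) powr (1/p)"
        by (simp add: nrm_lp_sum sum_fun_eval w_def)
      define V where "V = (\<Sum>k. v k powr p) powr (1/p)"
      have Vp: "V powr p = (\<Sum>k. v k powr p)"
        using p vs by (simp add: V_def powr_powr suminf_nonneg)
      have wL: "(1 - \<eta>) * L \<le> (\<Sum>k. w k powr p) powr (1/p)"
        using le by (simp add: nw L_def a_def)
      also have "\<dots> \<le> V"
        unfolding V_def using p w0 wv ws vs
        by (intro powr_mono2 suminf_le suminf_nonneg) auto
      finally have VL: "(1 - \<eta>) * L \<le> V" .
      then have V: "0 < V" using L \<eta> by (smt (verit) mult_pos_pos)
      have "((1 - \<eta>) * L) powr p \<le> ((\<Sum>k. w k powr p) powr (1/p)) powr p"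
        using wL p L \<eta> by (intro powr_mono2) auto
      also have "\<dots> = (\<Sum>k. w k powr p)" using p ws by (simp add: powr_powr suminf_nonneg)
      finally have "(1 - \<eta>) powr p * L powr p \<le> (\<Sum>k. w k powr p)" by (simp add: powr_mult)
      moreover have "(1 - \<theta>) * L powr p \<le> (1 - \<eta>) powr p * L powr p"
        using \<theta> by (intro mult_right_mono) auto
      ultimately have W: "(1 - \<theta>) * L powr p \<le> (\<Sum>k. w k powr p)" by linarith
      \<comment> \<open>The common profile: the sequence of summed coordinate norms, normalised in
        the scalar l_p space.\<close>
      define u where "u k = v k / V" for k
      have u0: "0 \<le> u k" for k using v0 V by (simp add: u_def)
      have us: "(\<lambda>k. u k powr p) sums 1"
        using sums_divide[OF summable_sums[OF vs], of "V powr p"] V v0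
        by (simp add: u_def powr_divide flip: Vp)
      have "\<forall>k. \<exists>\<zeta>. (\<forall>n\<in>I. \<zeta> n \<in> vectors (X k) \<and> nrm (X k) (\<zeta> n) = 1) \<and>
        (\<forall>\<beta>. (\<forall>n\<in>I. 0 \<le> \<beta> n) \<longrightarrow> nrm (X k) (\<Sum>n\<in>I. scale (X k) (of_real (\<beta> n)) (\<zeta> n)) = (\<Sum>n\<in>I. \<beta> n)) \<and>
        ((1 - \<eta>') * (\<Sum>n\<in>I. nrm (X k) (y n k)) \<le> nrm (X k) (\<Sum>n\<in>I. y n k) \<longrightarrow>
          (\<Sum>n\<in>I. nrm (X k) (y n k - scale (X k) (of_real (nrm (X k) (y n k))) (\<zeta> n))) \<le>
            2 * (\<epsilon>' / 2) * (\<Sum>n\<in>I. nrm (X k) (y n k)))"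
        using \<epsilon>' by (intro allI X.ex_aligned_unit_vectors[OF approx \<eta>'(2,3) _ nontrivial I yk]) auto
      from choice[OF this] obtain \<zeta> where \<zeta>_all: "\<forall>k. (\<forall>n\<in>I. \<zeta> k n \<in> vectors (X k) \<and> nrm (X k) (\<zeta> k n) = 1) \<and>
        (\<forall>\<beta>. (\<forall>n\<in>I. 0 \<le> \<beta> n) \<longrightarrow> nrm (X k) (\<Sum>n\<in>I. scale (X k) (of_real (\<beta> n)) (\<zeta> k n)) = (\<Sum>n\<in>I. \<beta> n)) \<and>
        ((1 - \<eta>') * v k \<le> w k \<longrightarrow>
          (\<Sum>n\<in>I. nrm (X k) (y n k - scale (X k) (of_real (b n k)) (\<zeta> k n))) \<le> 2 * (\<epsilon>' / 2) * v k)"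
        unfolding v_def w_def b_def by (elim exE)
      then have \<zeta>: "\<zeta> k n \<in> vectors (X k)" "nrm (X k) (\<zeta> k n) = 1" if "n \<in> I" for n k
        using that by auto
      have align: "nrm (X k) (\<Sum>n\<in>I. scale (X k) (of_real (\<beta> n)) (\<zeta> k n)) = (\<Sum>n\<in>I. \<beta> n)"
        if "\<And>n. n \<in> I \<Longrightarrow> 0 \<le> \<beta> n" for \<beta> k using \<zeta>_all that by auto
      define \<rho> where "\<rho> n k = nrm (X k) (y n k - scale (X k) (of_real (b n k)) (\<zeta> k n))" for n k
      have good: "(\<Sum>n\<in>I. \<rho> n k) \<le> \<epsilon>' * v k" if "(1 - \<eta>') * v k \<le> w k" for k
        using \<zeta>_all that by (auto simp: \<rho>_def)
      have \<rho>0: "0 \<le> \<rho> n k" if "n \<in> I" for n k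
        by (simp add: \<rho>_def X.nrm_nonneg X.diff_mem X.scale_mem yk \<zeta> that)
      have \<rho>2: "\<rho> n k \<le> 2 * b n k" if "n \<in> I" for n k
        using X.nrm_diff_le[OF yk[OF that] X.scale_mem[OF \<zeta>(1)[OF that]], of k "of_real (b n k)"]
          b0[OF that, of k]
        by (simp add: \<rho>_def X.nrm_scale \<zeta> that flip: b_def)
      define c where "c n k = b n k / a n" for n k
      define d where "d n k = \<rho> n k / a n" for n k
      \<comment> \<open>If \<open>a n = 0\<close>, the division yields 0; this is consistent, since
        \<open>y n\<close> is then zero in every coordinate.\<close>
      have ac: "a n * c n k = b n k" if "n \<in> I" for n k
        using b_zero[OF that] by (cases "a n = 0") (simp_all add: c_def)
      have ad: "a n * d n k = \<rho> n k" if "n \<in> I" for n k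
        using b_zero[OF that, of k] \<rho>2[OF that, of k] \<rho>0[OF that, of k]
        by (cases "a n = 0") (simp_all add: d_def)
      have cp: "c n k powr p = b n k powr p / a n powr p" if "n \<in> I" for n k
        using b0[OF that] a0 by (simp add: c_def powr_divide)
      have cs: "summable (\<lambda>k. c n k powr p)" if "n \<in> I" for n
        unfolding cp[OF that] by (rule summable_divide[OF bs[OF that]])
      \<comment> \<open>Only an inequality: the sum is 1 unless \<open>a n = 0\<close>, where it is
        0.\<close>
      have c1: "(\<Sum>k. c n k powr p) \<le> 1" if "n \<in> I" for n
        unfolding cp[OF that] suminf_divide[OF bs[OF that]] ab[OF that, symmetric] by simp
      have Vu: "V * u k = v k" for k using V by (simp add: u_def)
      have dev:
        "n \<in> I \<Longrightarrow> summable (\<lambda>k. (d n k + \<bar>c n k - u k\<bar>) powr p)"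
        "(\<Sum>n\<in>I. a n * (\<Sum>k. (d n k + \<bar>c n k - u k\<bar>) powr p)) \<le>
          L * (2 powr p * 2 powr (p - 1) * (\<epsilon>' + 2 / \<eta>' * \<theta>) + 6 powr p * (2 * \<tau> + C * \<eta>))" for n
      proof -
        have 1: "0 \<le> c n k" "0 \<le> d n k" "d n k \<le> 2 * c n k" if "n \<in> I" for n k
          using b0[OF that, of k] \<rho>0[OF that, of k] divide_right_mono[OF \<rho>2[OF that] a0[of n], of k] a0[of n]
          by (auto simp: c_def d_def)
        have 2: "V * u k = (\<Sum>n\<in>I. a n * c n k)" for k
          unfolding Vu by (simp add: ac v_def)
        have 3: "w k \<le> V * u k" for k by (simp add: Vu wv)
        have 4: "(\<Sum>n\<in>I. a n * d n k) \<le> \<epsilon>' * (V * u k)" if "(1 - \<eta>') * (V * u k) \<le> w k" for k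
          using good[of k] that by (simp add: Vu ad)
        have 5: "\<eta>' \<le> 1" "0 \<le> \<epsilon>'" "0 \<le> \<tau>" using \<eta>' \<epsilon>' \<tau> by auto
        note dev = sum_lp_deviation_le[OF p I a0 1(1) cs c1 1(2,3) V u0 us 2 w0 3 ws \<eta>'(1) 5(1,2) 4 L_def W \<theta>(1,2)
            VL 5(3) C gap]
        show "n \<in> I \<Longrightarrow> summable (\<lambda>k. (d n k + \<bar>c n k - u k\<bar>) powr p)"
          by (rule dev(1))
        show "(\<Sum>n\<in>I. a n * (\<Sum>k. (d n k + \<bar>c n k - u k\<bar>) powr p)) \<le>
          L * (2 powr p * 2 powr (p - 1) * (\<epsilon>' + 2 / \<eta>' * \<theta>) + 6 powr p * (2 * \<tau> + C * \<eta>))"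
          by (rule dev(2))
      qed
      \<comment> \<open>The directions are those aligned in each coordinate, while the norm sequence
        is replaced by \<open>a n\<close> times u. A nonnegative combination then has norm sequence
        A u, whose norm is A.\<close>
      define z where "z n k = scale (X k) (of_real (a n * u k)) (\<zeta> k n)" for n k
      have zk: "z n k \<in> vectors (X k)" if "n \<in> I" for n k
        by (simp add: z_def X.scale_mem \<zeta> that del: of_real_mult)
      have nz: "nrm (X k) (z n k) = a n * u k" if "n \<in> I" for n k
        using that a0[of n] u0[of k] by (simp add: z_def X.nrm_scale \<zeta> norm_mult)
      have zY: "z n \<in> vectors ?Y" if "n \<in> I" for n
        using summable_mult[OF sums_summable[OF us], of "a n powr p"]
        by (simp add: vectors_lp_sum zk nz that powr_mult)
      show ?thesis
      proof (intro exI[of _ z] conjI ballI allI impI)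
        show "z n \<in> vectors ?Y" if "n \<in> I" for n by (rule zY[OF that])
        fix \<beta> :: "nat \<Rightarrow> real" assume \<beta>: "\<forall>n\<in>I. 0 \<le> \<beta> n"
        define A where "A = (\<Sum>n\<in>I. \<beta> n * a n)"
        have A: "0 \<le> A" unfolding A_def using \<beta> a0 by (intro sum_nonneg) auto
        define Z where "Z = (\<Sum>n\<in>I. scale ?Y (of_real (\<beta> n)) (z n))"
        have Zk: "Z k = (\<Sum>n\<in>I. scale (X k) (of_real (\<beta> n * (a n * u k))) (\<zeta> k n))" for k
          unfolding Z_def sum_fun_eval scale_lp_sum
          by (rule sum.cong) (simp_all add: z_def X.scale_scale \<zeta>)
        have nZ: "nrm (X k) (Z k) = A * u k" for k
          unfolding Zk using align[of "\<lambda>n. \<beta> n * (a n * u k)" k] \<beta> a0 u0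
          by (simp add: A_def sum_distrib_right mult.assoc del: of_real_mult)
        have "(\<Sum>k. (A * u k) powr p) = A powr p * (\<Sum>k. u k powr p)"
          by (simp add: powr_mult suminf_mult[OF sums_summable[OF us]])
        then have "nrm ?Y Z = (A powr p * (\<Sum>k. u k powr p)) powr (1/p)"
          by (simp add: nrm_lp_sum nZ)
        also have "\<dots> = A" using A p sums_unique[OF us] by (simp add: powr_powr)
        finally show "nrm ?Y (\<Sum>n\<in>I. scale ?Y (of_real (\<beta> n)) (z n)) = (\<Sum>n\<in>I. \<beta> n * nrm ?Y (y n))"
          by (simp add: Z_def A_def a_def)
      next
        define E where "E n = (\<Sum>k. (d n k + \<bar>c n k - u k\<bar>) powr p)" for n
        have E0: "0 \<le> E n" if "n \<in> I" for n unfolding E_def by (intro suminf_nonneg dev(1) that) simp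
        have bound: "nrm ?Y (y n - z n) \<le> a n * (s + s powr (1 - p) * E n)" if n: "n \<in> I" for n
        proof -
          have point: "nrm (X k) (y n k - z n k) \<le> a n * (d n k + \<bar>c n k - u k\<bar>)" for k
          proof -
            define r where "r = b n k - a n * u k"
            \<comment> \<open>The direction is changed at fixed length, at cost \<rho>, and then the
              length is changed along the new direction.\<close>
            have eq: "y n k - z n k =
                (y n k - scale (X k) (of_real (b n k)) (\<zeta> k n)) + scale (X k) (of_real r) (\<zeta> k n)"
              by (simp add: z_def r_def X.scale_diff_left \<zeta> n del: of_real_mult)
            have "nrm (X k) (y n k - z n k) \<le> \<rho> n k + \<bar>r\<bar>"
              unfolding eq using X.nrm_triangle[of "y n k - scale (X k) (of_real (b n k)) (\<zeta> k n)" k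
                  "scale (X k) (of_real r) (\<zeta> k n)"]
              by (simp add: X.diff_mem X.scale_mem X.nrm_scale yk \<zeta> n flip: \<rho>_def)
            also have "r = a n * (c n k - u k)" by (simp add: r_def right_diff_distrib ac n)
            finally show ?thesis using a0[of n] by (simp add: abs_mult distrib_left ad n)
          qed
          have "nrm ?Y (y n - z n) \<le> (\<Sum>k. (a n * (d n k + \<bar>c n k - u k\<bar>)) powr p) powr (1/p)"
          proof -
            have sm: "summable (\<lambda>k. (a n * (d n k + \<bar>c n k - u k\<bar>)) powr p)"
              unfolding powr_mult by (rule summable_mult[OF dev(1)[OF n]])
            have 0: "0 \<le> nrm (X k) (y n k - z n k)" for k
              by (simp add: X.nrm_nonneg X.diff_mem yk zk n)
            have "summable (\<lambda>k. nrm (X k) (y n k - z n k) powr p)"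
              by (rule summable_powr_le[OF sm _ 0 point]) (use p in simp)
            then show ?thesis
              unfolding nrm_lp_sum using p point 0 sm
              by (intro powr_mono2 suminf_le suminf_nonneg) auto
          qed
          also have "(\<Sum>k. (a n * (d n k + \<bar>c n k - u k\<bar>)) powr p) = a n powr p * E n"
            unfolding powr_mult E_def by (rule suminf_mult[OF dev(1)[OF n]])
          also have "(a n powr p * E n) powr (1/p) = a n * E n powr (1/p)" using p a0[of n] by (simp add: powr_mult powr_powr)
          \<comment> \<open>Bounds are available for the weighted sum of the \<open>E n\<close>, not
            for their p-th roots, so the root is replaced by an expression linear in
            \<open>E n\<close>.\<close>
          also have "E n powr (1/p) \<le> s + s powr (1 - p) * (E n powr (1/p)) powr p"
            using p s by (intro le_add_powr) auto
          also have "(E n powr (1/p)) powr p = E n" using p E0[OF n] by (simp add: powr_powr)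
          finally show ?thesis using a0[of n] unfolding fun_diff_def by (simp add: mult_left_mono)
        qed
        have "(\<Sum>n\<in>I. nrm ?Y (y n - z n)) \<le> (\<Sum>n\<in>I. a n * (s + s powr (1 - p) * E n))"
          by (intro sum_mono bound)
        also have "\<dots> = s * L + s powr (1 - p) * (\<Sum>n\<in>I. a n * E n)"
          by (simp add: distrib_left sum.distrib L_def sum_distrib_left mult_ac)
        also have "\<dots> \<le> s * L + s powr (1 - p) * (L * \<kappa>)"
        proof -
          have "L * (B * (\<epsilon>' + 2 / \<eta>' * \<theta>) + M * (2 * \<tau> + C * \<eta>)) \<le> L * \<kappa>"
            using total L by (intro mult_left_mono) auto
          then have "(\<Sum>n\<in>I. a n * E n) \<le> L * \<kappa>"
            using dev(2) by (simp add: E_def B_def M_def)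
          then show ?thesis by (intro add_left_mono mult_left_mono) auto
        qed
        also have "s powr (1 - p) * (L * \<kappa>) = s * L"
          using s by (simp add: \<kappa>_def mult.left_commute flip: powr_add)
        finally show "(\<Sum>n\<in>I. nrm ?Y (y n - z n)) \<le> \<epsilon> * (\<Sum>n\<in>I. nrm ?Y (y n))"
          unfolding fun_diff_def by (simp add: s_def L_def a_def)
      qed
    qed
  qed
  then show ?thesis using \<eta> by blast
qed

theorem corollary2p11:
  fixes X :: "nat \<Rightarrow> ('k::real_or_complex, 'a::ab_group_add) nspace"
    and A :: "nat set"
    and p :: real
  assumes "\<And>k. banach_space_on (X k)"
    and "\<And>k. vectors (X k) \<noteq> {0}"
    and "\<And>k. uniformly_convex (X k) \<or>
           (\<exists>K :: 't topology. compact_space K \<and> Hausdorff_space K \<and>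
              isometric_to (X k) (C_space K)) \<or>
           (\<exists>\<mu> :: 's measure. isometric_to (X k) (L1_functions \<mu>))"
    and "A = {k. uniformly_convex (X k)}"
    and "\<And>\<epsilon>. \<epsilon> > 0 \<Longrightarrow> (INF k\<in>A. modulus_of_convexity (X k) \<epsilon>) > 0"
    and "1 \<le> p"
  shows "BPBp ell1 (lp_sum p X)"
proof -
  have X: "normed_space_on (X k)" for k using assms(1)[of k] by (rule banach_space_on.axioms(1))
  interpret X: normed_space_on "X k" for k by (rule X)
  have unif: "\<exists>\<eta>>0. \<forall>k. approx_alignable (X k) \<eta> \<epsilon>" if \<epsilon>: "0 < \<epsilon>" for \<epsilon>
  proof -
    \<comment> \<open>One real d below the infimum serves every uniformly convex member. If there is
      none, the infimum is infinite and d still exists.\<close>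
    obtain d where d: "0 < d" and dA: "ereal d \<le> (INF k\<in>A. modulus_of_convexity (X k) (\<epsilon> / 2))"
      using assms(5)[of "\<epsilon> / 2"] \<epsilon> ereal_dense2[of 0] by (auto intro: less_imp_le)
    \<comment> \<open>The second entry makes \<eta> / d at most \<epsilon> / 2 for the uniformly
      convex members; the third does the same for \<eta> / t with t = \<epsilon> / 2, the parameter
      used for C(K) and L_1. The first keeps \<eta> below 1.\<close>
    define \<eta> where "\<eta> = min (1/2) (min (\<epsilon> * d / 2) (\<epsilon>\<^sup>2 / 4))"
    have \<eta>: "0 < \<eta>" "\<eta> < 1" "\<eta> \<le> \<epsilon> * d / 2" "\<eta> \<le> \<epsilon>\<^sup>2 / 4" using \<epsilon> d by (auto simp: \<eta>_def)
    have \<eta>1: "\<epsilon> / 2 + \<eta> / d \<le> \<epsilon>" using \<eta>(3) d by (simp add: field_simps)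
    have \<eta>2: "\<epsilon> / 2 + \<eta> / (\<epsilon> / 2) \<le> \<epsilon>" using \<eta>(4) \<epsilon> by (simp add: field_simps power2_eq_square)
    have "approx_alignable (X k) \<eta> \<epsilon>" for k
      using assms(3)[of k]
    proof (elim disjE exE conjE)
      assume "uniformly_convex (X k)"
      then have "(INF k\<in>A. modulus_of_convexity (X k) (\<epsilon> / 2)) \<le> modulus_of_convexity (X k) (\<epsilon> / 2)"
        by (intro INF_lower) (simp add: assms(4))
      with dA have dk: "ereal d \<le> modulus_of_convexity (X k) (\<epsilon> / 2)" by (rule order_trans)
      have "d \<le> 1 - nrm (X k) (x + y) / 2"
        if "x \<in> unit_ball (X k)" "y \<in> unit_ball (X k)" "\<epsilon> / 2 \<le> nrm (X k) (x - y)" for x y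
      proof -
        have "modulus_of_convexity (X k) (\<epsilon> / 2) \<le> ereal (1 - nrm (X k) (x + y) / 2)"
          unfolding modulus_of_convexity_def by (rule Inf_lower) (use that in blast)
        then show ?thesis using dk order_trans ereal_less_eq(3) by blast
      qed
      then have "approx_alignable (X k) \<eta> (\<epsilon> / 2 + \<eta> / d)"
        using \<epsilon> d \<eta> by (intro X.approx_alignable_uniformly_convex) auto
      then show ?thesis by (rule X.approx_alignable_mono) (use \<eta>1 in auto)
    next
      fix K :: "'t topology" assume K: "compact_space K" "isometric_to (X k) (C_space K)"
      have "approx_alignable (X k) \<eta> (\<epsilon> / 2 + \<eta> / (\<epsilon> / 2))"
        using \<epsilon> \<eta>
        by (intro approx_alignable_isometric[OF K(2) approx_alignable_C_space[OF K(1)]] C_space_closed) auto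
      then show ?thesis by (rule X.approx_alignable_mono) (use \<eta>2 in auto)
    next
      fix \<mu> :: "'s measure" assume \<mu>: "isometric_to (X k) (L1_functions \<mu>)"
      have "approx_alignable (X k) \<eta> (\<epsilon> / 2 + \<eta> / (\<epsilon> / 2))"
        using \<epsilon> \<eta>
        by (intro approx_alignable_isometric[OF \<mu> approx_alignable_L1] L1_closed) auto
      then show ?thesis by (rule X.approx_alignable_mono) (use \<eta>2 in auto)
    qed
    then show ?thesis using \<eta>(1) by blast
  qed
  show ?thesis
  proof (rule BPBp_ell1)
    show "normed_space_on (lp_sum p X)" by (rule normed_space_lp_sum[OF X assms(6)])
    show "\<exists>\<eta>>0. approx_alignable (lp_sum p X) \<eta> \<epsilon>" if "0 < \<epsilon>" for \<epsilon>
    proof (cases "p = 1")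
      case True
      then show ?thesis using approx_alignable_l1_sum[OF X assms(2) unif that] by simp
    next
      case False
      then show ?thesis using assms(6) by (intro approx_alignable_lp_sum[OF X assms(2) unif _ that]) auto
    qed
  qed
qed

end
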